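(* Let $0<r<1$, $0<p\le q<\infty$, $\omega\in\mathcal{D}$, let $\varphi,\psi$ be holomorphic self-maps of $\mathbb{B}_n$, $u,v$ weights (Borel functions on $\mathbb{B}_n$), and $\mu$ a positive Borel measure on $\mathbb{B}_n$. If $\eta+\sigma_{\varphi,r}$ or $\eta+\sigma_{\psi,r}$ is a $q$-Carleson measure (respectively vanishing $q$-Carleson measure) for $A^p_\omega$, then $uC_\varphi-vC_\psi:A^p_\omega\to L^q_\mu$ is bounded (respectively compact). Here $$\eta=(|\rho u|^qd\mu)\circ\varphi^{-1}+(|\rho v|^qd\mu)\circ\psi^{-1},\ \ \sigma_{\varphi,r}=(\chi_{G_r}|u-v|^qd\mu)\circ\varphi^{-1},\ \ \sigma_{\psi,r}=(\chi_{G_r}|u-v|^qd\mu)\circ\psi^{-1},$$ with $\rho(z)=\rho(\varphi(z),\psi(z))$ and $G_r=\{z:\rho(z)<r\}$.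
   Context: $\mathbb{B}_n$ is the open unit ball of $\mathbb{C}^n$, $dV$ the normalized volume measure. A radial weight is a positive, measurable, integrable $\omega$ with $\omega(z)=\omega(|z|)$; $\hat\omega(r)=\int_r^1\omega(s)ds$. $\omega\in\hat{\mathcal D}$ if there is $C\ge1$ with $\hat\omega(r)\le C\hat\omega(\frac{1+r}{2})$ for all $r\in[0,1)$; $\omega\in\check{\mathcal D}$ if there are $C,K>1$ with $\hat\omega(r)\ge C\hat\omega(1-\frac{1-r}{K})$ for all $r\in[0,1)$; $\mathcal D=\hat{\mathcal D}\cap\check{\mathcal D}$. $A^p_\omega$ is the space of holomorphic $f$ with $\|f\|^p_{A^p_\omega}=\int|f|^p\omega\,dV<\infty$; $L^q_\mu$ the space of measurable $g$ with $\int|g|^qd\mu<\infty$. $(uC_\varphi f)(z)=u(z)f(\varphi(z))$. The pseudohyperbolic distance is $\rho(a,z)=|\varphi_a(z)|$ with $\varphi_a$ the involutive automorphism exchanging $a$ and $0$. $(\nu\circ\varphi^{-1})(E)=\nu(\varphi^{-1}(E))$. A positive Borel measure $\nu$ is a $q$-Carleson measure for $A^p_\omega$ if the identity $A^p_\omega\to L^q_\nu$ is bounded, vanishing if it is compact; a linear map is compact if it maps bounded sequences to sequences with a convergent subsequence. *)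

theory Defs
  imports "HOL-Analysis.Analysis"
begin

definition Bn :: "(complex ^ 'n::finite) set" where
  "Bn = ball 0 1"

definition dV :: "(complex ^ 'n::finite) measure" where
  "dV = density (restrict_space lborel Bn) (\<lambda>_. inverse (emeasure lborel (Bn :: (complex ^ 'n) set)))"

definition cinner :: "complex ^ 'n::finite \<Rightarrow> complex ^ 'n \<Rightarrow> complex" where
  "cinner z w = (\<Sum>i\<in>UNIV. z $ i * cnj (w $ i))"

definition holo_scalar :: "(complex ^ 'n::finite \<Rightarrow> complex) \<Rightarrow> (complex ^ 'n) set \<Rightarrow> bool" where
  "holo_scalar f S \<longleftrightarrow> (\<forall>z\<in>S. \<exists>f'. (f has_derivative f') (at z) \<and> (\<forall>c x. f' (c *s x) = c * f' x))"

definition holo_map :: "(complex ^ 'n::finite \<Rightarrow> complex ^ 'm::finite) \<Rightarrow> (complex ^ 'n) set \<Rightarrow> bool" where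
  "holo_map F S \<longleftrightarrow> (\<forall>z\<in>S. \<exists>F'. (F has_derivative F') (at z) \<and> (\<forall>c x. F' (c *s x) = c *s F' x))"

definition holo_self_map :: "(complex ^ 'n::finite \<Rightarrow> complex ^ 'n) \<Rightarrow> bool" where
  "holo_self_map F \<longleftrightarrow> holo_map F Bn \<and> F ` Bn \<subseteq> Bn"

text \<open>Involutive automorphism of the ball exchanging a and 0.\<close>
definition ball_aut :: "complex ^ 'n::finite \<Rightarrow> complex ^ 'n \<Rightarrow> complex ^ 'n" where
  "ball_aut a z =
     (let Pz = (if a = 0 then 0 else (cinner z a / cinner a a) *s a);
          Qz = z - Pz;
          s = complex_of_real (sqrt (1 - (norm a)\<^sup>2))
      in (1 / (1 - cinner z a)) *s (a - Pz - s *s Qz))"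

definition pseudo_hyp :: "complex ^ 'n::finite \<Rightarrow> complex ^ 'n \<Rightarrow> real" where
  "pseudo_hyp a z = norm (ball_aut a z)"

text \<open>Radial weights (given by their profile on [0,1)) and the classes.\<close>
definition radial_weight :: "'n::finite itself \<Rightarrow> (real \<Rightarrow> real) \<Rightarrow> bool" where
  "radial_weight _ \<omega> \<longleftrightarrow> (\<forall>s\<in>{0..<1}. 0 < \<omega> s) \<and> \<omega> \<in> borel_measurable borel \<and>
      integrable (dV :: (complex ^ 'n) measure) (\<lambda>z. \<omega> (norm z))"

definition omega_hat :: "(real \<Rightarrow> real) \<Rightarrow> real \<Rightarrow> ennreal" where
  "omega_hat \<omega> r = (\<integral>\<^sup>+ s\<in>{r<..<1}. ennreal (\<omega> s) \<partial>lborel)"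

definition D_hat :: "(real \<Rightarrow> real) \<Rightarrow> bool" where
  "D_hat \<omega> \<longleftrightarrow> (\<exists>C\<ge>1. \<forall>r\<in>{0..<1}. omega_hat \<omega> r \<le> ennreal C * omega_hat \<omega> ((1 + r) / 2))"

definition D_check :: "(real \<Rightarrow> real) \<Rightarrow> bool" where
  "D_check \<omega> \<longleftrightarrow> (\<exists>C>1. \<exists>K>1. \<forall>r\<in>{0..<1}. omega_hat \<omega> r \<ge> ennreal C * omega_hat \<omega> (1 - (1 - r) / K))"

definition D_class :: "'n::finite itself \<Rightarrow> (real \<Rightarrow> real) \<Rightarrow> bool" where
  "D_class n \<omega> \<longleftrightarrow> radial_weight n \<omega> \<and> D_hat \<omega> \<and> D_check \<omega>"

definition Ap_integral :: "real \<Rightarrow> (real \<Rightarrow> real) \<Rightarrow> (complex ^ 'n::finite \<Rightarrow> complex) \<Rightarrow> ennreal" where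
  "Ap_integral p \<omega> f = (\<integral>\<^sup>+ z. ennreal (norm (f z) powr p * \<omega> (norm z)) \<partial>dV)"

definition Ap :: "real \<Rightarrow> (real \<Rightarrow> real) \<Rightarrow> (complex ^ 'n::finite \<Rightarrow> complex) set" where
  "Ap p \<omega> = {f. holo_scalar f Bn \<and> Ap_integral p \<omega> f < \<infinity>}"

definition Ap_norm :: "real \<Rightarrow> (real \<Rightarrow> real) \<Rightarrow> (complex ^ 'n::finite \<Rightarrow> complex) \<Rightarrow> real" where
  "Ap_norm p \<omega> f = enn2real (Ap_integral p \<omega> f) powr (1 / p)"

definition Lq_integral :: "real \<Rightarrow> 'a measure \<Rightarrow> ('a \<Rightarrow> complex) \<Rightarrow> ennreal" where
  "Lq_integral q M g = (\<integral>\<^sup>+ z. ennreal (norm (g z) powr q) \<partial>M)"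

definition in_Lq :: "real \<Rightarrow> 'a measure \<Rightarrow> ('a \<Rightarrow> complex) \<Rightarrow> bool" where
  "in_Lq q M g \<longleftrightarrow> g \<in> borel_measurable M \<and> Lq_integral q M g < \<infinity>"

definition bounded_Ap_Lq ::
  "real \<Rightarrow> real \<Rightarrow> (real \<Rightarrow> real) \<Rightarrow> (complex ^ 'n::finite) measure \<Rightarrow>
   ((complex ^ 'n \<Rightarrow> complex) \<Rightarrow> (complex ^ 'n \<Rightarrow> complex)) \<Rightarrow> bool" where
  "bounded_Ap_Lq p q \<omega> M T \<longleftrightarrow>
     (\<forall>f\<in>Ap p \<omega>. in_Lq q M (T f)) \<and>
     (\<exists>C\<ge>0. \<forall>f\<in>Ap p \<omega>. Lq_integral q M (T f) \<le> ennreal ((C * Ap_norm p \<omega> f) powr q))"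

definition compact_Ap_Lq ::
  "real \<Rightarrow> real \<Rightarrow> (real \<Rightarrow> real) \<Rightarrow> (complex ^ 'n::finite) measure \<Rightarrow>
   ((complex ^ 'n \<Rightarrow> complex) \<Rightarrow> (complex ^ 'n \<Rightarrow> complex)) \<Rightarrow> bool" where
  "compact_Ap_Lq p q \<omega> M T \<longleftrightarrow>
     (\<forall>f\<in>Ap p \<omega>. in_Lq q M (T f)) \<and>
     (\<forall>fs :: nat \<Rightarrow> complex ^ 'n \<Rightarrow> complex. (\<forall>k. fs k \<in> Ap p \<omega>) \<and> bounded (range (\<lambda>k. Ap_norm p \<omega> (fs k))) \<longrightarrow>
        (\<exists>(s :: nat \<Rightarrow> nat) (g :: complex ^ 'n \<Rightarrow> complex). strict_mono s \<and> in_Lq q M g \<and>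
           (\<lambda>k. Lq_integral q M (\<lambda>z. T (fs (s k)) z - g z)) \<longlonglongrightarrow> 0))"

definition carleson :: "real \<Rightarrow> real \<Rightarrow> (real \<Rightarrow> real) \<Rightarrow> (complex ^ 'n::finite) measure \<Rightarrow> bool" where
  "carleson p q \<omega> \<nu> \<longleftrightarrow> bounded_Ap_Lq p q \<omega> \<nu> (\<lambda>f. f)"

definition vanishing_carleson :: "real \<Rightarrow> real \<Rightarrow> (real \<Rightarrow> real) \<Rightarrow> (complex ^ 'n::finite) measure \<Rightarrow> bool" where
  "vanishing_carleson p q \<omega> \<nu> \<longleftrightarrow> compact_Ap_Lq p q \<omega> \<nu> (\<lambda>f. f)"

definition measure_plus :: "'a measure \<Rightarrow> 'a measure \<Rightarrow> 'a measure" where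
  "measure_plus M N = measure_of (space M) (sets M) (\<lambda>A. emeasure M A + emeasure N A)"

definition push :: "(complex ^ 'n::finite) measure \<Rightarrow> (complex ^ 'n \<Rightarrow> real) \<Rightarrow>
    (complex ^ 'n \<Rightarrow> complex ^ 'n) \<Rightarrow> (complex ^ 'n) measure" where
  "push \<mu> g F = distr (density \<mu> (\<lambda>z. ennreal (g z))) (restrict_space borel Bn) F"

definition wcd :: "(complex ^ 'n::finite \<Rightarrow> complex) \<Rightarrow> (complex ^ 'n \<Rightarrow> complex ^ 'n) \<Rightarrow>
    (complex ^ 'n \<Rightarrow> complex) \<Rightarrow> (complex ^ 'n \<Rightarrow> complex ^ 'n) \<Rightarrow>
    (complex ^ 'n \<Rightarrow> complex) \<Rightarrow> (complex ^ 'n \<Rightarrow> complex)" where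
  "wcd u \<phi> v \<psi> f = (\<lambda>z. u z * f (\<phi> z) - v z * f (\<psi> z))"

end

theory Submission
  imports Defs "HOL-Complex_Analysis.Complex_Analysis"
begin

text \<open>
  Where the pseudohyperbolic distance \<open>\<rho>\<close> of \<open>\<phi>(z)\<close> and \<open>\<psi>(z)\<close> is bounded below, the two terms of
  \<open>u f(\<phi>) - v f(\<psi>)\<close> are estimated separately and absorbed by \<open>\<eta>\<close>. Where \<open>\<rho>\<close> is small, it is written as
  \<open>(u - v) f(\<phi>) + v (f(\<phi>) - f(\<psi>))\<close>; the first summand is controlled by \<open>\<sigma>\<close>, and a Schwarz-type
  estimate bounds \<open>|f(\<phi>) - f(\<psi>)|\<^sup>q\<close> by \<open>\<rho>\<^sup>q\<close> times the average of \<open>|f|\<^sup>q\<close> over a pseudohyperbolic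
  neighbourhood of \<open>\<psi>(z)\<close>. So everything reduces to the inequality
  \<open>\<integral> (average of |f|\<^sup>q) d\<nu> \<le> K A \<parallel>f\<parallel>\<^sup>q\<close> with \<open>K\<close> independent of \<open>\<nu>\<close>, for \<open>\<nu>\<close> a \<open>q\<close>-Carleson measure
  with constant \<open>A\<close>. It follows by Tonelli from three facts about weights in \<open>\<D>\<close>: the norm estimate of the
  kernels \<open>((1 - |a|\<^sup>2) / (1 - \<langle>z,a\<rangle>))\<^sup>N\<close> (upper doubling), which bounds the \<open>\<nu>\<close>-measure of the
  neighbourhoods; the comparison \<open>\<integral> |f|\<^sup>p \<omega>^(|z|) / (1 - |z|) dV \<le> C \<parallel>f\<parallel>\<^sup>p\<close> (lower doubling and the
  monotonicity of integral means); and the resulting pointwise growth estimate. For compactness,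
  a vanishing Carleson measure has arbitrarily small constant near the boundary, so the same
  inequality together with locally uniform convergence of a subsequence gives norm convergence.
\<close>


unbundle no fps_syntax

section \<open>Invariance of Lebesgue measure and polar coordinates\<close>

text \<open>A weight of the class may oscillate at every scale, so it is not comparable to a
  constant on pseudohyperbolic balls and |f|^p cannot be averaged directly against it. Its smoothed
  version omega^(|z|) / (1 - |z|) is roughly constant there; all local estimates are made with it,
  and one global inequality leads back to omega. Since p and q may be below 1, integrals of powers
  replace norms throughout: the triangle inequality becomes (x + y)^q <= 2^q (x^q + y^q), and the
  submean value property is obtained for every positive exponent from one-variable circle means.
  Local changes of variables use affine charts of constant Jacobian, and spherical integrals are
  Lebesgue integrals over the ball of functions of z / |z|, so no surface measure appears. The
  radius r need not be small, while the oscillation estimate holds only for rho <= 1/40; the gap is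
  harmless because any fixed positive lower bound on rho lets eta take both terms.\<close>

lemma nn_integral_lborel_shift:
  fixes f :: "'a::euclidean_space \<Rightarrow> ennreal"
  assumes [measurable]: "f \<in> borel_measurable borel"
  shows "(\<integral>\<^sup>+x. f (c + x) \<partial>lborel) = (\<integral>\<^sup>+x. f x \<partial>lborel)"
proof -
  have "(\<integral>\<^sup>+x. f x \<partial>lborel) = (\<integral>\<^sup>+x. f x \<partial>distr lborel borel ((+) c))"
    by (simp add: lborel_distr_plus)
  also have "\<dots> = (\<integral>\<^sup>+x. f (c + x) \<partial>lborel)"
    by (subst nn_integral_distr) auto
  finally show ?thesis ..
qed

lemma nn_integral_lborel_scaleR:
  fixes f :: "'a::euclidean_space \<Rightarrow> ennreal"
  assumes [measurable]: "f \<in> borel_measurable borel" and c: "c > 0"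
  shows "(\<integral>\<^sup>+x. f x \<partial>lborel) = ennreal (c ^ DIM('a)) * (\<integral>\<^sup>+x. f (c *\<^sub>R x) \<partial>lborel)"
  using c
  by (subst lborel_affine[of c 0])
     (simp_all add: nn_integral_density nn_integral_distr nn_integral_cmult)

text \<open>Test f against the indicator \<open>U\<close> of the unit ball, which is even and
  invariant under \<open>T\<close>. The double integral of f(T x) U(y - T x) equals the integral of
  f(T x) times the volume of the ball when y goes first, and the integral of f times the same volume
  after translating x and exchanging the order. The volume cancels because it is positive and
  finite.\<close>

lemma nn_integral_lborel_isometry:
  fixes T :: "'a::euclidean_space \<Rightarrow> 'a" and f :: "'a \<Rightarrow> ennreal"
  assumes T: "orthogonal_transformation T" and f [measurable]: "f \<in> borel_measurable borel"
  shows "(\<integral>\<^sup>+x. f (T x) \<partial>lborel) = (\<integral>\<^sup>+x. f x \<partial>lborel)"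
proof -
  define U where "U = (indicator (ball 0 1) :: 'a \<Rightarrow> ennreal)"
  have [measurable]: "ball (0::'a) 1 \<in> sets borel" by simp
  have [measurable]: "U \<in> borel_measurable borel" by (simp add: U_def)
  have lin: "linear T" using T by (rule orthogonal_transformation_linear)
  have [measurable]: "T \<in> borel_measurable borel"
    using lin by (intro borel_measurable_continuous_onI linear_continuous_on linear_conv_bounded_linear[THEN iffD1])
  have nT: "norm (T x) = norm x" for x using T by (rule orthogonal_transformation_norm)
  define c where "c = (\<integral>\<^sup>+y. U y \<partial>lborel)"
  have c: "c \<noteq> 0" "c \<noteq> \<infinity>"
    using emeasure_lborel_ball_finite[of "0::'a" 1] content_ball_pos[of 1 "0::'a"]
    by (auto simp: c_def U_def measure_def zero_less_iff_neq_zero)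
  have sym: "U (- x) = U x" for x by (simp add: U_def indicator_def)
  have TU: "U (T x) = U x" for x by (simp add: U_def indicator_def nT)
  have "(\<integral>\<^sup>+x. f (T x) \<partial>lborel) * c = (\<integral>\<^sup>+x. f (T x) * c \<partial>lborel)"
    by (simp add: nn_integral_multc)
  also have "\<dots> = (\<integral>\<^sup>+x. \<integral>\<^sup>+y. f (T x) * U (- T x + y) \<partial>lborel \<partial>lborel)"
    by (subst nn_integral_cmult, simp, subst nn_integral_lborel_shift) (auto simp: c_def)
  also have "\<dots> = (\<integral>\<^sup>+y. \<integral>\<^sup>+x. f (T x) * U (- T x + y) \<partial>lborel \<partial>lborel)"
    by (rule lborel_pair.Fubini') simp
  also have "\<dots> = (\<integral>\<^sup>+y. \<integral>\<^sup>+x. f (T x + y) * U x \<partial>lborel \<partial>lborel)"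
  proof (rule nn_integral_cong)
    fix y :: 'a
    \<comment> \<open>Translating x by a preimage of y moves the dependence on y from
      \<open>U\<close> to f.\<close>
    obtain y' where y': "T y' = y" using orthogonal_transformation_surj[OF T] by (metis surjD)
    have "(\<integral>\<^sup>+x. f (T x) * U (- T x + y) \<partial>lborel) = (\<integral>\<^sup>+x. f (T (y' + x)) * U (- T (y' + x) + y) \<partial>lborel)"
      by (rule nn_integral_lborel_shift[symmetric]) simp
    also have "\<dots> = (\<integral>\<^sup>+x. f (T x + y) * U x \<partial>lborel)"
      by (rule nn_integral_cong) (simp add: linear_add[OF lin] y' sym TU add.commute)
    finally show "(\<integral>\<^sup>+x. f (T x) * U (- T x + y) \<partial>lborel) = (\<integral>\<^sup>+x. f (T x + y) * U x \<partial>lborel)" .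
  qed
  also have "\<dots> = (\<integral>\<^sup>+x. \<integral>\<^sup>+y. f (T x + y) * U x \<partial>lborel \<partial>lborel)"
    by (rule lborel_pair.Fubini') simp
  also have "\<dots> = (\<integral>\<^sup>+x. (\<integral>\<^sup>+y. f y \<partial>lborel) * U x \<partial>lborel)"
    by (subst nn_integral_multc, simp, subst nn_integral_lborel_shift) auto
  also have "\<dots> = (\<integral>\<^sup>+y. f y \<partial>lborel) * c"
    by (simp add: nn_integral_cmult c_def)
  finally show ?thesis
    using c by (simp add: mult.commute[of _ c] ennreal_mult_cancel_left)
qed

text \<open>The antiderivative is -t^(-d). In the polar formula d t^(d-1) is the radial density, one
  factor t^(-d) is the Jacobian of a dilation and the other comes from rescaling |z|^d.\<close>

lemma nn_integral_inverse_power_tail: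
  assumes "a > 0" "d > 0"
  shows "(\<integral>\<^sup>+t. ennreal (real d * t ^ (d - 1) / t ^ (2*d)) * indicator {a<..} t \<partial>lborel) = ennreal (1 / a ^ d)"
proof -
  have "((\<lambda>t::real. - (1 / t ^ d)) \<longlongrightarrow> - 0) at_top"
    unfolding divide_inverse mult_1
    by (intro tendsto_minus tendsto_inverse_0_at_top filterlim_pow_at_top filterlim_ident assms)
  hence lim: "((\<lambda>t::real. - (1 / t ^ d)) \<longlongrightarrow> 0) at_top" by simp
  have "(\<integral>\<^sup>+t. ennreal (real d * t ^ (d - 1) / t ^ (2*d)) * indicator {a<..} t \<partial>lborel)
      = (\<integral>\<^sup>+t. ennreal (real d * t ^ (d - 1) / t ^ (2*d)) * indicator {a..} t \<partial>lborel)"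
  proof (rule nn_integral_cong_AE)
    show "AE t in lborel. ennreal (real d * t ^ (d - 1) / t ^ (2*d)) * indicator {a<..} t
        = ennreal (real d * t ^ (d - 1) / t ^ (2*d)) * indicator {a..} t"
      using AE_lborel_singleton[of a] by eventually_elim (simp add: indicator_def less_le)
  qed
  also have "\<dots> = ennreal (0 - (- (1 / a ^ d)))"
  proof (rule nn_integral_FTC_atLeast[OF _ _ _ lim])
    show "((\<lambda>t. - (1 / t ^ d)) has_real_derivative real d * x ^ (d - 1) / x ^ (2 * d)) (at x)" if "a \<le> x" for x
      using that assms
      unfolding mult_2 power_add by (auto intro!: derivative_eq_intros)
    show "0 \<le> real d * x ^ (d - 1) / x ^ (2 * d)" if "a \<le> x" for x
      using that assms by auto
  qed auto
  finally show ?thesis by simp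
qed

text \<open>Both sides are compared after the substitution \<open>s = \<tau> |z|\<close>, which turns the inner integral
  into one over dilations; Tonelli and the scaling of Lebesgue measure do the rest.\<close>

lemma nn_integral_ball_polar:
  fixes F :: "'a::euclidean_space \<Rightarrow> ennreal"
  assumes [measurable]: "F \<in> borel_measurable borel"
  shows "(\<integral>\<^sup>+z. F z * indicator (ball 0 1) z \<partial>lborel) =
    (\<integral>\<^sup>+z. (\<integral>\<^sup>+s. F ((s / norm z) *\<^sub>R z) * (ennreal (real DIM('a) * s ^ (DIM('a) - 1)) * indicator {0<..<1} s) \<partial>lborel)
       * indicator (ball 0 1) z \<partial>lborel)"
proof -
  have [measurable]: "ball (0::'a) r \<in> sets borel" for r by simp
  define d where "d = DIM('a)"
  have d: "d > 0" by (simp add: d_def)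
  define w where "w = (\<lambda>t. ennreal (real d * t ^ (d - 1)))"
  have [measurable]: "w \<in> borel_measurable borel" by (simp add: w_def)
  \<comment> \<open>The constraints 0 < t, |z| < 1 and |t z| < 1. Replacing z by z / t turns the
    last two into |z| < t and |z| < 1, so that for fixed z the variable t runs over |z| < t, where
    its integral is explicit.\<close>
  define I where "I = (\<lambda>t z. indicator {0<..} (t::real) * indicator (ball 0 1) (z::'a) * indicator (ball 0 1) (t *\<^sub>R z) :: ennreal)"
  have [measurable]: "(\<lambda>(t, z). I t z) \<in> borel_measurable (borel \<Otimes>\<^sub>M borel)"
    unfolding I_def by measurable
  have [measurable]: "(\<lambda>(t, z::'a). indicator {norm z<..} t :: ennreal) \<in> borel_measurable (borel \<Otimes>\<^sub>M borel)"
  proof -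
    have "(\<lambda>(t, z::'a). indicator {norm z<..} t :: ennreal) = (\<lambda>x. if norm (snd x) < fst x then 1 else 0)"
      by (auto simp: indicator_def)
    then show ?thesis by simp
  qed
  have 1: "(\<integral>\<^sup>+s. F ((s / norm z) *\<^sub>R z) * (w s * indicator {0<..<1} s) \<partial>lborel) * indicator (ball 0 1) z
      = (\<integral>\<^sup>+t. F (t *\<^sub>R z) * (ennreal (norm z ^ d) * w t) * I t z \<partial>lborel)" if z: "z \<noteq> 0" for z
  proof -
    have "(\<integral>\<^sup>+s. F ((s / norm z) *\<^sub>R z) * (w s * indicator {0<..<1} s) \<partial>lborel)
      = ennreal \<bar>norm z\<bar> * (\<integral>\<^sup>+t. F (((0 + norm z * t) / norm z) *\<^sub>R z) * (w (0 + norm z * t) * indicator {0<..<1} (0 + norm z * t)) \<partial>lborel)"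
      using z by (intro nn_integral_real_affine) auto
    also have "\<dots> = (\<integral>\<^sup>+t. norm z * (F (t *\<^sub>R z) * (w (norm z * t) * indicator {0<..<1} (norm z * t))) \<partial>lborel)"
      using z by (subst nn_integral_cmult[symmetric]) auto
    finally have *: "(\<integral>\<^sup>+s. F ((s / norm z) *\<^sub>R z) * (w s * indicator {0<..<1} s) \<partial>lborel)
      = (\<integral>\<^sup>+t. norm z * (F (t *\<^sub>R z) * (w (norm z * t) * indicator {0<..<1} (norm z * t))) \<partial>lborel)" .
    show ?thesis
      unfolding * 
    proof (subst nn_integral_multc[symmetric], measurable, intro nn_integral_cong)
      fix t :: real
      show "norm z * (F (t *\<^sub>R z) * (w (norm z * t) * indicator {0<..<1} (norm z * t))) * indicator (ball 0 1) z
         = F (t *\<^sub>R z) * (ennreal (norm z ^ d) * w t) * I t z"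
      proof (cases "0 < t")
        case True
        have "ennreal (norm z) * w (norm z * t) = ennreal (norm z ^ d) * w t"
          unfolding w_def using True d
          by (cases d) (auto simp: ennreal_mult'[symmetric] power_mult_distrib mult_ac)
        moreover have "(0 < norm z * t \<and> norm z * t < 1) = (t *\<^sub>R z \<in> ball 0 1)"
          using True z by (simp add: mult.commute)
        ultimately show ?thesis using True
          by (auto simp: I_def indicator_def mult_ac) (metis mult.left_commute mult.commute)
      next
        case False
        then have "\<not> 0 < norm z * t" by (simp add: mult_nonneg_nonpos not_less)
        then show ?thesis using False by (simp add: I_def)
      qed
    qed
  qed
  have 2: "(\<integral>\<^sup>+z. F (t *\<^sub>R z) * (ennreal (norm z ^ d) * w t) * I t z \<partial>lborel)
      = (\<integral>\<^sup>+z. F z * ennreal (norm z ^ d) * indicator (ball 0 1) z * (ennreal (real d * t ^ (d - 1) / t ^ (2*d)) * indicator {norm z<..} t) \<partial>lborel)"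
    (is "?l = ?r") for t
  proof (cases "t > 0")
    case True
    define g where "g = (\<lambda>z. F z * (ennreal ((norm z / t) ^ d) * w t) * (indicator (ball 0 1) z * indicator (ball 0 t) z))"
    have [measurable]: "g \<in> borel_measurable borel" unfolding g_def by simp
    have "t ^ d > 0" using True by simp
    have "?l = (\<integral>\<^sup>+z. g (t *\<^sub>R z) \<partial>lborel)"
      using True by (intro nn_integral_cong) (auto simp: g_def I_def indicator_def)
    also have "\<dots> = ennreal (1 / t ^ d) * (ennreal (t ^ DIM('a)) * (\<integral>\<^sup>+z. g (t *\<^sub>R z) \<partial>lborel))"
      using True by (simp add: mult.assoc[symmetric] ennreal_mult'[symmetric] d_def)
    also have "\<dots> = ennreal (1 / t ^ d) * (\<integral>\<^sup>+z. g z \<partial>lborel)"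
      using nn_integral_lborel_scaleR[of g t] True by simp
    also have "\<dots> = (\<integral>\<^sup>+z. ennreal (1 / t ^ d) * g z \<partial>lborel)"
      by (simp add: nn_integral_cmult)
    also have "\<dots> = ?r"
    proof (intro nn_integral_cong)
      fix z :: 'a
      have "ennreal (1 / t ^ d) * (ennreal ((norm z / t) ^ d) * w t)
          = ennreal (norm z ^ d) * ennreal (real d * t ^ (d - 1) / t ^ (2*d))"
        unfolding w_def mult_2 power_add using True
        by (simp add: ennreal_mult'[symmetric] power_divide)
      then show "ennreal (1 / t ^ d) * g z = F z * ennreal (norm z ^ d) * indicator (ball 0 1) z * (ennreal (real d * t ^ (d - 1) / t ^ (2*d)) * indicator {norm z<..} t)"
        by (auto simp: g_def indicator_def mult_ac)
    qed
    finally show ?thesis .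
  next
    case False
    have "?l = 0" using False by (simp add: I_def)
    moreover have "?r = (\<integral>\<^sup>+(z::'a). 0 \<partial>lborel)"
    proof (rule nn_integral_cong)
      fix z :: 'a
      have "\<not> norm z < t" using False norm_ge_zero[of z] by linarith
      then show "F z * ennreal (norm z ^ d) * indicator (ball 0 1) z * (ennreal (real d * t ^ (d - 1) / t ^ (2*d)) * indicator {norm z<..} t) = 0"
        by simp
    qed
    ultimately show ?thesis by simp
  qed
  have "(\<integral>\<^sup>+z. (\<integral>\<^sup>+s. F ((s / norm z) *\<^sub>R z) * (w s * indicator {0<..<1} s) \<partial>lborel) * indicator (ball 0 1) z \<partial>lborel)
     = (\<integral>\<^sup>+z. \<integral>\<^sup>+t. F (t *\<^sub>R z) * (ennreal (norm z ^ d) * w t) * I t z \<partial>lborel \<partial>lborel)"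
    by (rule nn_integral_cong_AE[OF AE_mp[OF AE_lborel_singleton[of 0]]]) (simp add: 1)
  also have "\<dots> = (\<integral>\<^sup>+t. \<integral>\<^sup>+z. F (t *\<^sub>R z) * (ennreal (norm z ^ d) * w t) * I t z \<partial>lborel \<partial>lborel)"
    by (rule lborel_pair.Fubini') measurable
  also have "\<dots> = (\<integral>\<^sup>+t. \<integral>\<^sup>+z. F z * ennreal (norm z ^ d) * indicator (ball 0 1) z * (ennreal (real d * t ^ (d - 1) / t ^ (2*d)) * indicator {norm z<..} t) \<partial>lborel \<partial>lborel)"
    by (simp add: 2)
  also have "\<dots> = (\<integral>\<^sup>+z. \<integral>\<^sup>+t. F z * ennreal (norm z ^ d) * indicator (ball 0 1) z * (ennreal (real d * t ^ (d - 1) / t ^ (2*d)) * indicator {norm z<..} t) \<partial>lborel \<partial>lborel)"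
    by (rule lborel_pair.Fubini') measurable
  also have "\<dots> = (\<integral>\<^sup>+z. F z * indicator (ball 0 1) z \<partial>lborel)"
  proof -
    have "(\<integral>\<^sup>+t. F z * ennreal (norm z ^ d) * indicator (ball 0 1) z * (ennreal (real d * t ^ (d - 1) / t ^ (2*d)) * indicator {norm z<..} t) \<partial>lborel)
      = F z * indicator (ball 0 1) z" if z: "z \<noteq> 0" for z :: 'a
    proof -
      have "(\<integral>\<^sup>+t. F z * ennreal (norm z ^ d) * indicator (ball 0 1) z * (ennreal (real d * t ^ (d - 1) / t ^ (2*d)) * indicator {norm z<..} t) \<partial>lborel)
        = F z * ennreal (norm z ^ d) * indicator (ball 0 1) z * ennreal (1 / norm z ^ d)"
        using nn_integral_inverse_power_tail[of "norm z" d] z d by (simp add: nn_integral_cmult)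
      also have "\<dots> = F z * indicator (ball 0 1) z * (ennreal (norm z ^ d) * ennreal (1 / norm z ^ d))"
        by (simp add: mult_ac)
      also have "ennreal (norm z ^ d) * ennreal (1 / norm z ^ d) = 1"
        using z by (simp add: ennreal_mult'[symmetric])
      finally show ?thesis by simp
    qed
    then show ?thesis
      by (intro nn_integral_cong_AE eventually_mono[OF AE_lborel_singleton[of 0]]) simp
  qed
  finally show ?thesis by (simp add: w_def d_def)
qed


section \<open>Integral means on circles\<close>

lemma integral_periodic_shift:
  fixes h :: "real \<Rightarrow> real"
  assumes cont: "continuous_on UNIV h" and per: "\<And>x. h (x + 2*pi) = h x" and \<alpha>: "0 \<le> \<alpha>" "\<alpha> \<le> 2*pi"
  shows "integral {0..2*pi} (\<lambda>\<theta>. h (\<theta> + \<alpha>)) = integral {0..2*pi} h"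
proof -
  have int: "h integrable_on {a..b}" for a b
    using cont by (intro integrable_continuous_real continuous_on_subset[OF cont]) auto
  have shift: "integral {a..b} (\<lambda>\<theta>. h (\<theta> + c)) = integral {a+c..b+c} h" for a b c
    using integral_shift[of a c b h] continuous_on_subset[OF cont] by (auto simp: o_def)
  have "integral {0..2*pi} (\<lambda>\<theta>. h (\<theta> + \<alpha>)) = integral {\<alpha>..2*pi+\<alpha>} h"
    using shift[of 0 "2*pi" \<alpha>] by simp
  also have "\<dots> = integral {\<alpha>..2*pi} h + integral {2*pi..2*pi+\<alpha>} h"
    using \<alpha> by (intro Henstock_Kurzweil_Integration.integral_combine[symmetric] int) auto
  also have "integral {2*pi..2*pi+\<alpha>} h = integral {0..\<alpha>} h"
    using shift[of 0 \<alpha> "2*pi"] by (simp add: per add.commute)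
  also have "integral {\<alpha>..2*pi} h + integral {0..\<alpha>} h = integral {0..2*pi} h"
    using Henstock_Kurzweil_Integration.integral_combine[of 0 \<alpha> "2*pi" h] \<alpha> int by auto
  finally show ?thesis .
qed

text \<open>Pairing \<open>g(w e\<^sup>i\<^sup>\<theta>)\<close> with an almost unimodular function that straightens the phase of
  \<open>g\<close> on the inner circle gives a holomorphic function of \<open>w\<close>, to which the maximum principle applies.\<close>

lemma circle_mean_norm_mono:
  fixes g :: "complex \<Rightarrow> complex"
  assumes g: "g holomorphic_on ball 0 R" and st: "0 \<le> s" "s \<le> t" "t < R"
  shows "integral {0..2*pi} (\<lambda>\<theta>. norm (g (of_real s * cis \<theta>)))
       \<le> integral {0..2*pi} (\<lambda>\<theta>. norm (g (of_real t * cis \<theta>)))"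
proof (cases "s = t")
  case False
  with st have t: "s < t" "0 < t" by auto
  have contg: "continuous_on (ball 0 R) g" using g holomorphic_on_imp_continuous_on by blast
  have contd: "continuous_on (ball 0 R) (deriv g)"
    using g holomorphic_deriv holomorphic_on_imp_continuous_on open_ball by blast
  have contgr: "continuous_on UNIV (\<lambda>\<theta>. g (w * cis \<theta>))" if "norm w < R" for w
    using that by (intro continuous_on_compose2[OF contg]) (auto intro!: continuous_intros simp: norm_mult)
  have cg: "continuous_on A (\<lambda>\<theta>. g (w * cis \<theta>))" if "norm w < R" for w A
    using continuous_on_subset[OF contgr[OF that]] by auto
  define J where "J = integral {0..2*pi} (\<lambda>\<theta>. norm (g (of_real t * cis \<theta>)))"
  have rot: "integral {0..2*pi} (\<lambda>\<theta>. norm (g (w * cis \<theta>))) = J" if "norm w = t" for w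
  proof -
    have w: "w = of_real t * cis (Arg2pi w)"
      using that Arg2pi_eq[of w] by (simp add: cis_conv_exp mult.commute)
    have "integral {0..2*pi} (\<lambda>\<theta>. norm (g (w * cis \<theta>))) = integral {0..2*pi} (\<lambda>\<theta>. norm (g (of_real t * cis (\<theta> + Arg2pi w))))"
      by (subst w) (simp add: mult.assoc cis_mult add.commute)
    also have "\<dots> = J" unfolding J_def
    proof (rule integral_periodic_shift)
      show "continuous_on UNIV (\<lambda>x. norm (g (of_real t * cis x)))"
        using t st by (intro continuous_on_norm contgr) auto
      show "norm (g (of_real t * cis (x + 2*pi))) = norm (g (of_real t * cis x))" for x
        by (simp add: cis_mult[symmetric])
    qed (use Arg2pi_ge_0[of w] Arg2pi_lt_2pi[of w] in auto)
    finally show ?thesis .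
  qed
  have main: "integral {0..2*pi} (\<lambda>\<theta>. norm (g (of_real s * cis \<theta>))) \<le> J + 2*pi*\<delta>" if \<delta>: "\<delta> > 0" for \<delta>
  proof -
    \<comment> \<open>Up to \<open>\<delta>\<close>, \<open>e\<close> is the conjugate phase of g on
      the inner circle; adding \<open>\<delta>\<close> keeps it continuous at zeros of g. Then |e|
      <= 1, and on that circle g e = |g|^2 / (|g| + delta) >= |g| - delta.\<close>
    define e where "e = (\<lambda>\<theta>. cnj (g (of_real s * cis \<theta>)) / of_real (norm (g (of_real s * cis \<theta>)) + \<delta>))"
    have nz: "norm x + \<delta> \<noteq> 0" for x :: complex using \<delta> norm_ge_zero[of x] by linarith
    then have nz': "complex_of_real (norm x) + of_real \<delta> \<noteq> 0" for x :: complex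
      by (metis of_real_add of_real_eq_0_iff)
    have conte: "continuous_on A e" for A
      unfolding e_def using st t nz' by (auto intro!: continuous_intros cg)
    have ne: "norm (e \<theta>) \<le> 1" for \<theta>
    proof -
      have "0 < norm (g (of_real s * cis \<theta>)) + \<delta>" using \<delta> by (simp add: add_nonneg_pos)
      then show ?thesis using \<delta> by (simp add: e_def norm_divide del: of_real_add)
    qed
    define G where "G = (\<lambda>w. integral (cbox 0 (2*pi)) (\<lambda>\<theta>. g (w * cis \<theta>) * e \<theta>))"
    have holG: "G holomorphic_on ball 0 R"
      unfolding G_def
    proof (rule leibniz_rule_holomorphic[where fx="\<lambda>w \<theta>. deriv g (w * cis \<theta>) * cis \<theta> * e \<theta>"])
      show "((\<lambda>w. g (w * cis \<theta>) * e \<theta>) has_field_derivative deriv g (w * cis \<theta>) * cis \<theta> * e \<theta>) (at w within ball 0 R)"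
        if "w \<in> ball 0 R" for w \<theta>
      proof -
        have "(g has_field_derivative deriv g (w * cis \<theta>)) (at (w * cis \<theta>))"
          using that by (intro holomorphic_derivI[OF g]) (auto simp: norm_mult)
        then have "((\<lambda>w. g (w * cis \<theta>)) has_field_derivative deriv g (w * cis \<theta>) * cis \<theta>) (at w)"
          by (rule DERIV_chain2) (auto intro!: derivative_eq_intros)
        then show ?thesis
          by (rule DERIV_cmult_right[OF has_field_derivative_at_within])
      qed
      show "(\<lambda>\<theta>. g (w * cis \<theta>) * e \<theta>) integrable_on cbox 0 (2*pi)" if "w \<in> ball 0 R" for w
        using that by (intro integrable_continuous continuous_intros cg conte) auto
      have "continuous_on (ball 0 R \<times> cbox 0 (2*pi)) (\<lambda>x. deriv g (fst x * cis (snd x)))"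
        by (intro continuous_on_compose2[OF contd]) (auto intro!: continuous_intros simp: norm_mult)
      moreover have "continuous_on (ball 0 R \<times> cbox 0 (2*pi)) (\<lambda>x. e (snd x))"
        by (rule continuous_on_compose2[OF conte[of UNIV]]) (auto intro!: continuous_intros)
      ultimately show "continuous_on (ball 0 R \<times> cbox 0 (2*pi)) (\<lambda>(w, \<theta>). deriv g (w * cis \<theta>) * cis \<theta> * e \<theta>)"
        unfolding case_prod_unfold by (intro continuous_intros)
    qed simp
    \<comment> \<open>For |w| = t the bound on \<open>e\<close> gives |G(w)| <= the mean of |g| over
      the circle of radius t, and \<open>rot\<close> makes this the same number \<open>J\<close> for
      every such w. The maximum principle carries the bound to the interior point s.\<close>
    have "norm (G (of_real s)) \<le> J"
    proof (rule maximum_modulus_frontier[of G "ball 0 t"])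
      show "G holomorphic_on interior (ball 0 t)"
        using holG st by (auto intro: holomorphic_on_subset)
      have "cball 0 t \<subseteq> ball (0::complex) R" using st by auto
      then show "continuous_on (closure (ball 0 t)) G"
        using holG t by (auto intro: continuous_on_subset holomorphic_on_imp_continuous_on)
      show "norm (G w) \<le> J" if "w \<in> frontier (ball 0 t)" for w
      proof -
        have w: "norm w = t" using that t by simp
        have "norm (G w) \<le> integral (cbox 0 (2*pi)) (\<lambda>\<theta>. norm (g (w * cis \<theta>)))"
          unfolding G_def
        proof (rule integral_norm_bound_integral)
          show "(\<lambda>\<theta>. g (w * cis \<theta>) * e \<theta>) integrable_on cbox 0 (2*pi)"
            using w st by (intro integrable_continuous continuous_intros cg conte) auto
          show "(\<lambda>\<theta>. norm (g (w * cis \<theta>))) integrable_on cbox 0 (2*pi)"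
            using w st by (intro integrable_continuous continuous_intros cg) auto
          show "norm (g (w * cis \<theta>) * e \<theta>) \<le> norm (g (w * cis \<theta>))" for \<theta>
            using mult_left_mono[OF ne[of \<theta>] norm_ge_zero[of "g (w * cis \<theta>)"]] by (simp add: norm_mult)
        qed
        with rot[OF w] show ?thesis by simp
      qed
    qed (use st t in auto)
    moreover have "integral {0..2*pi} (\<lambda>\<theta>. norm (g (of_real s * cis \<theta>)) - \<delta>) \<le> norm (G (of_real s))"
    proof -
      define k where "k = (\<lambda>\<theta>. (norm (g (of_real s * cis \<theta>)))\<^sup>2 / (norm (g (of_real s * cis \<theta>)) + \<delta>))"
      have contk: "continuous_on A k" for A
        unfolding k_def using st t nz by (auto intro!: continuous_intros cg)
      have "g (of_real s * cis \<theta>) * e \<theta> = of_real (k \<theta>)" for \<theta>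
        unfolding e_def k_def of_real_divide complex_norm_square by simp
      then have "G (of_real s) = integral (cbox 0 (2*pi)) (\<lambda>\<theta>. complex_of_real (k \<theta>))"
        by (simp add: G_def)
      also have "\<dots> = of_real (integral (cbox 0 (2*pi)) k)"
        using integral_linear[OF integrable_continuous[OF contk] bounded_linear_of_real, of 0 "2*pi"]
        by (simp add: o_def)
      finally have "norm (G (of_real s)) = \<bar>integral {0..2*pi} k\<bar>" by simp
      moreover have "integral {0..2*pi} (\<lambda>\<theta>. norm (g (of_real s * cis \<theta>)) - \<delta>) \<le> integral {0..2*pi} k"
      proof (rule integral_le)
        show "(\<lambda>\<theta>. norm (g (of_real s * cis \<theta>)) - \<delta>) integrable_on {0..2*pi}"
          using st t by (intro integrable_continuous_real continuous_intros cg) auto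
        show "k integrable_on {0..2*pi}" by (intro integrable_continuous_real contk)
        show "norm (g (of_real s * cis \<theta>)) - \<delta> \<le> k \<theta>" for \<theta>
        proof -
          define y where "y = norm (g (of_real s * cis \<theta>))"
          have "y \<ge> 0" by (simp add: y_def)
          then have "y - \<delta> \<le> y\<^sup>2 / (y + \<delta>)"
            using \<delta> by (simp add: le_divide_eq algebra_simps power2_eq_square)
          then show ?thesis by (simp add: k_def y_def)
        qed
      qed
      ultimately show ?thesis by linarith
    qed
    moreover have "integral {0..2*pi} (\<lambda>\<theta>. norm (g (of_real s * cis \<theta>)) - \<delta>) 
        = integral {0..2*pi} (\<lambda>\<theta>. norm (g (of_real s * cis \<theta>))) - 2*pi*\<delta>"
      using st t by (subst integral_diff) (auto intro!: integrable_continuous_real continuous_intros cg)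
    ultimately show ?thesis by linarith
  qed
  show ?thesis
    unfolding J_def[symmetric]
  proof (rule field_le_epsilon)
    fix \<epsilon> :: real assume "\<epsilon> > 0"
    then show "integral {0..2*pi} (\<lambda>\<theta>. norm (g (of_real s * cis \<theta>))) \<le> J + \<epsilon>"
      using main[of "\<epsilon> / (2*pi)"] by simp
  qed
qed simp

text \<open>Without zeros F has a holomorphic logarithm L on the disc, and |F|^p is the modulus of
  the holomorphic function exp(p L), to which the case of exponent 1 applies.\<close>

lemma circle_mean_powr_mono_zero_free:
  fixes F :: "complex \<Rightarrow> complex"
  assumes F: "F holomorphic_on ball 0 R" and nz: "\<And>z. z \<in> ball 0 R \<Longrightarrow> F z \<noteq> 0"
    and st: "0 \<le> s" "s \<le> t" "t < R"
  shows "integral {0..2*pi} (\<lambda>\<theta>. norm (F (of_real s * cis \<theta>)) powr p)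
       \<le> integral {0..2*pi} (\<lambda>\<theta>. norm (F (of_real t * cis \<theta>)) powr p)"
proof -
  obtain L where L: "L holomorphic_on ball 0 R" "\<And>z. z \<in> ball 0 R \<Longrightarrow> F z = exp (L z)"
    using contractible_imp_holomorphic_log[OF F convex_imp_contractible] nz by (metis convex_ball)
  define g where "g = (\<lambda>z. exp (of_real p * L z))"
  have g: "g holomorphic_on ball 0 R" unfolding g_def by (intro holomorphic_intros L)
  have "norm (g z) = norm (F z) powr p" if "z \<in> ball 0 R" for z
    using L(2)[OF that] by (simp add: g_def powr_def)
  then have "norm (g (of_real a * cis \<theta>)) = norm (F (of_real a * cis \<theta>)) powr p" if "0 \<le> a" "a < R" for a \<theta>
    using that by (auto simp: norm_mult)
  with circle_mean_norm_mono[OF g st] st show ?thesis by simp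
qed

text \<open>Each zero in the disc is replaced by its reflection in the circle.\<close>

lemma poly_reflect_zeros:
  fixes P :: "complex poly"
  assumes t: "t > 0" and "P \<noteq> 0"
  obtains Q where "\<And>z. norm z < t \<Longrightarrow> poly Q z \<noteq> 0"
    "\<And>z. norm z \<le> t \<Longrightarrow> norm (poly P z) \<le> norm (poly Q z)"
    "\<And>z. norm z = t \<Longrightarrow> norm (poly P z) = norm (poly Q z)"
  using \<open>P \<noteq> 0\<close>
proof (induction "degree P" arbitrary: P thesis rule: less_induct)
  case less
  show ?case
  proof (cases "\<exists>a. norm a < t \<and> poly P a = 0")
    case False
    then show ?thesis using less.prems(1)[of P] by auto
  next
    case True
    then obtain a where a: "norm a < t" "poly P a = 0" by blast
    then obtain P' where P': "P = [:-a, 1:] * P'" by (metis poly_eq_0_iff_dvd dvdE)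
    then have "P' \<noteq> 0" "degree P' < degree P" using less.prems(2) by (auto simp: degree_mult_eq simp del: mult_pCons_left)
    then obtain Q' where Q': "\<And>z. norm z < t \<Longrightarrow> poly Q' z \<noteq> 0"
      "\<And>z. norm z \<le> t \<Longrightarrow> norm (poly P' z) \<le> norm (poly Q' z)"
      "\<And>z. norm z = t \<Longrightarrow> norm (poly P' z) = norm (poly Q' z)"
      using less.hyps by metis
    \<comment> \<open>The quotient of z - a by t - z cnj(a) / t is a Blaschke factor of the disc of
      radius t. The identity shows that trading the first for the second keeps the modulus on |z| =
      t and does not decrease it inside.\<close>
    have id: "(norm (of_real t - z * cnj a / of_real t))\<^sup>2 - (norm (z - a))\<^sup>2
       = (t\<^sup>2 - (norm z)\<^sup>2) * (t\<^sup>2 - (norm a)\<^sup>2) / t\<^sup>2" for z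
    proof -
      have "complex_of_real ((norm (of_real t - z * cnj a / of_real t))\<^sup>2 - (norm (z - a))\<^sup>2)
         = of_real ((t\<^sup>2 - (norm z)\<^sup>2) * (t\<^sup>2 - (norm a)\<^sup>2) / t\<^sup>2)"
        using t unfolding of_real_diff of_real_mult of_real_divide complex_norm_square
        by (simp add: field_simps power2_eq_square)
      then show ?thesis by (metis of_real_eq_iff)
    qed
    have le: "norm (z - a) \<le> norm (of_real t - z * cnj a / of_real t)" if "norm z \<le> t" for z
    proof -
      have "(norm z)\<^sup>2 \<le> t\<^sup>2" "(norm a)\<^sup>2 \<le> t\<^sup>2" using that a by (auto intro: power_mono)
      then have "0 \<le> (t\<^sup>2 - (norm z)\<^sup>2) * (t\<^sup>2 - (norm a)\<^sup>2) / t\<^sup>2" by simp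
      then have "(norm (z - a))\<^sup>2 \<le> (norm (of_real t - z * cnj a / of_real t))\<^sup>2" using id[of z] by linarith
      then show ?thesis by (rule power2_le_imp_le) simp
    qed
    have eq: "norm (z - a) = norm (of_real t - z * cnj a / of_real t)" if "norm z = t" for z
      using id[of z] that by (simp add: power2_eq_iff_nonneg)
    have ne: "of_real t - z * cnj a / of_real t \<noteq> 0" if "norm z < t" for z
    proof
      assume "of_real t - z * cnj a / of_real t = 0"
      then have "norm (z * cnj a / of_real t) = t" using t by (metis abs_of_pos norm_of_real right_minus_eq)
      then have "norm z * norm a = t * t" using t by (simp add: norm_mult norm_divide field_simps)
      moreover have "norm z * norm a < t * t" using that a t
        by (meson mult_strict_mono' norm_ge_zero)
      ultimately show False by simp
    qed
    have eP: "norm (poly P z) = norm (z - a) * norm (poly P' z)" for z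
      unfolding P' poly_mult norm_mult by simp
    have eQ: "norm (poly ([:of_real t, - cnj a / of_real t:] * Q') z) = norm (of_real t - z * cnj a / of_real t) * norm (poly Q' z)" for z
      unfolding poly_mult norm_mult by simp
    show ?thesis
    proof (rule less.prems(1)[of "[:of_real t, - cnj a / of_real t:] * Q'"])
      show "poly ([:of_real t, - cnj a / of_real t:] * Q') z \<noteq> 0" if "norm z < t" for z
        using ne[OF that] Q'(1)[OF that] unfolding poly_mult by (intro no_zero_divisors) simp_all
      show "norm (poly P z) \<le> norm (poly ([:of_real t, - cnj a / of_real t:] * Q') z)" if "norm z \<le> t" for z
        unfolding eP eQ by (intro mult_mono le Q'(2) that) auto
      show "norm (poly P z) = norm (poly ([:of_real t, - cnj a / of_real t:] * Q') z)" if "norm z = t" for z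
        unfolding eP eQ using eq[OF that] Q'(3)[OF that] by simp
    qed
  qed
qed

text \<open>With Q the polynomial with reflected zeros, |P| <= |Q| on the inner circle and |P| = |Q|
  on the outer one, so monotonicity for Q, which has no zeros in the open disc, implies it for
  P.\<close>

lemma circle_mean_powr_mono_poly:
  fixes P :: "complex poly"
  assumes st: "0 \<le> s" "s < t" and p: "p > 0"
  shows "integral {0..2*pi} (\<lambda>\<theta>. norm (poly P (of_real s * cis \<theta>)) powr p)
       \<le> integral {0..2*pi} (\<lambda>\<theta>. norm (poly P (of_real t * cis \<theta>)) powr p)"
proof (cases "P = 0")
  case False
  have t: "t > 0" using st by simp
  obtain Q where Q: "\<And>z. norm z < t \<Longrightarrow> poly Q z \<noteq> 0"
    "\<And>z. norm z \<le> t \<Longrightarrow> norm (poly P z) \<le> norm (poly Q z)"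
    "\<And>z. norm z = t \<Longrightarrow> norm (poly P z) = norm (poly Q z)"
    using poly_reflect_zeros[OF t False] by blast
  define M where "M = (\<lambda>r. integral (cbox 0 (2*pi)) (\<lambda>\<theta>. norm (poly Q (of_real r * cis \<theta>)) powr p))"
  have contp: "continuous_on A (\<lambda>x. norm (poly P' (of_real (a x) * cis (b x))) powr p)"
    if "continuous_on A a" "continuous_on A b" for A a b and P' :: "complex poly"
    using that p by (intro continuous_on_powr' continuous_intros) auto
  have holpoly: "poly Q holomorphic_on ball 0 t"
    unfolding holomorphic_on_def field_differentiable_def
    using poly_DERIV has_field_derivative_at_within by blast
  have "continuous_on UNIV M"
    unfolding M_def
    by (intro integral_continuous_on_param) (auto simp: case_prod_unfold intro!: contp continuous_intros)
  \<comment> \<open>\<open>Q\<close> may vanish on the circle |z| = t itself, so the zero-free case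
    is used for radii r < t, and r tends to t.\<close>
  then have "(M \<longlongrightarrow> M t) (at_left t)"
    by (auto simp: continuous_on_eq_continuous_at isCont_def intro: tendsto_mono[OF at_le])
  moreover have "\<forall>\<^sub>F r in at_left t. M s \<le> M r"
  proof (rule eventually_at_leftI[of s])
    fix r assume r: "r \<in> {s<..<t}"
    show "M s \<le> M r"
      using circle_mean_powr_mono_zero_free[of "poly Q" t s r p] Q(1) r st holpoly
      by (simp add: M_def)
  qed (use st in auto)
  ultimately have "M s \<le> M t"
    by (intro tendsto_lowerbound) auto
  moreover have "integral {0..2*pi} (\<lambda>\<theta>. norm (poly P (of_real s * cis \<theta>)) powr p) \<le> M s"
    unfolding M_def cbox_interval
  proof (rule integral_le)
    show "norm (poly P (of_real s * cis \<theta>)) powr p \<le> norm (poly Q (of_real s * cis \<theta>)) powr p" for \<theta>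
      using st p Q(2)[of "of_real s * cis \<theta>"] by (intro powr_mono2) (auto simp: norm_mult)
  qed (intro integrable_continuous_real contp continuous_intros)+
  moreover have "integral {0..2*pi} (\<lambda>\<theta>. norm (poly P (of_real t * cis \<theta>)) powr p) = M t"
    unfolding M_def using st Q(3) by (simp add: norm_mult)
  ultimately show ?thesis by simp
qed simp

text \<open>Reflection works one zero at a time, hence for polynomials. The Taylor polynomials of F
  converge uniformly on the closed disc of radius t, and both means pass to the limit.\<close>

lemma circle_mean_powr_mono:
  fixes F :: "complex \<Rightarrow> complex"
  assumes F: "F holomorphic_on ball 0 R" and st: "0 \<le> s" "s \<le> t" "t < R" and p: "p > 0"
  shows "integral {0..2*pi} (\<lambda>\<theta>. norm (F (of_real s * cis \<theta>)) powr p)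
       \<le> integral {0..2*pi} (\<lambda>\<theta>. norm (F (of_real t * cis \<theta>)) powr p)"
proof (cases "s = t")
  case False
  with st have st': "s < t" by simp
  define a where "a = (\<lambda>n. (deriv ^^ n) F 0 / fact n)"
  define P where "P = (\<lambda>N. \<Sum>n<N. monom (a n) n)"
  have sums: "(\<lambda>n. a n * w ^ n) sums F w" if "w \<in> ball 0 R" for w
    using holomorphic_power_series[OF F that] by (simp add: a_def)
  have poly: "poly (P N) w = (\<Sum>n<N. a n * w ^ n)" for N w
    by (simp add: P_def poly_sum poly_monom)
  have "ereal t < conv_radius a"
  proof -
    obtain t' where t': "t < t'" "t' < R" using st dense by blast
    have "summable (\<lambda>n. a n * of_real t' ^ n)"
      using sums[of "of_real t'"] t' st by (auto simp: sums_iff)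
    from conv_radius_geI[OF this] t' st show ?thesis
      by (auto intro: less_le_trans[of _ "ereal t'"])
  qed
  from powser_uniform_limit[OF this, of 0]
  have "uniform_limit (cball 0 t) (\<lambda>N w. poly (P N) w) (\<lambda>w. \<Sum>i. a i * w ^ i) sequentially"
    by (simp add: poly)
  moreover have "(\<Sum>i. a i * w ^ i) = F w" if "w \<in> cball 0 t" for w
    using sums[of w] that st by (auto simp: sums_iff)
  ultimately have unif: "uniform_limit (cball 0 t) (\<lambda>N w. poly (P N) w) F sequentially"
    by (simp add: uniform_limit_iff)
  have contF: "continuous_on (cball 0 t) F"
    using F st by (intro continuous_on_subset[OF holomorphic_on_imp_continuous_on[OF F]]) auto
  then obtain M where M: "\<And>w. w \<in> cball 0 t \<Longrightarrow> norm (F w) \<le> M"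
    using compact_imp_bounded[OF compact_continuous_image[OF contF compact_cball]]
    unfolding bounded_iff by (metis imageI)
  \<comment> \<open>From the index \<open>N0\<close> on the partial sums are bounded by M + 1, which
    supplies the dominating constant.\<close>
  obtain N0 where N0: "\<And>N w. N \<ge> N0 \<Longrightarrow> w \<in> cball 0 t \<Longrightarrow> norm (poly (P N) w - F w) < 1"
    using uniform_limitD[OF unif, of 1] unfolding eventually_sequentially dist_norm by (metis zero_less_one)
  have bd: "norm (poly (P N) w) \<le> M + 1" if "N \<ge> N0" "w \<in> cball 0 t" for N w
    using N0[OF that] M[OF that(2)] norm_triangle_ineq2[of "poly (P N) w" "F w"] by linarith
  have lim: "(\<lambda>k. integral {0..2*pi} (\<lambda>\<theta>. norm (poly (P (k + N0)) (of_real r * cis \<theta>)) powr p))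
      \<longlonglongrightarrow> integral {0..2*pi} (\<lambda>\<theta>. norm (F (of_real r * cis \<theta>)) powr p)" if r: "0 \<le> r" "r \<le> t" for r
  proof (rule dominated_convergence(2)[where h="\<lambda>_. (M + 1) powr p"])
    show "(\<lambda>\<theta>. norm (poly (P (k + N0)) (of_real r * cis \<theta>)) powr p) integrable_on {0..2*pi}" for k
      using p by (intro integrable_continuous_real continuous_on_powr' continuous_intros) auto
    show "norm (norm (poly (P (k + N0)) (of_real r * cis \<theta>)) powr p) \<le> (M + 1) powr p" for k \<theta>
      using bd[of "k + N0" "of_real r * cis \<theta>"] r p by (auto simp: norm_mult intro!: powr_mono2)
    show "(\<lambda>k. norm (poly (P (k + N0)) (of_real r * cis \<theta>)) powr p) \<longlonglongrightarrow> norm (F (of_real r * cis \<theta>)) powr p" for \<theta>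
    proof -
      have "(\<lambda>k. poly (P k) (of_real r * cis \<theta>)) \<longlonglongrightarrow> F (of_real r * cis \<theta>)"
        using r by (intro tendsto_uniform_limitI[OF unif]) (auto simp: norm_mult)
      from LIMSEQ_ignore_initial_segment[OF this, of N0] p show ?thesis
        by (intro tendsto_powr' tendsto_norm) auto
    qed
  qed auto
  show ?thesis
  proof (rule LIMSEQ_le[OF lim lim])
    show "\<exists>N. \<forall>n\<ge>N. integral {0..2*pi} (\<lambda>\<theta>. norm (poly (P (n + N0)) (of_real s * cis \<theta>)) powr p)
          \<le> integral {0..2*pi} (\<lambda>\<theta>. norm (poly (P (n + N0)) (of_real t * cis \<theta>)) powr p)"
      using circle_mean_powr_mono_poly[OF st(1) st' p] by auto
  qed (use st in auto)
qed simp


section \<open>Unitary maps and charts of the ball\<close>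

lemma cinner_add_left: "cinner (x + y) z = cinner x z + cinner y z"
  by (simp add: cinner_def algebra_simps sum.distrib)

lemma cinner_diff_left: "cinner (x - y) z = cinner x z - cinner y z"
  by (simp add: cinner_def algebra_simps sum_subtractf)

lemma cinner_diff_right: "cinner x (y - z) = cinner x y - cinner x z"
  by (simp add: cinner_def algebra_simps sum_subtractf)

lemma cinner_scale_left: "cinner (c *s x) y = c * cinner x y"
  by (simp add: cinner_def sum_distrib_left mult_ac)

lemma cinner_scale_right: "cinner x (c *s y) = cnj c * cinner x y"
  by (simp add: cinner_def sum_distrib_left mult_ac)

lemma cnj_cinner: "cnj (cinner x y) = cinner y x"
  by (simp add: cinner_def mult_ac)

lemma cinner_zero [simp]: "cinner 0 y = 0" "cinner x 0 = 0"
  by (simp_all add: cinner_def)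

lemma norm_sq_vec: "(norm (x :: complex ^ 'n::finite))\<^sup>2 = (\<Sum>j\<in>UNIV. (norm (x $ j))\<^sup>2)"
  by (simp add: norm_vec_def L2_set_def sum_nonneg)

lemma norm_sq_vec_split:
  "(norm (x :: complex ^ 'n::finite))\<^sup>2 = (norm (x $ i))\<^sup>2 + (\<Sum>j\<in>UNIV-{i}. (norm (x $ j))\<^sup>2)"
  by (simp add: norm_sq_vec sum.remove[of UNIV i])

lemma cinner_self: "cinner x x = of_real ((norm x)\<^sup>2)"
  unfolding norm_sq_vec of_real_sum complex_norm_square by (simp add: cinner_def)

lemma Re_cinner: "Re (cinner x y) = x \<bullet> y"
  by (simp add: cinner_def inner_vec_def inner_complex_def)

lemma norm_vector_scale: "norm (c *s x) = norm c * norm (x :: complex ^ 'n::finite)"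
proof (rule power2_eq_imp_eq)
  show "(norm (c *s x))\<^sup>2 = (norm c * norm x)\<^sup>2"
    by (simp add: norm_sq_vec power_mult_distrib norm_mult sum_distrib_left)
qed auto

text \<open>A unimodular factor on x makes the complex product real and nonnegative, hence equal to
  the real inner product, where the real Cauchy-Schwarz inequality applies.\<close>

lemma norm_cinner_le: "norm (cinner x y) \<le> norm x * norm (y :: complex ^ 'n::finite)"
proof (cases "cinner x y = 0")
  case False
  define c where "c = cnj (cinner x y) / of_real (norm (cinner x y))"
  have c: "norm c = 1" using False by (simp add: c_def norm_divide)
  have "c * cinner x y = of_real (norm (cinner x y))"
  proof -
    have "c * cinner x y = of_real ((norm (cinner x y))\<^sup>2) / of_real (norm (cinner x y))"
      unfolding complex_norm_square by (simp add: c_def mult.commute)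
    then show ?thesis using False by (simp add: power2_eq_square)
  qed
  then have "norm (cinner x y) = Re (cinner (c *s x) y)"
    by (simp add: cinner_scale_left)
  also have "\<dots> \<le> norm (c *s x) * norm y"
    unfolding Re_cinner by (rule norm_cauchy_schwarz)
  finally show ?thesis by (simp add: norm_vector_scale c)
qed simp

lemma cinner_axis_right: "cinner x (axis i c) = x $ i * cnj c"
proof -
  have "cinner x (axis i c) = (\<Sum>j\<in>UNIV. if j = i then x $ i * cnj c else 0)"
    unfolding cinner_def by (intro sum.cong) (auto simp: axis_def)
  then show ?thesis by simp
qed

lemma norm_axis: "norm (axis i c :: complex ^ 'n::finite) = norm c"
proof (rule power2_eq_imp_eq)
  show "(norm (axis i c :: complex ^ 'n))\<^sup>2 = (norm c)\<^sup>2"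
    unfolding norm_sq_vec_split[of _ i] by (simp add: axis_def)
qed auto

definition unitary_map :: "(complex ^ 'n::finite \<Rightarrow> complex ^ 'n) \<Rightarrow> bool" where
  "unitary_map H \<longleftrightarrow> (\<forall>x y. H (x + y) = H x + H y) \<and> (\<forall>c x. H (c *s x) = c *s H x)
     \<and> (\<forall>x y. cinner (H x) (H y) = cinner x y)"

lemma unitary_mapD:
  assumes "unitary_map H"
  shows "H (x + y) = H x + H y" "H (c *s x) = c *s H x" "cinner (H x) (H y) = cinner x y"
  using assms by (auto simp: unitary_map_def)

lemma unitary_map_norm: "unitary_map H \<Longrightarrow> norm (H x) = norm x"
  using unitary_mapD(3)[of H x x]
  unfolding cinner_self of_real_eq_iff by (simp add: power2_eq_iff_nonneg)

lemma scaleR_conv_vector_scale: "r *\<^sub>R x = complex_of_real r *s (x :: complex ^ 'n::finite)"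
  by (simp add: vec_eq_iff complex_eq_iff)

lemma unitary_map_orthogonal: "unitary_map H \<Longrightarrow> orthogonal_transformation H"
  unfolding orthogonal_transformation
  by (auto intro!: linearI simp: unitary_mapD scaleR_conv_vector_scale unitary_map_norm)

lemma unitary_map_diff: "unitary_map H \<Longrightarrow> H (x - y) = H x - H y"
  by (metis unitary_map_orthogonal orthogonal_transformation_linear linear_diff)

lemma unitary_map_scalar: "norm c = 1 \<Longrightarrow> unitary_map (\<lambda>x. c *s x)"
  using complex_norm_square[of c]
  by (auto simp: unitary_map_def vector_add_ldistrib cinner_scale_left cinner_scale_right vector_smult_assoc mult.commute
      mult.assoc[symmetric])

text \<open>The map is a complex Householder reflection. Reflecting along e - y exchanges the unit
  vectors e and y only if their complex product is real, so b is first scaled by a factor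
  \<open>\<gamma>\<close> that makes it a unit vector with nonnegative i-th coordinate.\<close>

lemma unitary_map_axis_exists:
  fixes b :: "complex ^ 'n::finite"
  obtains H \<beta> where "unitary_map H" "H (axis i \<beta>) = b" "norm \<beta> = norm b"
proof (cases "b = 0")
  case True
  have "unitary_map (\<lambda>x :: complex ^ 'n. x)" by (simp add: unitary_map_def)
  then show ?thesis using True that[of "\<lambda>x. x" 0] by (simp add: axis_def vec_eq_iff)
next
  case False
  define \<gamma> where "\<gamma> = (if b $ i = 0 then 1 else cnj (b $ i) / of_real (norm (b $ i))) / of_real (norm b)"
  have \<gamma>: "norm \<gamma> = 1 / norm b" "\<gamma> \<noteq> 0" using False by (auto simp: \<gamma>_def norm_divide)
  have \<gamma>b: "\<gamma> * b $ i = of_real (norm (b $ i) / norm b)"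
    using complex_norm_square[of "b $ i"] by (auto simp: \<gamma>_def field_simps power2_eq_square)
  define e where "e = (axis i 1 :: complex ^ 'n)"
  define y where "y = \<gamma> *s b"
  define v where "v = e - y"
  define k where "k = complex_of_real (norm (b $ i) / norm b)"
  define N where "N = cinner v v"
  define H where "H = (\<lambda>z. z - (2 * cinner z v / N) *s v)"
  have ee: "cinner e e = 1" by (simp add: e_def cinner_axis_right)
  have yy: "cinner y y = 1" using \<gamma> False by (simp add: y_def cinner_self norm_vector_scale)
  have ye: "cinner y e = k" unfolding e_def cinner_axis_right by (simp add: y_def \<gamma>b k_def)
  have ey: "cinner e y = k" using cnj_cinner[of y e] unfolding ye by (simp add: k_def)
  have N: "N = 2 - 2 * k" by (simp add: N_def v_def cinner_diff_left cinner_diff_right ee yy ye ey)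
  have ev: "cinner e v = 1 - k" by (simp add: v_def cinner_diff_right ee ey)
  have cN: "cnj N = N" by (simp add: N_def cinner_self)
  \<comment> \<open>If v = 0 then N = 0 and division by zero yields 0, so \<open>H\<close> is the
    identity, which is correct because then e = y.\<close>
  have He: "H e = y"
  proof (cases "N = 0")
    case True
    then have "v = 0" by (simp add: N_def cinner_self)
    then show ?thesis by (simp add: H_def v_def)
  next
    case False
    then have "2 * cinner e v / N = 1" unfolding ev by (simp add: N)
    then show ?thesis by (simp add: H_def v_def)
  qed
  have "cinner (H x) (H z) = cinner x z" for x z
  proof (cases "N = 0")
    case False
    then show ?thesis
      using cN cnj_cinner[of z v]
      by (simp add: H_def cinner_diff_left cinner_diff_right cinner_scale_left cinner_scale_right N_def[symmetric] field_simps)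
  qed (simp add: H_def)
  then have U: "unitary_map H"
    unfolding unitary_map_def
    by (auto simp: H_def cinner_add_left cinner_scale_left vec_eq_iff algebra_simps add_divide_distrib)
  have "H (axis i (1 / \<gamma>)) = (1 / \<gamma>) *s H e"
    unfolding unitary_mapD(2)[OF U, symmetric] e_def by (rule arg_cong[of _ _ H]) (simp add: vec_eq_iff axis_def)
  also have "\<dots> = b" using \<gamma> by (simp add: He y_def vector_smult_assoc)
  finally show ?thesis using that[OF U] \<gamma> by (simp add: norm_divide)
qed

definition vscale :: "('n::finite \<Rightarrow> real) \<Rightarrow> complex ^ 'n \<Rightarrow> complex ^ 'n" where
  "vscale c x = (\<chi> j. complex_of_real (c j) * x $ j)"

lemma vscale_nth [simp]: "vscale c x $ j = complex_of_real (c j) * x $ j"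
  by (simp add: vscale_def)

text \<open>Every complex coordinate consists of two real ones, which is why each factor enters the
  Jacobian squared.\<close>

lemma nn_integral_lborel_vscale:
  fixes f :: "complex ^ 'n::finite \<Rightarrow> ennreal"
  assumes [measurable]: "f \<in> borel_measurable borel" and c: "\<And>j. c j > 0"
  shows "(\<integral>\<^sup>+x. f x \<partial>lborel) = ennreal (\<Prod>j\<in>UNIV. (c j)\<^sup>2) * (\<integral>\<^sup>+x. f (vscale c x) \<partial>lborel)"
proof -
  \<comment> \<open>\<open>ix\<close> reads off the coordinate in which a basis vector lives;
    through it the factors \<open>c\<close>, indexed by complex coordinates, become factors
    \<open>C\<close> indexed by the real basis.\<close>
  define ix where "ix = (\<lambda>k :: complex ^ 'n. SOME i. k $ i \<noteq> 0)"
  have ix: "ix (axis i u) = i" if "u \<noteq> 0" for i and u :: complex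
    unfolding ix_def using that by (intro some_equality) (auto simp: axis_def split: if_splits)
  define C where "C = (\<lambda>k :: complex ^ 'n. c (ix k))"
  have Basis: "Basis = (\<lambda>(i, u). axis i u :: complex ^ 'n) ` (UNIV \<times> Basis)"
    by (auto simp: Basis_vec_def)
  have inj: "inj_on (\<lambda>(i, u). axis i u :: complex ^ 'n) (UNIV \<times> Basis)"
    by (auto simp: inj_on_def axis_eq_axis)
  have nz: "u \<noteq> 0" if "u \<in> Basis" for u :: complex using that by auto
  have T: "0 + (\<Sum>k\<in>Basis. (C k * (x \<bullet> k)) *\<^sub>R k) = vscale c x" for x
  proof -
    have "(\<Sum>k\<in>Basis. (C k * (x \<bullet> k)) *\<^sub>R k) = (\<Sum>i\<in>UNIV. \<Sum>u\<in>Basis. (c i * (x $ i \<bullet> u)) *\<^sub>R axis i u)"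
      unfolding Basis
      by (subst sum.reindex[OF inj], subst sum.cartesian_product)
         (auto intro!: sum.cong simp: C_def ix nz inner_axis)
    also have "\<dots> = vscale c x"
      by (simp add: vec_eq_iff Basis_complex_def axis_def if_distrib if_distribR sum.distrib complex_eq_iff
          inner_complex_def cong: if_cong)
    finally show ?thesis by simp
  qed
  have "(\<Prod>k\<in>Basis. \<bar>C k\<bar>) = (\<Prod>i\<in>UNIV. \<Prod>u\<in>(Basis::complex set). c i)"
    unfolding Basis
    by (subst prod.reindex[OF inj], subst prod.cartesian_product)
       (use c in \<open>auto intro!: prod.cong simp: C_def ix nz abs_of_pos\<close>)
  then have P: "(\<Prod>k\<in>Basis. \<bar>C k\<bar>) = (\<Prod>j\<in>UNIV. (c j)\<^sup>2)" by simp
  have "lborel = density (distr lborel borel (\<lambda>x. 0 + (\<Sum>k\<in>Basis. (C k * (x \<bullet> k)) *\<^sub>R k))) (\<lambda>_. (\<Prod>k\<in>Basis. \<bar>C k\<bar>))"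
    by (rule lborel_affine_euclidean) (use c in \<open>simp add: C_def less_imp_neq[symmetric]\<close>)
  then have eq: "lborel = density (distr lborel borel (vscale c)) (\<lambda>_. (\<Prod>j\<in>UNIV. (c j)\<^sup>2))"
    unfolding T P .
  have "continuous_on UNIV (vscale c)"
    unfolding vscale_def by (intro continuous_intros)
  then have [measurable]: "vscale c \<in> borel_measurable borel"
    by (rule borel_measurable_continuous_onI)
  show ?thesis
    by (subst eq) (simp add: nn_integral_density nn_integral_distr nn_integral_cmult)
qed


text \<open>A set comparable to a pseudohyperbolic ball around \<open>b\<close>, given by inequalities that are stable,
  up to constants, under exchanging \<open>b\<close> and \<open>z\<close>.\<close>

definition near :: "complex ^ 'n::finite \<Rightarrow> complex ^ 'n \<Rightarrow> bool" where
  "near b z \<longleftrightarrow> (1 - (norm b)\<^sup>2) / 2 \<le> 1 - (norm z)\<^sup>2 \<and> 1 - (norm z)\<^sup>2 \<le> 2 * (1 - (norm b)\<^sup>2)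
      \<and> norm (1 - cinner b z) \<le> 2 * (1 - (norm b)\<^sup>2)"

lemma mem_Bn_iff: "z \<in> Bn \<longleftrightarrow> norm z < 1"
  by (simp add: Bn_def)

lemma mem_Bn_iff_sq: "z \<in> Bn \<longleftrightarrow> 0 < 1 - (norm z)\<^sup>2"
  using abs_square_less_1[of "norm z"] by (simp add: mem_Bn_iff)

lemma near_imp_Bn: "b \<in> Bn \<Longrightarrow> near b z \<Longrightarrow> z \<in> Bn"
  by (auto simp: mem_Bn_iff_sq near_def)

text \<open>\<open>H\<close> carries the i-th axis to the complex line of b, so the projection onto
  that line becomes the i-th coordinate and its complement the remaining ones. The second disjunct
  covers the points outside the ball where the denominator of the automorphism vanishes.\<close>

lemma pseudo_hyp_coords:
  fixes y :: "complex ^ 'n::finite"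
  assumes H: "unitary_map H" "H (axis i \<beta>) = b" and b: "norm b < 1"
  shows "pseudo_hyp b (H y) * norm (1 - y $ i * cnj \<beta>)
     = sqrt ((norm (\<beta> - y $ i))\<^sup>2 + (1 - (norm b)\<^sup>2) * (\<Sum>j\<in>UNIV-{i}. (norm (y $ j))\<^sup>2))
       \<or> 1 - y $ i * cnj \<beta> = 0"
proof (cases "1 - y $ i * cnj \<beta> = 0")
  case False
  define s where "s = sqrt (1 - (norm b)\<^sup>2)"
  have s2: "s\<^sup>2 = 1 - (norm b)\<^sup>2" using b by (simp add: s_def abs_square_le_1)
  have nb: "norm \<beta> = norm b" using unitary_map_norm[OF H(1), of "axis i \<beta>"] H(2) by (simp add: norm_axis)
  have c: "cinner (H y) b = y $ i * cnj \<beta>"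
    unfolding H(2)[symmetric] unitary_mapD(3)[OF H(1)] by (rule cinner_axis_right)
  define x where "x = axis i (\<beta> - y $ i) - of_real s *s (y - axis i (y $ i))"
  have "ball_aut b (H y) = (1 / (1 - y $ i * cnj \<beta>)) *s H x"
  \<comment> \<open>For b = 0 the projection is set to 0 by definition; the general formula survives
    because then s = 1 and beta = 0.\<close>
  proof (cases "b = 0")
    case True
    then have "\<beta> = 0" "s = 1" using nb by (auto simp: s_def)
    then have "x = (-1) *s y" by (simp add: x_def vec_eq_iff axis_def)
    then show ?thesis using True \<open>\<beta> = 0\<close> 
      by (simp add: ball_aut_def linear_neg[OF orthogonal_transformation_linear[OF unitary_map_orthogonal[OF H(1)]]])
  next
    case False
    then have \<beta>: "\<beta> \<noteq> 0" using nb by auto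
    have "(cinner (H y) b / cinner b b) *s b = (y $ i / \<beta>) *s H (axis i \<beta>)"
      using \<beta> complex_norm_square[of \<beta>] unfolding c cinner_self nb[symmetric] H(2) by simp
    also have "\<dots> = H (axis i (y $ i))"
      unfolding unitary_mapD(2)[OF H(1), symmetric]
      by (rule arg_cong[of _ _ H]) (use \<beta> in \<open>simp add: vec_eq_iff axis_def\<close>)
    finally have P: "(cinner (H y) b / cinner b b) *s b = H (axis i (y $ i))" .
    have "b - H (axis i (y $ i)) - of_real s *s (H y - H (axis i (y $ i))) = H x"
      unfolding H(2)[symmetric] unitary_map_diff[OF H(1), symmetric] unitary_mapD(2)[OF H(1), symmetric] x_def
      by (rule arg_cong[of _ _ H]) (simp add: vec_eq_iff axis_def)
    then show ?thesis using False
      unfolding ball_aut_def Let_def c P[unfolded c] s_def[symmetric] by (simp only: if_False)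
  qed
  then have "pseudo_hyp b (H y) * norm (1 - y $ i * cnj \<beta>) = norm x"
    using False by (simp add: pseudo_hyp_def norm_vector_scale unitary_map_norm[OF H(1)] norm_divide)
  also have "norm x = sqrt ((norm x)\<^sup>2)" by simp
  also have "(norm x)\<^sup>2 = (norm (\<beta> - y $ i))\<^sup>2 + (1 - (norm b)\<^sup>2) * (\<Sum>j\<in>UNIV-{i}. (norm (y $ j))\<^sup>2)"
    unfolding s2[symmetric] sum_distrib_left norm_sq_vec_split[of x i]
    by (auto simp: x_def axis_def norm_mult power_mult_distrib intro!: sum.cong)
  finally show ?thesis by simp
qed simp

lemma one_minus_cinner_nonzero:
  assumes "norm a < 1" "norm z < 1"
  shows "1 - cinner z a \<noteq> 0"
proof
  assume "1 - cinner z a = 0"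
  then have "norm (cinner z a) = 1" by simp
  with norm_cinner_le[of z a] have "1 \<le> norm z * norm a" by simp
  moreover have "norm z * norm a < 1 * 1" using assms by (intro mult_strict_mono') auto
  ultimately show False by simp
qed

text \<open>After rotating a onto an axis this is the one-variable identity |1 - y cnj(b)|^2 - |b -
  y|^2 = (1 - |b|^2)(1 - |y|^2), combined with a tangential part weighted by 1 - |a|^2. Symmetry and
  joint measurability of the distance are read off from it.\<close>

lemma one_minus_pseudo_hyp_sq:
  assumes a: "norm a < 1" and z: "norm (z :: complex ^ 'n::finite) < 1"
  shows "1 - (pseudo_hyp a z)\<^sup>2 = (1 - (norm a)\<^sup>2) * (1 - (norm z)\<^sup>2) / (norm (1 - cinner z a))\<^sup>2"
proof -
  fix i :: 'n
  obtain H \<beta> where H: "unitary_map H" "H (axis i \<beta>) = a" "norm \<beta> = norm a"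
    using unitary_map_axis_exists[of i a] by blast
  obtain y where y: "z = H y"
    using orthogonal_transformation_surj[OF unitary_map_orthogonal[OF H(1)]] by (metis surjD)
  have c: "cinner z a = y $ i * cnj \<beta>"
    unfolding H(2)[symmetric] y unitary_mapD(3)[OF H(1)] by (rule cinner_axis_right)
  have nz: "1 - y $ i * cnj \<beta> \<noteq> 0" using one_minus_cinner_nonzero[OF a z] c by simp
  define Y where "Y = (\<Sum>j\<in>UNIV-{i}. (norm (y $ j))\<^sup>2)"
  have Y: "Y \<ge> 0" by (simp add: Y_def sum_nonneg)
  have a1: "(norm a)\<^sup>2 < 1" using a by (simp add: abs_square_less_1)
  have nz2: "(norm z)\<^sup>2 = (norm (y $ i))\<^sup>2 + Y"
    unfolding y unitary_map_norm[OF H(1)] Y_def by (rule norm_sq_vec_split)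
  have "(pseudo_hyp a z * norm (1 - y $ i * cnj \<beta>))\<^sup>2 = (norm (\<beta> - y $ i))\<^sup>2 + (1 - (norm a)\<^sup>2) * Y"
    using pseudo_hyp_coords[OF H(1,2) a, of y] nz Y a1 unfolding y Y_def by simp
  moreover have "(norm (1 - y $ i * cnj \<beta>))\<^sup>2 - (norm (\<beta> - y $ i))\<^sup>2 = (1 - (norm \<beta>)\<^sup>2) * (1 - (norm (y $ i))\<^sup>2)"
  proof -
    have "complex_of_real ((norm (1 - y $ i * cnj \<beta>))\<^sup>2 - (norm (\<beta> - y $ i))\<^sup>2) = of_real ((1 - (norm \<beta>)\<^sup>2) * (1 - (norm (y $ i))\<^sup>2))"
      unfolding of_real_diff of_real_mult complex_norm_square by (simp add: algebra_simps)
    then show ?thesis by (metis of_real_eq_iff)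
  qed
  ultimately have "(norm (1 - y $ i * cnj \<beta>))\<^sup>2 - (pseudo_hyp a z * norm (1 - y $ i * cnj \<beta>))\<^sup>2
      = (1 - (norm a)\<^sup>2) * (1 - (norm z)\<^sup>2)"
    unfolding H(3) nz2 by (simp add: algebra_simps)
  then show ?thesis using nz by (simp add: c field_simps power_mult_distrib)
qed

lemma pseudo_hyp_commute:
  assumes "norm a < 1" "norm z < 1"
  shows "pseudo_hyp a z = pseudo_hyp z a"
proof -
  have "norm (1 - cinner z a) = norm (1 - cinner a z)"
    by (metis cnj_cinner complex_cnj_diff complex_cnj_one complex_mod_cnj)
  then have "(pseudo_hyp a z)\<^sup>2 = (pseudo_hyp z a)\<^sup>2"
    using one_minus_pseudo_hyp_sq[OF assms] one_minus_pseudo_hyp_sq[OF assms(2,1)] by (simp add: mult.commute)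
  then show ?thesis by (simp add: pseudo_hyp_def power2_eq_iff_nonneg)
qed

text \<open>Affine coordinates at \<open>b\<close> adapted to the pseudohyperbolic metric: lengths are scaled by
  \<open>1 - |b|\<^sup>2\<close> in the complex radial direction and by its square root in the tangential ones. They
  play the role of the automorphism of the ball at \<open>b\<close>, but have constant Jacobian.\<close>

lemma ball_chart:
  fixes b :: "complex ^ 'n::finite"
  assumes b: "b \<in> Bn"
  obtains L :: "complex ^ 'n \<Rightarrow> complex ^ 'n" where "linear L" "\<And>c x. L (c *s x) = c *s L x"
    "\<And>x. norm x \<le> 1/5 \<Longrightarrow> near b (b + L x)"
    "\<And>f. f \<in> borel_measurable borel \<Longrightarrow>
       (\<integral>\<^sup>+z. f z \<partial>lborel) = ennreal ((1 - (norm b)\<^sup>2) ^ (CARD('n) + 1)) * (\<integral>\<^sup>+x. f (b + L x) \<partial>lborel)"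
    "\<And>a. a \<in> Bn \<Longrightarrow> pseudo_hyp b a \<le> 1/2 \<Longrightarrow> \<exists>x. a = b + L x \<and> norm x \<le> 2 * pseudo_hyp b a"
proof -
  fix i :: 'n
  define s where "s = sqrt (1 - (norm b)\<^sup>2)"
  have nb: "norm b < 1" using b by (simp add: mem_Bn_iff)
  have s2: "s\<^sup>2 = 1 - (norm b)\<^sup>2" using nb by (simp add: s_def abs_square_le_1)
  have s: "0 < s" "s \<le> 1" using b by (auto simp: s_def mem_Bn_iff_sq)
  obtain H \<beta> where H: "unitary_map H" "H (axis i \<beta>) = b" "norm \<beta> = norm b"
    using unitary_map_axis_exists[of i b] by blast
  define c where "c = (\<lambda>j. if j = i then s\<^sup>2 else s)"
  have c: "c j > 0" for j using s by (simp add: c_def)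
  define L where "L = (\<lambda>x. H (vscale c x))"
  have vadd: "vscale c (x + y) = vscale c x + vscale c y" for x y
    by (simp add: vec_eq_iff algebra_simps)
  have vsc: "vscale c (k *s x) = k *s vscale c x" for k x
    by (simp add: vec_eq_iff algebra_simps)
  have Lsc: "L (k *s x) = k *s L x" for k x
    by (simp add: L_def vsc unitary_mapD[OF H(1)])
  have lin: "linear L"
    by (rule linearI) (simp_all add: L_def vadd unitary_mapD[OF H(1)] scaleR_conv_vector_scale vsc)
  have bL: "b + L x = H (axis i \<beta> + vscale c x)" for x
    by (simp add: L_def H(2)[symmetric] unitary_mapD[OF H(1)])
  have near: "near b (b + L x)" if x: "norm x \<le> 1/5" for x
  proof -
    define A where "A = (norm (x $ i))\<^sup>2"
    define A' where "A' = (\<Sum>j\<in>UNIV-{i}. (norm (x $ j))\<^sup>2)"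
    have A: "A \<ge> 0" "A' \<ge> 0" by (auto simp: A_def A'_def sum_nonneg)
    have "(norm x)\<^sup>2 \<le> (1/5)\<^sup>2" using x by (intro power_mono) auto
    moreover have "(norm x)\<^sup>2 = A + A'" unfolding A_def A'_def by (rule norm_sq_vec_split)
    ultimately have AA: "A + A' \<le> 1/25" by (simp add: power2_eq_square)
    define t where "t = Re (\<beta> * cnj (x $ i))"
    have xi: "norm (x $ i) \<le> 1/5" using component_le_norm_cart order_trans x Finite_Cartesian_Product.norm_nth_le by blast
    have n\<beta>x: "norm (\<beta> * cnj (x $ i)) \<le> 1/5"
      using mult_mono[of "norm \<beta>" 1 "norm (x $ i)" "1/5"] xi nb H(3) by (simp add: norm_mult)
    then have t: "\<bar>t\<bar> \<le> 1/5" unfolding t_def using abs_Re_le_cmod order_trans by blast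
    have "(norm (b + L x))\<^sup>2 = (norm (\<beta> + of_real (s\<^sup>2) * x $ i))\<^sup>2 + s\<^sup>2 * A'"
      unfolding bL unitary_map_norm[OF H(1)] norm_sq_vec_split[of _ i] A'_def sum_distrib_left
      by (auto simp: axis_def c_def norm_mult power_mult_distrib intro!: sum.cong)
    also have "(norm (\<beta> + of_real (s\<^sup>2) * x $ i))\<^sup>2 = (norm b)\<^sup>2 + 2 * s\<^sup>2 * t + s^4 * A"
    proof -
      have "(norm (\<beta> + of_real (s\<^sup>2) * x $ i))\<^sup>2 = (norm \<beta>)\<^sup>2 + 2 * (\<beta> \<bullet> (of_real (s\<^sup>2) * x $ i)) + (norm (of_real (s\<^sup>2) * x $ i))\<^sup>2"
        by (simp add: power2_norm_eq_inner algebra_simps inner_commute)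
      then show ?thesis
        using s unfolding H(3) A_def t_def
        by (simp add: inner_complex_def norm_mult norm_power power_mult_distrib algebra_simps power_mult[symmetric])
    qed
    \<comment> \<open>The radius 1/5 is chosen for the bracket obtained here: 2 |t| <= 2/5 and A +
      A' <= 1/25 keep it between 1/2 and 2.\<close>
    finally have n: "1 - (norm (b + L x))\<^sup>2 = s\<^sup>2 * (1 - 2 * t - s\<^sup>2 * A - A')"
      using s2 by (simp add: algebra_simps power4_eq_xxxx power2_eq_square)
    have "s\<^sup>2 * A \<le> 1 * A" using s A by (intro mult_right_mono) (auto simp: power_le_one)
    moreover have "0 \<le> s\<^sup>2 * A" using A by simp
    ultimately have "1/2 \<le> 1 - 2 * t - s\<^sup>2 * A - A'" "1 - 2 * t - s\<^sup>2 * A - A' \<le> 2"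
      using t A AA by linarith+
    then have "s\<^sup>2 * (1/2) \<le> 1 - (norm (b + L x))\<^sup>2" "1 - (norm (b + L x))\<^sup>2 \<le> s\<^sup>2 * 2"
      unfolding n by (intro mult_left_mono; simp)+
    moreover have "norm (1 - cinner b (b + L x)) \<le> 2 * s\<^sup>2"
    proof -
      have "cinner b (b + L x) = cinner (H (axis i \<beta>)) (H (axis i \<beta> + vscale c x))"
        unfolding bL H(2) ..
      also have "\<dots> = cnj (cinner (axis i \<beta> + vscale c x) (axis i \<beta>))"
        unfolding cnj_cinner unitary_mapD(3)[OF H(1)] ..
      also have "\<dots> = \<beta> * cnj \<beta> + of_real (s\<^sup>2) * (\<beta> * cnj (x $ i))"
        unfolding cinner_axis_right by (simp add: axis_def c_def algebra_simps)
      also have "\<beta> * cnj \<beta> = of_real (1 - s\<^sup>2)"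
        unfolding complex_norm_square[symmetric] H(3) s2 by simp
      finally have "1 - cinner b (b + L x) = of_real (s\<^sup>2) * (1 - \<beta> * cnj (x $ i))"
        by (simp add: algebra_simps)
      then have eq: "norm (1 - cinner b (b + L x)) = s\<^sup>2 * norm (1 - \<beta> * cnj (x $ i))"
        by (simp add: norm_mult norm_power)
      have "norm (1 - \<beta> * cnj (x $ i)) \<le> 2"
        using norm_triangle_ineq4[of 1 "\<beta> * cnj (x $ i)"] n\<beta>x by simp
      then show ?thesis unfolding eq mult.commute[of 2] by (intro mult_left_mono) auto
    qed
    ultimately show ?thesis by (simp add: near_def s2)
  qed
  have int: "(\<integral>\<^sup>+z. f z \<partial>lborel) = ennreal ((1 - (norm b)\<^sup>2) ^ (CARD('n) + 1)) * (\<integral>\<^sup>+x. f (b + L x) \<partial>lborel)"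
    if [measurable]: "f \<in> borel_measurable borel" for f
  proof -
    have [measurable]: "H \<in> borel_measurable borel"
      using orthogonal_transformation_linear[OF unitary_map_orthogonal[OF H(1)]]
      by (intro borel_measurable_continuous_onI linear_continuous_on) (simp add: linear_conv_bounded_linear)
    have "(\<integral>\<^sup>+z. f z \<partial>lborel) = (\<integral>\<^sup>+z. f (b + z) \<partial>lborel)"
      by (rule nn_integral_lborel_shift[symmetric]) simp
    also have "\<dots> = (\<integral>\<^sup>+z. f (b + H z) \<partial>lborel)"
      by (rule nn_integral_lborel_isometry[symmetric]) (simp_all add: unitary_map_orthogonal H)
    also have "\<dots> = ennreal (\<Prod>j\<in>UNIV. (c j)\<^sup>2) * (\<integral>\<^sup>+z. f (b + H (vscale c z)) \<partial>lborel)"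
      by (rule nn_integral_lborel_vscale) (simp_all add: c)
    \<comment> \<open>The axis direction contributes s^4 and each of the n - 1 others s^2, in total
      (s^2)^(n+1); the subtraction on naturals is harmless since n >= 1.\<close>
    also have "(\<Prod>j\<in>UNIV. (c j)\<^sup>2) = (1 - (norm b)\<^sup>2) ^ (CARD('n) + 1)"
    proof -
      have "(\<Prod>j\<in>UNIV. (c j)\<^sup>2) = (s\<^sup>2)\<^sup>2 * (\<Prod>j\<in>UNIV-{i}. s\<^sup>2)"
        by (subst prod.remove[of UNIV i]) (auto simp: c_def intro!: prod.cong)
      also have "\<dots> = (s\<^sup>2) ^ (2 + (CARD('n) - 1))" unfolding power_add by simp
      also have "2 + (CARD('n) - 1) = CARD('n) + 1" using zero_less_card_finite[where 'a='n] by linarith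
      finally show ?thesis by (simp add: s2)
    qed
    finally show ?thesis by (simp add: L_def)
  qed
  have inv: "\<exists>x. a = b + L x \<and> norm x \<le> 2 * pseudo_hyp b a" if a: "a \<in> Bn" and \<rho>: "pseudo_hyp b a \<le> 1/2" for a
  proof -
    obtain y where y: "a = H y"
      using orthogonal_transformation_surj[OF unitary_map_orthogonal[OF H(1)]] by (metis surjD)
    define x where "x = (\<chi> j. (y - axis i \<beta>) $ j / of_real (c j))"
    have yx: "y = axis i \<beta> + vscale c x" using c by (simp add: vec_eq_iff x_def less_imp_neq[symmetric])
    have yi: "y $ i = \<beta> + of_real (s\<^sup>2) * x $ i" unfolding yx by (simp add: axis_def c_def)
    have yj: "y $ j = of_real s * x $ j" if "j \<noteq> i" for j unfolding yx using that by (simp add: axis_def c_def)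
    have "cinner a b = y $ i * cnj \<beta>"
      unfolding H(2)[symmetric] y unitary_mapD(3)[OF H(1)] by (rule cinner_axis_right)
    then have nz: "1 - y $ i * cnj \<beta> \<noteq> 0"
      using one_minus_cinner_nonzero[of b a] nb a by (simp add: mem_Bn_iff)
    have one: "1 - y $ i * cnj \<beta> = of_real (s\<^sup>2) * (1 - x $ i * cnj \<beta>)"
    proof -
      have "\<beta> * cnj \<beta> = of_real (1 - s\<^sup>2)"
        unfolding complex_norm_square[symmetric] H(3) s2 by simp
      then show ?thesis unfolding yi by (simp add: algebra_simps)
    qed
    have "(norm (\<beta> - y $ i))\<^sup>2 + s\<^sup>2 * (\<Sum>j\<in>UNIV-{i}. (norm (y $ j))\<^sup>2) = (s\<^sup>2 * norm x)\<^sup>2"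
    proof -
      have "(\<Sum>j\<in>UNIV-{i}. (norm (y $ j))\<^sup>2) = s\<^sup>2 * (\<Sum>j\<in>UNIV-{i}. (norm (x $ j))\<^sup>2)"
        unfolding sum_distrib_left by (intro sum.cong) (auto simp: yj norm_mult power_mult_distrib)
      moreover have "(norm (\<beta> - y $ i))\<^sup>2 = s^4 * (norm (x $ i))\<^sup>2"
        using s by (simp add: yi norm_mult power_mult_distrib norm_power)
      moreover have "s^4 = s\<^sup>2 * s\<^sup>2" by (simp add: power4_eq_xxxx power2_eq_square)
      ultimately have "(norm (\<beta> - y $ i))\<^sup>2 + s\<^sup>2 * (\<Sum>j\<in>UNIV-{i}. (norm (y $ j))\<^sup>2)
          = (s\<^sup>2 * s\<^sup>2) * (norm (x $ i))\<^sup>2 + (s\<^sup>2 * s\<^sup>2) * (\<Sum>j\<in>UNIV-{i}. (norm (x $ j))\<^sup>2)" by (simp only: mult.assoc)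
      also have "\<dots> = (s\<^sup>2 * s\<^sup>2) * (norm x)\<^sup>2"
        unfolding norm_sq_vec_split[of x i] by (rule distrib_left[symmetric])
      also have "\<dots> = (s\<^sup>2 * norm x)\<^sup>2"
        unfolding power2_eq_square[of "s\<^sup>2 * norm x"] power2_eq_square[of "norm x"] by (simp only: mult_ac)
      finally show ?thesis .
    qed
    then have "pseudo_hyp b a * norm (1 - y $ i * cnj \<beta>) = s\<^sup>2 * norm x"
      using pseudo_hyp_coords[OF H(1,2) nb, of y] nz unfolding y s2[symmetric] by simp
    \<comment> \<open>Here |x| = rho |1 - x_i cnj(beta)| <= rho (1 + |x|), and rho <= 1/2 absorbs
      the last term; hence the factor 2.\<close>
    then have "norm x = pseudo_hyp b a * norm (1 - x $ i * cnj \<beta>)"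
      using s unfolding one by (simp add: norm_mult norm_power)
    also have "\<dots> \<le> pseudo_hyp b a * (1 + norm x)"
    proof (rule mult_left_mono)
      have "norm (x $ i) * norm \<beta> \<le> norm x * 1"
        using nb H(3) Finite_Cartesian_Product.norm_nth_le[of x i] by (intro mult_mono) auto
      then show "norm (1 - x $ i * cnj \<beta>) \<le> 1 + norm x"
        using norm_triangle_ineq4[of 1 "x $ i * cnj \<beta>"] by (simp add: norm_mult)
    qed (simp add: pseudo_hyp_def)
    also have "\<dots> \<le> pseudo_hyp b a + norm x / 2"
      using mult_right_mono[OF \<rho> norm_ge_zero[of x]] by (simp add: algebra_simps)
    finally have "norm x \<le> 2 * pseudo_hyp b a" by simp
    moreover have "a = b + L x" unfolding bL y yx[symmetric] ..
    ultimately show ?thesis by blast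
  qed
  show ?thesis
    by (rule that[of L], rule lin, rule Lsc, erule near, erule int, erule (1) inv)
qed


section \<open>Submean value and local oscillation estimates\<close>

text \<open>A holomorphic f is arbitrary outside the ball. The cutoff makes the function Borel on
  the whole space, so that all integrals can run over \<open>lborel\<close>.\<close>

definition pw :: "real \<Rightarrow> (complex ^ 'n::finite \<Rightarrow> complex) \<Rightarrow> complex ^ 'n \<Rightarrow> ennreal" where
  "pw p f z = ennreal (norm (f z) powr p) * indicator Bn z"

definition local_pw :: "real \<Rightarrow> (complex ^ 'n::finite \<Rightarrow> complex) \<Rightarrow> complex ^ 'n \<Rightarrow> ennreal" where
  "local_pw p f b = (\<integral>\<^sup>+z. pw p f z * indicator {z. near b z} z \<partial>lborel)"

lemma Bn_borel [measurable, simp]: "(Bn :: (complex ^ 'n::finite) set) \<in> sets borel"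
  by (simp add: Bn_def)

lemma holo_scalar_continuous_on: "holo_scalar f S \<Longrightarrow> continuous_on S f"
  unfolding holo_scalar_def
  by (meson continuous_at_imp_continuous_on has_derivative_continuous)

lemma pw_measurable [measurable]:
  assumes "holo_scalar f Bn"
  shows "pw p f \<in> borel_measurable borel"
proof -
  have [measurable]: "(\<lambda>z. indicator Bn z *\<^sub>R f z) \<in> borel_measurable borel"
    using holo_scalar_continuous_on[OF assms] by (intro borel_measurable_continuous_on_indicator) auto
  have "pw p f = (\<lambda>z. ennreal (norm (indicator Bn z *\<^sub>R f z) powr p) * indicator Bn z)"
    by (auto simp: pw_def indicator_def fun_eq_iff)
  also have "\<dots> \<in> borel_measurable borel" by measurable
  finally show ?thesis .
qed

lemma continuous_on_cinner [continuous_intros]: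
  "continuous_on S f \<Longrightarrow> continuous_on S g \<Longrightarrow> continuous_on S (\<lambda>x. cinner (f x) (g x))"
  unfolding cinner_def by (intro continuous_intros)

lemma near_measurable [measurable]:
  "{x. near (fst x) (snd x)} \<in> sets (borel :: ((complex ^ 'n::finite) \<times> (complex ^ 'n)) measure)"
  unfolding near_def
  by (intro borel_closed closed_Collect_conj closed_Collect_le continuous_intros) auto

lemma near_measurable_snd [measurable]: "{z. near b z} \<in> sets borel"
  unfolding near_def
  by (intro borel_closed closed_Collect_conj closed_Collect_le continuous_intros) auto

lemma near_measurable_fst [measurable]: "{b. near b z} \<in> sets borel"
  unfolding near_def
  by (intro borel_closed closed_Collect_conj closed_Collect_le continuous_intros) auto

lemma holo_scalar_affine:
  assumes f: "holo_scalar f S" and L: "linear L" "\<And>c x. L (c *s x) = c *s L x"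
    and T: "\<And>x. x \<in> T \<Longrightarrow> b + L x \<in> S"
  shows "holo_scalar (\<lambda>x. f (b + L x)) T"
  unfolding holo_scalar_def
proof
  fix x assume "x \<in> T"
  then obtain f' where f': "(f has_derivative f') (at (b + L x))" "\<And>c x. f' (c *s x) = c * f' x"
    using f T unfolding holo_scalar_def by metis
  have "((\<lambda>x. b + L x) has_derivative L) (at x)"
    using L(1) by (auto intro!: derivative_eq_intros linear_imp_has_derivative)
  from has_derivative_compose[OF this f'(1)]
  show "\<exists>f'. ((\<lambda>x. f (b + L x)) has_derivative f') (at x) \<and> (\<forall>c x. f' (c *s x) = c * f' x)"
    using f'(2) L(2) by auto
qed

lemma holo_scalar_slice:
  assumes f: "holo_scalar f S" and U: "open U" "\<And>w. w \<in> U \<Longrightarrow> a + w *s x \<in> S"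
  shows "(\<lambda>w. f (a + w *s x)) holomorphic_on U"
proof -
  have "(\<lambda>w. f (a + w *s x)) field_differentiable at w" if "w \<in> U" for w
  proof -
    have "a + w *s x \<in> S" using U(2) that .
    then obtain f' where f': "(f has_derivative f') (at (a + w *s x))" "\<And>c x. f' (c *s x) = c * f' x"
      using f unfolding holo_scalar_def by blast
    have "linear (\<lambda>w::complex. w *s x)"
      by (rule linearI) (simp_all add: vec_eq_iff algebra_simps)
    then have "((\<lambda>w. a + w *s x) has_derivative (\<lambda>w. w *s x)) (at w)"
      by (auto intro!: derivative_eq_intros linear_imp_has_derivative)
    from has_derivative_compose[OF this f'(1)]
    have "((\<lambda>w. f (a + w *s x)) has_derivative (*) (f' x)) (at w)"
      by (rule has_derivative_eq_rhs) (auto simp: f'(2))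
    then show ?thesis
      unfolding field_differentiable_def has_field_derivative_def by blast
  qed
  then show ?thesis
    unfolding holomorphic_on_def using field_differentiable_at_within by blast
qed

lemma nn_circle_mean_powr_mono:
  fixes F :: "complex \<Rightarrow> complex"
  assumes F: "F holomorphic_on ball 0 R" and st: "0 \<le> s" "s \<le> t" "t < R" and p: "p > 0"
  shows "(\<integral>\<^sup>+\<theta>. ennreal (norm (F (of_real s * cis \<theta>)) powr p) * indicator {0..2*pi} \<theta> \<partial>lborel)
       \<le> (\<integral>\<^sup>+\<theta>. ennreal (norm (F (of_real t * cis \<theta>)) powr p) * indicator {0..2*pi} \<theta> \<partial>lborel)"
proof -
  have eq: "(\<integral>\<^sup>+\<theta>. ennreal (norm (F (of_real r * cis \<theta>)) powr p) * indicator {0..2*pi} \<theta> \<partial>lborel)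
     = ennreal (integral {0..2*pi} (\<lambda>\<theta>. norm (F (of_real r * cis \<theta>)) powr p))" if r: "0 \<le> r" "r < R" for r
  proof -
    define h where "h = (\<lambda>\<theta>. norm (F (of_real r * cis \<theta>)) powr p)"
    have "continuous_on (ball 0 R) F" using F by (rule holomorphic_on_imp_continuous_on)
    then have "continuous_on {0..2*pi} (\<lambda>\<theta>. F (of_real r * cis \<theta>))"
      using r by (rule_tac continuous_on_compose2) (auto intro!: continuous_intros simp: norm_mult)
    then have "continuous_on {0..2*pi} h"
      unfolding h_def using p by (intro continuous_on_powr' continuous_intros) auto
    then have si: "set_integrable lborel {0..2*pi} h" by (rule borel_integrable_atLeastAtMost')
    have "(\<integral>\<^sup>+\<theta>. ennreal (h \<theta>) * indicator {0..2*pi} \<theta> \<partial>lborel) = (\<integral>\<^sup>+\<theta>. ennreal (indicator {0..2*pi} \<theta> *\<^sub>R h \<theta>) \<partial>lborel)"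
      by (intro nn_integral_cong) (auto simp: indicator_def)
    also have "\<dots> = ennreal (LINT \<theta>:{0..2*pi}|lborel. h \<theta>)"
      unfolding set_lebesgue_integral_def
      using si by (intro nn_integral_eq_integral) (auto simp: set_integrable_def h_def)
    also have "(LINT \<theta>:{0..2*pi}|lborel. h \<theta>) = integral {0..2*pi} h"
      using si by (rule set_borel_integral_eq_integral(2))
    finally show ?thesis by (simp add: h_def)
  qed
  show ?thesis
    using st by (simp add: eq ennreal_leI circle_mean_powr_mono[OF F st p])
qed

text \<open>For each angle, multiplication by e^(i theta) is unitary and preserves Lebesgue measure.
  Averaging over the angle places a circle integral inside the volume integral, where one-variable
  results apply.\<close>

lemma nn_integral_rotation_average:
  fixes F :: "complex ^ 'n::finite \<Rightarrow> ennreal"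
  assumes [measurable]: "F \<in> borel_measurable borel"
  shows "ennreal (2*pi) * (\<integral>\<^sup>+z. F z \<partial>lborel) = (\<integral>\<^sup>+z. \<integral>\<^sup>+\<theta>. F (cis \<theta> *s z) * indicator {0..2*pi} \<theta> \<partial>lborel \<partial>lborel)"
proof -
  have cont: "continuous_on UNIV (\<lambda>x :: (complex ^ 'n) \<times> real. cis (snd x) *s fst x)"
    unfolding vector_scalar_mult_def by (intro continuous_intros)
  then have [measurable]: "(\<lambda>x :: (complex ^ 'n) \<times> real. cis (snd x) *s fst x) \<in> borel_measurable (borel \<Otimes>\<^sub>M borel)"
    unfolding borel_prod by (rule borel_measurable_continuous_onI)
  have meas2: "(\<lambda>x. F (cis (snd x) *s fst x) * indicator {0..2*pi} (snd x)) \<in> borel_measurable (borel \<Otimes>\<^sub>M borel)"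
    by measurable
  have "ennreal (2*pi) * (\<integral>\<^sup>+z. F z \<partial>lborel) = (\<integral>\<^sup>+\<theta>. (\<integral>\<^sup>+z. F z \<partial>lborel) * indicator {0..2*pi} \<theta> \<partial>lborel)"
    by (simp add: nn_integral_cmult_indicator mult.commute)
  also have "\<dots> = (\<integral>\<^sup>+\<theta>. (\<integral>\<^sup>+z. F (cis \<theta> *s z) * indicator {0..2*pi} \<theta> \<partial>lborel) \<partial>lborel)"
  proof (rule nn_integral_cong)
    fix \<theta> :: real
    have "(\<integral>\<^sup>+z. F (cis \<theta> *s z) \<partial>lborel) = (\<integral>\<^sup>+z. F z \<partial>lborel)"
      by (rule nn_integral_lborel_isometry) (auto intro!: unitary_map_orthogonal unitary_map_scalar)
    then show "(\<integral>\<^sup>+z. F z \<partial>lborel) * indicator {0..2*pi} \<theta> = (\<integral>\<^sup>+z. F (cis \<theta> *s z) * indicator {0..2*pi} \<theta> \<partial>lborel)"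
      by (auto simp: indicator_def)
  qed
  also have "\<dots> = (\<integral>\<^sup>+z. \<integral>\<^sup>+\<theta>. F (cis \<theta> *s z) * indicator {0..2*pi} \<theta> \<partial>lborel \<partial>lborel)"
    by (rule lborel_pair.Fubini') (use meas2 in \<open>simp add: case_prod_unfold\<close>)
  finally show ?thesis .
qed

text \<open>After averaging over rotations the integrand at z is a circle mean of the slice w -> g(w
  z), and comparing the radii 0 and 1 gives the value at the centre.\<close>

lemma submean_ball:
  fixes g :: "complex ^ 'n::finite \<Rightarrow> complex"
  assumes g: "holo_scalar g (ball 0 \<kappa>)" and p: "p > 0"
  shows "ennreal (norm (g 0) powr p) * emeasure lborel (ball (0 :: complex ^ 'n) \<kappa>)
     \<le> (\<integral>\<^sup>+z. ennreal (norm (g z) powr p) * indicator (ball 0 \<kappa>) z \<partial>lborel)"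
proof -
  define F where "F = (\<lambda>z. ennreal (norm (g z) powr p) * indicator (ball 0 \<kappa>) z)"
  have [measurable]: "ball (0 :: complex ^ 'n) \<kappa> \<in> sets borel" by simp
  have [measurable]: "(\<lambda>z. indicator (ball 0 \<kappa>) z *\<^sub>R g z) \<in> borel_measurable borel"
    using holo_scalar_continuous_on[OF g] by (intro borel_measurable_continuous_on_indicator) auto
  have "F = (\<lambda>z. ennreal (norm (indicator (ball 0 \<kappa>) z *\<^sub>R g z) powr p) * indicator (ball 0 \<kappa>) z)"
    by (auto simp: F_def indicator_def fun_eq_iff)
  also have "\<dots> \<in> borel_measurable borel" by measurable
  finally have [measurable]: "F \<in> borel_measurable borel" .
  have "ennreal (2*pi) * (ennreal (norm (g 0) powr p) * emeasure lborel (ball (0 :: complex ^ 'n) \<kappa>))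
     = (\<integral>\<^sup>+z. ennreal (2*pi) * ennreal (norm (g 0) powr p) * indicator (ball (0 :: complex ^ 'n) \<kappa>) z \<partial>lborel)"
    by (subst nn_integral_cmult_indicator) (simp_all add: mult.assoc)
  also have "\<dots> \<le> (\<integral>\<^sup>+z. \<integral>\<^sup>+\<theta>. F (cis \<theta> *s z) * indicator {0..2*pi} \<theta> \<partial>lborel \<partial>lborel)"
  proof (rule nn_integral_mono)
    fix z :: "complex ^ 'n"
    show "ennreal (2*pi) * ennreal (norm (g 0) powr p) * indicator (ball (0 :: complex ^ 'n) \<kappa>) z
       \<le> (\<integral>\<^sup>+\<theta>. F (cis \<theta> *s z) * indicator {0..2*pi} \<theta> \<partial>lborel)"
    proof (cases "z \<in> ball 0 \<kappa>")
      case True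
      then have z: "norm z < \<kappa>" by simp
      then have \<kappa>: "\<kappa> > 0" using norm_ge_zero[of z] by linarith
      \<comment> \<open>The slice is defined for |w| < kappa / |z|, a radius above 1; at z = 0 this
        quotient would be 0, so 2 is taken instead.\<close>
      define R where "R = (if z = 0 then 2 else \<kappa> / norm z)"
      have R: "R > 1" using z by (auto simp: R_def)
      have "(\<lambda>w. g (0 + w *s z)) holomorphic_on ball 0 R"
        using \<kappa> by (intro holo_scalar_slice[OF g]) (auto simp: R_def norm_vector_scale field_simps split: if_splits)
      from nn_circle_mean_powr_mono[OF this, of 0 1 p] R p
      have "(\<integral>\<^sup>+\<theta>. ennreal (norm (g 0) powr p) * indicator {0..2*pi} \<theta> \<partial>lborel)
         \<le> (\<integral>\<^sup>+\<theta>. ennreal (norm (g (cis \<theta> *s z)) powr p) * indicator {0..2*pi} \<theta> \<partial>lborel)"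
        by simp
      also have "\<dots> = (\<integral>\<^sup>+\<theta>. F (cis \<theta> *s z) * indicator {0..2*pi} \<theta> \<partial>lborel)"
        using z by (intro nn_integral_cong) (auto simp: F_def norm_vector_scale)
      finally show ?thesis using True by (simp add: nn_integral_cmult_indicator mult.commute)
    qed simp
  qed
  also have "\<dots> = ennreal (2*pi) * (\<integral>\<^sup>+z. F z \<partial>lborel)"
    by (rule nn_integral_rotation_average[symmetric]) simp
  finally show ?thesis
    unfolding F_def[symmetric] by (subst (asm) ennreal_mult_le_mult_iff) auto
qed

text \<open>Schwarz's lemma for (h - h(0)) / (3 M) on the rescaled disc. The numerator is at most 2
  M in modulus; dividing by 3 M makes the required bound by 1 strict.\<close>

lemma holomorphic_bounded_lipschitz:
  fixes h :: "complex \<Rightarrow> complex"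
  assumes h: "h holomorphic_on ball 0 r" and M: "\<And>w. norm w < r \<Longrightarrow> norm (h w) \<le> M" and w: "norm w < r"
  shows "norm (h w - h 0) \<le> 3 * M * norm w / r"
proof (cases "M = 0")
  case True
  have "0 < r" using w norm_ge_zero[of w] by linarith
  then have "h w = 0" "h 0 = 0" using M[OF w] M[of 0] True by auto
  then show ?thesis using True by simp
next
  case False
  have r: "r > 0" using w norm_ge_zero[of w] by linarith
  have "M \<ge> 0" using M[OF w] norm_ge_zero[of "h w"] by linarith
  with False have M0: "M > 0" by simp
  define k where "k = (\<lambda>\<zeta>. (h (of_real r * \<zeta>) - h 0) / of_real (3 * M))"
  have "k holomorphic_on ball 0 1"
  proof -
    have "(h \<circ> (\<lambda>\<zeta>. of_real r * \<zeta>)) holomorphic_on ball 0 1"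
      using r by (intro holomorphic_on_compose_gen[OF _ h] holomorphic_intros) (auto simp: norm_mult)
    then show ?thesis unfolding k_def o_def using M0 by (intro holomorphic_intros) auto
  qed
  moreover have "k 0 = 0" by (simp add: k_def)
  moreover have "norm (k \<zeta>) < 1" if "norm \<zeta> < 1" for \<zeta>
  proof -
    have "norm (h (of_real r * \<zeta>) - h 0) \<le> 2 * M"
      using norm_triangle_ineq4[of "h (of_real r * \<zeta>)" "h 0"] M[of "of_real r * \<zeta>"] M[of 0] that r
      by (simp add: norm_mult)
    also have "\<dots> < 3 * M" using M0 by simp
    finally show ?thesis using M0 by (simp add: k_def norm_divide norm_mult)
  qed
  ultimately have "norm (k (w / of_real r)) \<le> norm (w / of_real r)"
    using w r by (intro Schwarz_Lemma(1)) (auto simp: norm_divide)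
  then show ?thesis using r M0 by (simp add: k_def norm_divide norm_mult field_simps)
qed


text \<open>Everything later needed from a chart at b, already applied to f: \<open>I\<close> is the
  local integral in chart coordinates, without the Jacobian. A point with |x| < 1/10 is the centre
  of a ball of radius 1/10 inside the chart ball of radius 1/5, so the submean property bounds the
  value of f there by \<open>I\<close>.\<close>

lemma local_pw_chart:
  fixes b :: "complex ^ 'n::finite"
  assumes b: "b \<in> Bn" and f: "holo_scalar f Bn" and p: "p > 0"
  obtains L :: "complex ^ 'n \<Rightarrow> complex ^ 'n" and I
  where "holo_scalar (\<lambda>x. f (b + L x)) (ball 0 (1/5))"
    "L 0 = 0" "\<And>a. a \<in> Bn \<Longrightarrow> pseudo_hyp b a \<le> 1/2 \<Longrightarrow> \<exists>x. a = b + L x \<and> norm x \<le> 2 * pseudo_hyp b a"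
    "local_pw p f b = ennreal ((1 - (norm b)\<^sup>2) ^ (CARD('n) + 1)) * I"
    "\<And>x. norm x < 1/10 \<Longrightarrow> ennreal (norm (f (b + L x)) powr p) * emeasure lborel (ball (0 :: complex ^ 'n) (1/10)) \<le> I"
proof -
  obtain L :: "complex ^ 'n \<Rightarrow> complex ^ 'n" where L: "linear L" "\<And>c x. L (c *s x) = c *s L x"
    and near: "\<And>x. norm x \<le> 1/5 \<Longrightarrow> near b (b + L x)"
    and int: "\<And>f. f \<in> borel_measurable borel \<Longrightarrow>
       (\<integral>\<^sup>+z. f z \<partial>lborel) = ennreal ((1 - (norm b)\<^sup>2) ^ (CARD('n) + 1)) * (\<integral>\<^sup>+x. f (b + L x) \<partial>lborel)"
    and inv: "\<And>a. a \<in> Bn \<Longrightarrow> pseudo_hyp b a \<le> 1/2 \<Longrightarrow> \<exists>x. a = b + L x \<and> norm x \<le> 2 * pseudo_hyp b a"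
    using ball_chart[OF b] by blast
  have hol: "holo_scalar (\<lambda>x. f (b + L x)) (ball 0 (1/5))"
    by (rule holo_scalar_affine[OF f L], rule near_imp_Bn[OF b near]) simp
  define F where "F = (\<lambda>z. pw p f z * indicator {z. near b z} z)"
  note [measurable] = pw_measurable[OF f]
  have F [measurable]: "F \<in> borel_measurable borel" unfolding F_def by measurable
  have [measurable]: "L \<in> borel_measurable borel"
    using L(1) by (intro borel_measurable_continuous_onI linear_continuous_on) (simp add: linear_conv_bounded_linear)
  define I where "I = (\<integral>\<^sup>+x. F (b + L x) \<partial>lborel)"
  have I: "ennreal (norm (f (b + L x)) powr p) * emeasure lborel (ball (0 :: complex ^ 'n) (1/10)) \<le> I"
    if x: "norm x < 1/10" for x
  proof -
    have "holo_scalar (\<lambda>y. f (b + L (x + y))) (ball 0 (1/10))"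
    proof (rule holo_scalar_affine[OF hol, of "\<lambda>y. y"])
      fix y :: "complex ^ 'n" assume "y \<in> ball 0 (1/10)"
      then show "x + y \<in> ball 0 (1/5)" using x norm_triangle_ineq[of x y] by simp
    qed (simp_all add: linear_id[unfolded id_def])
    from submean_ball[OF this p]
    have "ennreal (norm (f (b + L x)) powr p) * emeasure lborel (ball (0 :: complex ^ 'n) (1/10))
       \<le> (\<integral>\<^sup>+y. ennreal (norm (f (b + L (x + y))) powr p) * indicator (ball 0 (1/10)) y \<partial>lborel)" by simp
    also have "\<dots> \<le> (\<integral>\<^sup>+y. F (b + L (x + y)) \<partial>lborel)"
    proof (rule nn_integral_mono)
      fix y :: "complex ^ 'n"
      show "ennreal (norm (f (b + L (x + y))) powr p) * indicator (ball 0 (1/10)) y \<le> F (b + L (x + y))"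
      proof (cases "y \<in> ball 0 (1/10)")
        case True
        then have "norm (x + y) \<le> 1/5" using x norm_triangle_ineq[of x y] by simp
        then have "near b (b + L (x + y))" by (rule near)
        then show ?thesis using near_imp_Bn[OF b] by (simp add: F_def pw_def indicator_def)
      qed simp
    qed
    also have "\<dots> = I" unfolding I_def by (rule nn_integral_lborel_shift) simp
    finally show ?thesis .
  qed
  show ?thesis
    by (rule that[of L I], rule hol, rule linear_0[OF L(1)], erule (1) inv)
       (simp_all add: local_pw_def F_def[symmetric] int[OF F] I_def[symmetric] I)
qed

lemma pw_le_local_pw:
  fixes b :: "complex ^ 'n::finite"
  assumes b: "b \<in> Bn" and f: "holo_scalar f Bn" and p: "p > 0"
  shows "ennreal (norm (f b) powr p) * ennreal ((1 - (norm b)\<^sup>2) ^ (CARD('n) + 1))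
     \<le> ennreal (1 / measure lborel (ball (0 :: complex ^ 'n) (1/10))) * local_pw p f b"
proof -
  define v where "v = measure lborel (ball (0 :: complex ^ 'n) (1/10))"
  have v: "v > 0" unfolding v_def by (simp add: content_ball_pos)
  have ev: "emeasure lborel (ball (0 :: complex ^ 'n) (1/10)) = ennreal v"
    using emeasure_lborel_ball_finite[of "0 :: complex ^ 'n" "1/10"] by (simp add: v_def emeasure_eq_ennreal_measure)
  define S where "S = ennreal ((1 - (norm b)\<^sup>2) ^ (CARD('n) + 1))"
  obtain L :: "complex ^ 'n \<Rightarrow> complex ^ 'n" and I where L: "L 0 = 0" "local_pw p f b = S * I"
    "\<And>x. norm x < 1/10 \<Longrightarrow> ennreal (norm (f (b + L x)) powr p) * emeasure lborel (ball (0 :: complex ^ 'n) (1/10)) \<le> I"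
    using local_pw_chart[OF assms] unfolding S_def by metis
  have "ennreal (norm (f b) powr p) * S = ennreal (1 / v) * (S * (ennreal (norm (f b) powr p) * ennreal v))"
  proof -
    have "ennreal (1 / v) * ennreal v = 1" using v by (simp add: ennreal_mult'[symmetric])
    then show ?thesis by (metis (no_types, lifting) mult.assoc mult.commute mult.right_neutral)
  qed
  also have "\<dots> \<le> ennreal (1 / v) * local_pw p f b"
    unfolding L(2) using L(3)[of 0] by (intro mult_left_mono) (auto simp: L(1) ev)
  finally show ?thesis by (simp add: S_def v_def)
qed

text \<open>In the chart |f|^p is at most I / v on |x| < 1/10, and a has a coordinate with |x| <= 2
  rho <= 1/20. The one-variable Lipschitz bound on the complex line through x gives |f(a) - f(b)| <=
  30 M |x| <= 60 M rho, with M^p = I / v.\<close>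

lemma pw_diff_le_local_pw:
  fixes b :: "complex ^ 'n::finite"
  assumes b: "b \<in> Bn" and a: "a \<in> Bn" and f: "holo_scalar f Bn" and p: "p > 0" and \<rho>: "pseudo_hyp b a \<le> 1/40"
  shows "ennreal (norm (f a - f b) powr p) * ennreal ((1 - (norm b)\<^sup>2) ^ (CARD('n) + 1))
     \<le> ennreal (60 powr p / measure lborel (ball (0 :: complex ^ 'n) (1/10))) * (ennreal (pseudo_hyp b a powr p) * local_pw p f b)"
proof (cases "f a = f b")
  case False
  define v where "v = measure lborel (ball (0 :: complex ^ 'n) (1/10))"
  have v: "v > 0" unfolding v_def by (simp add: content_ball_pos)
  have ev: "emeasure lborel (ball (0 :: complex ^ 'n) (1/10)) = ennreal v"
    using emeasure_lborel_ball_finite[of "0 :: complex ^ 'n" "1/10"] by (simp add: v_def emeasure_eq_ennreal_measure)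
  define S where "S = (1 - (norm b)\<^sup>2) ^ (CARD('n) + 1)"
  have S: "S > 0" using b by (simp add: S_def mem_Bn_iff_sq)
  obtain L :: "complex ^ 'n \<Rightarrow> complex ^ 'n" and I where L: "L 0 = 0" "local_pw p f b = ennreal S * I"
    and hol: "holo_scalar (\<lambda>x. f (b + L x)) (ball 0 (1/5))"
    and inv: "\<And>a. a \<in> Bn \<Longrightarrow> pseudo_hyp b a \<le> 1/2 \<Longrightarrow> \<exists>x. a = b + L x \<and> norm x \<le> 2 * pseudo_hyp b a"
    and bd: "\<And>x. norm x < 1/10 \<Longrightarrow> ennreal (norm (f (b + L x)) powr p) * emeasure lborel (ball (0 :: complex ^ 'n) (1/10)) \<le> I"
    using local_pw_chart[OF b f p] unfolding S_def by metis
  obtain x where x: "a = b + L x" "norm x \<le> 2 * pseudo_hyp b a"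
    using inv[OF a] \<rho> by auto
  have xn: "x \<noteq> 0" using False x L(1) by auto
  then have \<rho>0: "pseudo_hyp b a > 0" using x(2) by (smt (verit) zero_less_norm_iff)
  show ?thesis
  \<comment> \<open>If the local integral is infinite, so is the right side; this uses rho > 0,
    which holds because f takes different values at a and b.\<close>
  proof (cases "I = top")
    case True
    then have "local_pw p f b = top" using S by (simp add: L(2) ennreal_mult_top)
    then show ?thesis using v \<rho>0 by (simp add: v_def[symmetric] ennreal_mult_top)
  next
    case fin: False
    then obtain i where i: "I = ennreal i" "i \<ge> 0" by (metis ennreal_cases)
    define M where "M = (i / v) powr (1 / p)"
    have bdM: "norm (f (b + L y)) \<le> M" if "norm y < 1/10" for y
    proof -
      have "norm (f (b + L y)) powr p * v \<le> i"
        using bd[OF that] i v unfolding ev by (simp add: ennreal_mult'[symmetric])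
      then have "norm (f (b + L y)) powr p \<le> i / v" using v by (simp add: field_simps)
      then have "(norm (f (b + L y)) powr p) powr (1/p) \<le> M"
        unfolding M_def using p by (intro powr_mono2) auto
      then show ?thesis using p by (simp add: powr_powr)
    qed
    have M0: "M \<ge> 0" by (simp add: M_def)
    define e where "e = (1 / complex_of_real (norm x)) *s x"
    have ne: "norm e = 1" using xn by (simp add: e_def norm_vector_scale norm_divide)
    define h where "h = (\<lambda>w. f (b + L (0 + w *s e)))"
    have "h holomorphic_on ball 0 (1/10)"
      unfolding h_def by (rule holo_scalar_slice[OF hol]) (auto simp: norm_vector_scale ne)
    moreover have "norm (h w) \<le> M" if "norm w < 1/10" for w
      unfolding h_def using that by (intro bdM) (simp add: norm_vector_scale ne)
    ultimately have "norm (h (of_real (norm x)) - h 0) \<le> 3 * M * norm (complex_of_real (norm x)) / (1/10)"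
      by (rule holomorphic_bounded_lipschitz) (use x(2) \<rho> in auto)
    moreover have "h (of_real (norm x)) = f a"
      unfolding h_def e_def x(1) using xn by (simp add: vector_smult_assoc)
    moreover have "h 0 = f b" by (simp add: h_def L(1))
    ultimately have "norm (f a - f b) \<le> 30 * M * norm x" by simp
    also have "\<dots> \<le> 30 * M * (2 * pseudo_hyp b a)"
      using x(2) M0 by (intro mult_left_mono) auto
    finally have "norm (f a - f b) \<le> 60 * pseudo_hyp b a * M" by (simp add: mult_ac)
    then have "norm (f a - f b) powr p \<le> (60 * pseudo_hyp b a * M) powr p"
      using p by (intro powr_mono2) auto
    also have "\<dots> = 60 powr p * pseudo_hyp b a powr p * (i / v)"
      using \<rho>0 M0 i v p by (simp add: powr_mult powr_powr M_def)
    finally have "norm (f a - f b) powr p * S \<le> 60 powr p * pseudo_hyp b a powr p * (i / v) * S"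
      using S by (intro mult_right_mono) auto
    then have "norm (f a - f b) powr p * S \<le> 60 powr p / v * (pseudo_hyp b a powr p * (S * i))"
      by (simp add: mult_ac)
    then show ?thesis
      unfolding L(2) i(1) v_def[symmetric] S_def[symmetric]
      using S i v by (simp add: ennreal_mult'[symmetric] ennreal_leI)
  qed
qed (use p in simp)


section \<open>Doubling weights\<close>

lemma nn_integral_dV:
  fixes F :: "complex ^ 'n::finite \<Rightarrow> ennreal"
  assumes F: "(\<lambda>z. F z * indicator Bn z) \<in> borel_measurable borel"
  shows "(\<integral>\<^sup>+z. F z \<partial>dV) = inverse (emeasure lborel (Bn :: (complex ^ 'n) set)) * (\<integral>\<^sup>+z. F z * indicator Bn z \<partial>lborel)"
proof -
  have [measurable]: "F \<in> borel_measurable (restrict_space lborel Bn)"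
    using F by (subst borel_measurable_restrict_space_iff_ennreal) (auto simp: mult.commute)
  have "(\<integral>\<^sup>+z. F z \<partial>dV) = (\<integral>\<^sup>+z. inverse (emeasure lborel (Bn :: (complex ^ 'n) set)) * F z \<partial>restrict_space lborel Bn)"
    unfolding dV_def by (subst nn_integral_density) auto
  also have "\<dots> = inverse (emeasure lborel (Bn :: (complex ^ 'n) set)) * (\<integral>\<^sup>+z. F z \<partial>restrict_space lborel Bn)"
    by (simp add: nn_integral_cmult)
  also have "(\<integral>\<^sup>+z. F z \<partial>restrict_space lborel Bn) = (\<integral>\<^sup>+z. F z * indicator Bn z \<partial>lborel)"
    by (subst nn_integral_restrict_space) auto
  finally show ?thesis .
qed

definition volB :: "'n::finite itself \<Rightarrow> real" where
  "volB _ = measure lborel (Bn :: (complex ^ 'n) set)"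

lemma volB_pos: "volB TYPE('n::finite) > 0"
  unfolding volB_def Bn_def by (simp add: content_ball_pos)

lemma emeasure_Bn: "emeasure lborel (Bn :: (complex ^ 'n::finite) set) = ennreal (volB TYPE('n))"
  unfolding volB_def Bn_def
  using emeasure_lborel_ball_finite[of "0 :: complex ^ 'n" 1] by (simp add: emeasure_eq_ennreal_measure)

text \<open>The weighted integral without the normalization of \<open>dV\<close>; it differs from
  \<open>Ap_integral\<close> by the constant factor \<open>volB\<close>.\<close>

definition wint :: "real \<Rightarrow> (real \<Rightarrow> real) \<Rightarrow> (complex ^ 'n::finite \<Rightarrow> complex) \<Rightarrow> ennreal" where
  "wint p \<omega> f = (\<integral>\<^sup>+z. pw p f z * ennreal (\<omega> (norm z)) \<partial>lborel)"

lemma Ap_integral_eq: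
  fixes f :: "complex ^ 'n::finite \<Rightarrow> complex"
  assumes f: "holo_scalar f Bn" and [measurable]: "\<omega> \<in> borel_measurable borel"
  shows "Ap_integral p \<omega> f = ennreal (1 / volB TYPE('n)) * wint p \<omega> f"
proof -
  have eq: "ennreal (norm (f z) powr p * \<omega> (norm z)) * indicator Bn z = pw p f z * ennreal (\<omega> (norm z))" for z
    by (auto simp: pw_def ennreal_mult' indicator_def)
  note [measurable] = pw_measurable[OF f]
  have "Ap_integral p \<omega> f = inverse (ennreal (volB TYPE('n))) * wint p \<omega> f"
    unfolding Ap_integral_def wint_def
    by (subst nn_integral_dV) (simp_all add: eq emeasure_Bn)
  then show ?thesis using volB_pos[where 'n='n] by (simp add: inverse_ennreal divide_inverse)
qed

text \<open>The factor 2n s^(2n-1) with which the sphere of radius s enters polar integration. The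
  dimension is carried by a type, hence the dummy argument.\<close>

definition rad_density :: "'n::finite itself \<Rightarrow> real \<Rightarrow> ennreal" where
  "rad_density _ s = ennreal (real DIM(complex ^ 'n) * s ^ (DIM(complex ^ 'n) - 1)) * indicator {0<..<1} s"

lemma rad_density_measurable [measurable]: "rad_density TYPE('n::finite) \<in> borel_measurable borel"
  unfolding rad_density_def by measurable

text \<open>A substitute for the integral over the sphere of radius s: the direction z / |z| of a
  point of the ball is uniformly distributed, so Lebesgue measure can stand in for surface measure.
  The total mass is the volume of the ball. At z = 0 the division yields 0, which affects a null set
  only.\<close>

definition sph_int :: "(complex ^ 'n::finite \<Rightarrow> ennreal) \<Rightarrow> real \<Rightarrow> ennreal" where
  "sph_int F s = (\<integral>\<^sup>+z. F ((s / norm z) *\<^sub>R z) * indicator Bn z \<partial>lborel)"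

lemma sph_int_measurable [measurable]:
  fixes F :: "complex ^ 'n::finite \<Rightarrow> ennreal"
  assumes [measurable]: "F \<in> borel_measurable borel"
  shows "sph_int F \<in> borel_measurable borel"
  unfolding sph_int_def by measurable

lemma nn_integral_Bn_polar:
  fixes F :: "complex ^ 'n::finite \<Rightarrow> ennreal"
  assumes [measurable]: "F \<in> borel_measurable borel" "h \<in> borel_measurable borel"
  shows "(\<integral>\<^sup>+z. F z * h (norm z) * indicator Bn z \<partial>lborel)
    = (\<integral>\<^sup>+s. sph_int F s * (h s * rad_density TYPE('n) s) \<partial>lborel)"
proof -
  define w where "w = rad_density TYPE('n)"
  have [measurable]: "w \<in> borel_measurable borel" unfolding w_def by measurable
  have "(\<integral>\<^sup>+z. F z * h (norm z) * indicator Bn z \<partial>lborel)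
    = (\<integral>\<^sup>+z. (\<integral>\<^sup>+s. F ((s / norm z) *\<^sub>R z) * h (norm ((s / norm z) *\<^sub>R z)) * w s \<partial>lborel) * indicator Bn z \<partial>lborel)"
    unfolding Bn_def w_def rad_density_def by (subst nn_integral_ball_polar) auto
  also have "\<dots> = (\<integral>\<^sup>+z. \<integral>\<^sup>+s. F ((s / norm z) *\<^sub>R z) * indicator Bn z * (h s * w s) \<partial>lborel \<partial>lborel)"
  proof (rule nn_integral_cong_AE, rule eventually_mono[OF AE_lborel_singleton[of 0]])
    fix z :: "complex ^ 'n" assume z: "z \<noteq> 0"
    have "(\<integral>\<^sup>+s. F ((s / norm z) *\<^sub>R z) * h (norm ((s / norm z) *\<^sub>R z)) * w s \<partial>lborel)
        = (\<integral>\<^sup>+s. F ((s / norm z) *\<^sub>R z) * (h s * w s) \<partial>lborel)"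
      using z by (intro nn_integral_cong) (auto simp: w_def rad_density_def indicator_def mult.assoc)
    then show "(\<integral>\<^sup>+s. F ((s / norm z) *\<^sub>R z) * h (norm ((s / norm z) *\<^sub>R z)) * w s \<partial>lborel) * indicator Bn z
        = (\<integral>\<^sup>+s. F ((s / norm z) *\<^sub>R z) * indicator Bn z * (h s * w s) \<partial>lborel)"
      by (auto simp: indicator_def)
  qed
  also have "\<dots> = (\<integral>\<^sup>+s. \<integral>\<^sup>+z. F ((s / norm z) *\<^sub>R z) * indicator Bn z * (h s * w s) \<partial>lborel \<partial>lborel)"
    by (rule lborel_pair.Fubini'[symmetric]) measurable
  also have "\<dots> = (\<integral>\<^sup>+s. sph_int F s * (h s * w s) \<partial>lborel)"
    unfolding sph_int_def by (intro nn_integral_cong) (simp add: nn_integral_multc)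
  finally show ?thesis by (simp add: w_def)
qed

text \<open>The rotations z -> e^(i theta) z preserve the ball, so the spherical integral is an
  average of circle means along complex lines through 0, and each of these increases with the
  radius.\<close>

lemma sph_int_pw_mono:
  fixes f :: "complex ^ 'n::finite \<Rightarrow> complex"
  assumes f: "holo_scalar f Bn" and p: "p > 0" and st: "0 \<le> s" "s \<le> t" "t < 1"
  shows "sph_int (pw p f) s \<le> sph_int (pw p f) t"
proof -
  note [measurable] = pw_measurable[OF f]
  have eq: "ennreal (2*pi) * sph_int (pw p f) r = (\<integral>\<^sup>+z. (\<integral>\<^sup>+\<theta>. ennreal (norm (f ((of_real r * cis \<theta>) *s ((1 / complex_of_real (norm z)) *s z))) powr p) * indicator {0..2*pi} \<theta> \<partial>lborel) * indicator Bn z \<partial>lborel)"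
    if r: "0 \<le> r" "r < 1" for r
  proof -
    have "ennreal (2*pi) * sph_int (pw p f) r = (\<integral>\<^sup>+z. \<integral>\<^sup>+\<theta>. pw p f ((r / norm (cis \<theta> *s z)) *\<^sub>R (cis \<theta> *s z)) * indicator Bn (cis \<theta> *s z) * indicator {0..2*pi} \<theta> \<partial>lborel \<partial>lborel)"
      unfolding sph_int_def by (rule nn_integral_rotation_average) measurable
    also have "\<dots> = (\<integral>\<^sup>+z. (\<integral>\<^sup>+\<theta>. ennreal (norm (f ((of_real r * cis \<theta>) *s ((1 / complex_of_real (norm z)) *s z))) powr p) * indicator {0..2*pi} \<theta> \<partial>lborel) * indicator Bn z \<partial>lborel)"
    proof (rule nn_integral_cong)
      fix z :: "complex ^ 'n"
      have "pw p f ((r / norm (cis \<theta> *s z)) *\<^sub>R (cis \<theta> *s z)) = ennreal (norm (f ((of_real r * cis \<theta>) *s ((1 / complex_of_real (norm z)) *s z))) powr p)" for \<theta>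
      proof -
        have e: "(r / norm (cis \<theta> *s z)) *\<^sub>R (cis \<theta> *s z) = (of_real r * cis \<theta>) *s ((1 / complex_of_real (norm z)) *s z)"
          by (simp add: scaleR_conv_vector_scale vector_smult_assoc norm_vector_scale)
        have "norm ((of_real r * cis \<theta>) *s ((1 / complex_of_real (norm z)) *s z)) \<le> r"
          using r by (simp add: norm_vector_scale norm_mult norm_divide)
        then show ?thesis using r unfolding pw_def e by (simp add: mem_Bn_iff indicator_def)
      qed
      then show "(\<integral>\<^sup>+\<theta>. pw p f ((r / norm (cis \<theta> *s z)) *\<^sub>R (cis \<theta> *s z)) * indicator Bn (cis \<theta> *s z) * indicator {0..2*pi} \<theta> \<partial>lborel)
        = (\<integral>\<^sup>+\<theta>. ennreal (norm (f ((of_real r * cis \<theta>) *s ((1 / complex_of_real (norm z)) *s z))) powr p) * indicator {0..2*pi} \<theta> \<partial>lborel) * indicator Bn z"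
        by (auto simp: indicator_def mem_Bn_iff norm_vector_scale)
    qed
    finally show ?thesis .
  qed
  have "ennreal (2*pi) * sph_int (pw p f) s \<le> ennreal (2*pi) * sph_int (pw p f) t"
    unfolding eq[OF st(1) le_less_trans[OF st(2,3)]] eq[OF order_trans[OF st(1,2)] st(3)]
  proof (rule nn_integral_mono, rule mult_right_mono)
    fix z :: "complex ^ 'n"
    define \<zeta> where "\<zeta> = (1 / complex_of_real (norm z)) *s z"
    have "norm \<zeta> \<le> 1" by (simp add: \<zeta>_def norm_vector_scale norm_divide)
    then have "norm w * norm \<zeta> \<le> norm w" for w :: complex by (simp add: mult_left_le)
    then have "(\<lambda>w. f (0 + w *s \<zeta>)) holomorphic_on ball 0 1"
      by (intro holo_scalar_slice[OF f]) (auto simp: mem_Bn_iff norm_vector_scale intro: le_less_trans)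
    from nn_circle_mean_powr_mono[OF this st p]
    show "(\<integral>\<^sup>+\<theta>. ennreal (norm (f ((of_real s * cis \<theta>) *s ((1 / complex_of_real (norm z)) *s z))) powr p) * indicator {0..2*pi} \<theta> \<partial>lborel)
       \<le> (\<integral>\<^sup>+\<theta>. ennreal (norm (f ((of_real t * cis \<theta>) *s ((1 / complex_of_real (norm z)) *s z))) powr p) * indicator {0..2*pi} \<theta> \<partial>lborel)"
      by (simp add: \<zeta>_def)
  qed simp
  then show ?thesis by (subst (asm) ennreal_mult_le_mult_iff) auto
qed

lemma omega_hat_antimono: "r \<le> r' \<Longrightarrow> omega_hat \<omega> r' \<le> omega_hat \<omega> r"
  unfolding omega_hat_def by (intro nn_integral_mono) (auto simp: indicator_def)

lemma omega_hat_measurable [measurable]: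
  assumes [measurable]: "\<omega> \<in> borel_measurable borel"
  shows "omega_hat \<omega> \<in> borel_measurable borel"
proof -
  have "omega_hat \<omega> = (\<lambda>r. \<integral>\<^sup>+ s. ennreal (\<omega> s) * (if r < s \<and> s < 1 then 1 else 0) \<partial>lborel)"
    unfolding omega_hat_def by (intro ext nn_integral_cong) (auto simp: indicator_def)
  also have "\<dots> \<in> borel_measurable borel" by measurable
  finally show ?thesis .
qed

lemma D_classD:
  assumes "D_class TYPE('n::finite) \<omega>"
  shows "\<And>s. 0 \<le> s \<Longrightarrow> s < 1 \<Longrightarrow> 0 < \<omega> s" "\<omega> \<in> borel_measurable borel"
    "integrable (dV :: (complex ^ 'n) measure) (\<lambda>z. \<omega> (norm z))"
    "D_hat \<omega>" "D_check \<omega>"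
  using assms by (auto simp: D_class_def radial_weight_def)

lemma sph_int_const: "sph_int (\<lambda>_ :: complex ^ 'n::finite. c) s = c * ennreal (volB TYPE('n))"
  unfolding sph_int_def by (simp add: nn_integral_cmult_indicator emeasure_Bn)

lemma nn_integral_radial_weight_finite:
  assumes \<omega>: "D_class TYPE('n::finite) \<omega>"
  shows "(\<integral>\<^sup>+z. ennreal (\<omega> (norm z)) * indicator (Bn :: (complex ^ 'n) set) z \<partial>lborel) < top"
proof -
  note [measurable] = D_classD(2)[OF \<omega>]
  have "(\<integral>\<^sup>+(z :: complex ^ 'n). ennreal (norm (\<omega> (norm z))) \<partial>dV) < top"
    using D_classD(3)[OF \<omega>] by (simp add: integrable_iff_bounded)
  moreover have "(\<integral>\<^sup>+(z :: complex ^ 'n). ennreal (norm (\<omega> (norm z))) \<partial>dV)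
     = ennreal (1 / volB TYPE('n)) * (\<integral>\<^sup>+z. ennreal (norm (\<omega> (norm z))) * indicator (Bn :: (complex ^ 'n) set) z \<partial>lborel)"
    by (subst nn_integral_dV) (use volB_pos[where 'n='n] in \<open>simp_all add: emeasure_Bn inverse_ennreal divide_inverse\<close>)
  ultimately have "(\<integral>\<^sup>+z. ennreal (norm (\<omega> (norm z))) * indicator (Bn :: (complex ^ 'n) set) z \<partial>lborel) < top"
    using volB_pos[where 'n='n] by (auto simp: ennreal_mult_less_top)
  moreover have "(\<integral>\<^sup>+z. ennreal (\<omega> (norm z)) * indicator (Bn :: (complex ^ 'n) set) z \<partial>lborel)
    \<le> (\<integral>\<^sup>+z. ennreal (norm (\<omega> (norm z))) * indicator (Bn :: (complex ^ 'n) set) z \<partial>lborel)"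
    by (intro nn_integral_mono mult_right_mono ennreal_leI) auto
  ultimately show ?thesis by (rule le_less_trans[rotated])
qed

text \<open>Integrability with respect to \<open>dV\<close> gives no direct control of omega near s
  = 0, where the radial density degenerates. It gives finiteness of the tail at 1/2, and upper
  doubling at r = 0 covers the rest.\<close>

lemma omega_hat_finite:
  assumes \<omega>: "D_class TYPE('n::finite) \<omega>" and r: "0 \<le> r"
  shows "omega_hat \<omega> r < top"
proof -
  note [measurable] = D_classD(2)[OF \<omega>]
  define d where "d = DIM(complex ^ 'n)"
  define c where "c = volB TYPE('n) * (real d * (1/2) ^ (d - 1))"
  have d: "d > 0" by (simp add: d_def)
  have c: "c > 0" using volB_pos[where 'n='n] d by (simp add: c_def)
  have "ennreal c * omega_hat \<omega> (1/2) = (\<integral>\<^sup>+s. ennreal c * (ennreal (\<omega> s) * indicator {1/2<..<1} s) \<partial>lborel)"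
    unfolding omega_hat_def by (simp add: nn_integral_cmult)
  also have "\<dots> \<le> (\<integral>\<^sup>+s. sph_int (\<lambda>_ :: complex ^ 'n. 1) s * (ennreal (\<omega> s) * rad_density TYPE('n) s) \<partial>lborel)"
  proof (rule nn_integral_mono)
    fix s :: real
    show "ennreal c * (ennreal (\<omega> s) * indicator {1/2<..<1} s) \<le> sph_int (\<lambda>_ :: complex ^ 'n. 1) s * (ennreal (\<omega> s) * rad_density TYPE('n) s)"
    proof (cases "s \<in> {1/2<..<1}")
      case True
      then have s: "1/2 \<le> s" by simp
      then have "(1/2) ^ (d - 1) \<le> s ^ (d - 1)" by (intro power_mono) auto
      then have "c \<le> volB TYPE('n) * (real d * s ^ (d - 1))"
        unfolding c_def using volB_pos[where 'n='n] by (intro mult_left_mono) auto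
      then have "ennreal c \<le> ennreal (volB TYPE('n)) * ennreal (real d * s ^ (d - 1))"
        using volB_pos[where 'n='n] s by (subst ennreal_mult[symmetric]) (auto intro: ennreal_leI)
      then have "ennreal c * ennreal (\<omega> s) \<le> ennreal (volB TYPE('n)) * ennreal (real d * s ^ (d - 1)) * ennreal (\<omega> s)"
        by (rule mult_right_mono) simp
      then show ?thesis using True unfolding d_def by (simp add: sph_int_const rad_density_def mult_ac)
    qed simp
  qed
  also have "\<dots> = (\<integral>\<^sup>+z. 1 * ennreal (\<omega> (norm z)) * indicator (Bn :: (complex ^ 'n) set) z \<partial>lborel)"
    by (subst nn_integral_Bn_polar) auto
  also have "\<dots> < top" using nn_integral_radial_weight_finite[OF \<omega>] by simp
  finally have half: "omega_hat \<omega> (1/2) < top" using c by (auto simp: ennreal_mult_less_top)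
  obtain C where "C \<ge> 1" "\<forall>r\<in>{0..<1}. omega_hat \<omega> r \<le> ennreal C * omega_hat \<omega> ((1 + r) / 2)"
    using D_classD(4)[OF \<omega>] unfolding D_hat_def by blast
  then have "omega_hat \<omega> 0 \<le> ennreal C * omega_hat \<omega> (1/2)" by force
  also have "\<dots> < top" using half by (simp add: ennreal_mult_less_top)
  finally show ?thesis using omega_hat_antimono[OF r, of \<omega>] by (rule le_less_trans[rotated])
qed

text \<open>With s' the outer radius and A the mass of the annulus, omega^(s) = A + omega^(s'),
  while lower doubling says C omega^(s') <= omega^(s). Eliminating omega^(s'), which is finite,
  yields the factor C / (C - 1).\<close>

lemma D_check_le_annulus:
  assumes \<omega>: "D_class TYPE('n::finite) \<omega>"
  obtains C K where "C > 0" "K > 1"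
    "\<And>s. 0 \<le> s \<Longrightarrow> s < 1 \<Longrightarrow> omega_hat \<omega> s \<le> ennreal C * (\<integral>\<^sup>+t. ennreal (\<omega> t) * indicator {s<..1 - (1 - s) / K} t \<partial>lborel)"
proof -
  note [measurable] = D_classD(2)[OF \<omega>]
  obtain C K where CK: "C > 1" "K > 1" "\<forall>r\<in>{0..<1}. omega_hat \<omega> r \<ge> ennreal C * omega_hat \<omega> (1 - (1 - r) / K)"
    using D_classD(5)[OF \<omega>] unfolding D_check_def by blast
  show ?thesis
  proof (rule that[of "C / (C - 1)" K])
    fix s :: real assume s: "0 \<le> s" "s < 1"
    define s' where "s' = 1 - (1 - s) / K"
    have "(1 - s) / K < 1 - s" "0 < (1 - s) / K" using s CK by (auto simp: divide_less_eq)
    then have s': "s < s'" "s' < 1" by (auto simp: s'_def)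
    define A where "A = (\<integral>\<^sup>+t. ennreal (\<omega> t) * indicator {s<..s'} t \<partial>lborel)"
    have split: "omega_hat \<omega> s = A + omega_hat \<omega> s'"
      unfolding omega_hat_def A_def using s'
      by (subst nn_integral_add[symmetric]) (auto intro!: nn_integral_cong simp: indicator_def)
    have fin: "omega_hat \<omega> s < top" "omega_hat \<omega> s' < top" using omega_hat_finite[OF \<omega>] s s' by auto
    then have "A < top" using split by (metis ennreal_add_less_top)
    then obtain a w where aw: "A = ennreal a" "a \<ge> 0" "omega_hat \<omega> s' = ennreal w" "w \<ge> 0"
      using fin by (metis ennreal_cases less_irrefl)
    have "ennreal C * omega_hat \<omega> s' \<le> omega_hat \<omega> s" using CK(3) s by (simp add: s'_def)
    then have "C * w \<le> a + w" using aw CK unfolding split by (simp add: ennreal_mult'[symmetric] ennreal_plus[symmetric] del: ennreal_plus)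
    then have "(a + w) * (C - 1) \<le> C * a" by (simp add: algebra_simps)
    then have "a + w \<le> C / (C - 1) * a" using CK by (simp add: field_simps)
    then have "omega_hat \<omega> s \<le> ennreal (C / (C - 1)) * A"
      using aw CK unfolding split by (simp add: ennreal_mult'[symmetric] ennreal_plus[symmetric] del: ennreal_plus)
    then show "omega_hat \<omega> s \<le> ennreal (C / (C - 1)) * (\<integral>\<^sup>+t. ennreal (\<omega> t) * indicator {s<..1 - (1 - s) / K} t \<partial>lborel)"
      by (simp add: A_def s'_def)
  qed (use CK in auto)
qed


text \<open>The defining inequality of the lower doubling class replaces \<open>omega_hat\<close> by the mass of \<open>\<omega>\<close>
  on a slightly larger annulus, where the spherical means of \<open>|f|\<^sup>p\<close> are larger.\<close>

lemma nn_integral_omega_hat_le: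
  assumes \<omega>: "D_class TYPE('n::finite) \<omega>" and p: "p > 0"
  obtains C where "C > 0" "\<And>f :: complex ^ 'n \<Rightarrow> complex. holo_scalar f Bn \<Longrightarrow>
    (\<integral>\<^sup>+z. pw p f z * (omega_hat \<omega> (norm z) * ennreal (1 / (1 - norm z))) \<partial>lborel) \<le> ennreal C * wint p \<omega> f"
proof -
  note [measurable] = D_classD(2)[OF \<omega>]
  obtain C K where CK: "C > 0" "K > 1"
    "\<And>s. 0 \<le> s \<Longrightarrow> s < 1 \<Longrightarrow> omega_hat \<omega> s \<le> ennreal C * (\<integral>\<^sup>+t. ennreal (\<omega> t) * indicator {s<..1 - (1 - s) / K} t \<partial>lborel)"
    using D_check_le_annulus[OF \<omega>] by blast
  show ?thesis
  proof (rule that[of "C * K"])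
    fix f :: "complex ^ 'n \<Rightarrow> complex" assume f: "holo_scalar f Bn"
    note [measurable] = pw_measurable[OF f]
    define M where "M = sph_int (pw p f)"
    have [measurable]: "M \<in> borel_measurable borel" unfolding M_def by measurable
    define w where "w = rad_density TYPE('n)"
    have [measurable]: "w \<in> borel_measurable borel" unfolding w_def by measurable
    have ind: "pw p f z * x = pw p f z * x * indicator Bn z" for z x
      by (auto simp: pw_def indicator_def)
    \<comment> \<open>\<open>J\<close> relates a radius s to the points t of its annulus. For fixed
      t the admissible s lie in an interval of length at most K (1 - t), which cancels the factor 1
      / (1 - t) once the integrals are exchanged.\<close>
    define J where "J = (\<lambda>s t. if s < t \<and> 1 - s \<le> K * (1 - t) \<and> t < 1 then 1 else 0 :: ennreal)"
    have [measurable]: "(\<lambda>(s, t). J s t) \<in> borel_measurable (borel \<Otimes>\<^sub>M borel)"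
      unfolding J_def by measurable
    have "(\<integral>\<^sup>+z. pw p f z * (omega_hat \<omega> (norm z) * ennreal (1 / (1 - norm z))) \<partial>lborel)
        = (\<integral>\<^sup>+z. pw p f z * (\<lambda>s. omega_hat \<omega> s * ennreal (1 / (1 - s))) (norm z) * indicator Bn z \<partial>lborel)"
      by (subst ind) simp
    also have "\<dots> = (\<integral>\<^sup>+s. M s * ((omega_hat \<omega> s * ennreal (1 / (1 - s))) * w s) \<partial>lborel)"
      unfolding M_def w_def by (rule nn_integral_Bn_polar) measurable
    also have "\<dots> \<le> (\<integral>\<^sup>+s. ennreal C * (\<integral>\<^sup>+t. M t * (ennreal (\<omega> t) * w t) * (ennreal (1 / (1 - t)) * J s t) \<partial>lborel) \<partial>lborel)"
    proof (rule nn_integral_mono)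
      fix s :: real
      show "M s * ((omega_hat \<omega> s * ennreal (1 / (1 - s))) * w s)
         \<le> ennreal C * (\<integral>\<^sup>+t. M t * (ennreal (\<omega> t) * w t) * (ennreal (1 / (1 - t)) * J s t) \<partial>lborel)"
      proof (cases "s \<in> {0<..<1}")
        case True
        then have s: "0 < s" "s < 1" by auto
        have "M s * ((omega_hat \<omega> s * ennreal (1 / (1 - s))) * w s)
           \<le> M s * ((ennreal C * (\<integral>\<^sup>+t. ennreal (\<omega> t) * indicator {s<..1 - (1 - s) / K} t \<partial>lborel) * ennreal (1 / (1 - s))) * w s)"
          using CK(3)[of s] s by (intro mult_left_mono mult_right_mono) auto
        also have "\<dots> = ennreal C * (\<integral>\<^sup>+t. (M s * (ennreal (1 / (1 - s)) * w s)) * (ennreal (\<omega> t) * indicator {s<..1 - (1 - s) / K} t) \<partial>lborel)"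
          by (subst nn_integral_cmult) (auto simp: mult_ac)
        also have "\<dots> \<le> ennreal C * (\<integral>\<^sup>+t. M t * (ennreal (\<omega> t) * w t) * (ennreal (1 / (1 - t)) * J s t) \<partial>lborel)"
        proof (intro mult_left_mono nn_integral_mono)
          fix t :: real
          show "(M s * (ennreal (1 / (1 - s)) * w s)) * (ennreal (\<omega> t) * indicator {s<..1 - (1 - s) / K} t)
             \<le> M t * (ennreal (\<omega> t) * w t) * (ennreal (1 / (1 - t)) * J s t)"
          proof (cases "t \<in> {s<..1 - (1 - s) / K}")
            case True
            then have t: "s < t" "(1 - s) / K \<le> 1 - t" by auto
            have "0 < (1 - s) / K" using s CK by simp
            with t have t1: "t < 1" by linarith
            have "1 - s \<le> K * (1 - t)" using t CK by (simp add: divide_le_eq mult.commute)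
            then have J: "J s t = 1" using t t1 by (simp add: J_def)
            have "M s \<le> M t" unfolding M_def using s t t1 by (intro sph_int_pw_mono f p) auto
            moreover have "w s \<le> w t" unfolding w_def rad_density_def using s t t1
              by (auto intro!: ennreal_leI mult_left_mono power_mono simp: indicator_def)
            moreover have "ennreal (1 / (1 - s)) \<le> ennreal (1 / (1 - t))"
              using s t t1 by (intro ennreal_leI) (simp add: frac_le)
            ultimately have "M s * (ennreal (1 / (1 - s)) * w s) \<le> M t * (ennreal (1 / (1 - t)) * w t)"
              by (intro mult_mono) auto
            then have "M s * (ennreal (1 / (1 - s)) * w s) * ennreal (\<omega> t) \<le> M t * (ennreal (1 / (1 - t)) * w t) * ennreal (\<omega> t)"
              by (rule mult_right_mono) simp
            then show ?thesis using True J by (simp add: mult_ac)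
          qed simp
        qed simp_all
        finally show ?thesis .
      qed (simp add: w_def rad_density_def)
    qed
    also have "\<dots> = ennreal C * (\<integral>\<^sup>+s. \<integral>\<^sup>+t. M t * (ennreal (\<omega> t) * w t) * (ennreal (1 / (1 - t)) * J s t) \<partial>lborel \<partial>lborel)"
      by (rule nn_integral_cmult) measurable
    also have "\<dots> = ennreal C * (\<integral>\<^sup>+t. \<integral>\<^sup>+s. M t * (ennreal (\<omega> t) * w t) * (ennreal (1 / (1 - t)) * J s t) \<partial>lborel \<partial>lborel)"
      by (rule arg_cong[OF lborel_pair.Fubini']) (unfold J_def, measurable)
    also have "\<dots> \<le> ennreal C * (\<integral>\<^sup>+t. ennreal K * (M t * (ennreal (\<omega> t) * w t)) \<partial>lborel)"
    proof (intro mult_left_mono nn_integral_mono)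
      fix t :: real
      show "(\<integral>\<^sup>+s. M t * (ennreal (\<omega> t) * w t) * (ennreal (1 / (1 - t)) * J s t) \<partial>lborel) \<le> ennreal K * (M t * (ennreal (\<omega> t) * w t))"
      proof (cases "t < 1")
        case True
        have "(\<integral>\<^sup>+s. ennreal (1 / (1 - t)) * J s t \<partial>lborel) \<le> (\<integral>\<^sup>+s. ennreal (1 / (1 - t)) * indicator {1 - K * (1 - t)..t} s \<partial>lborel)"
          by (intro nn_integral_mono mult_left_mono) (auto simp: J_def indicator_def)
        also have "\<dots> \<le> ennreal (1 / (1 - t)) * ennreal (K * (1 - t))"
          using True CK by (simp add: nn_integral_cmult_indicator emeasure_lborel_Icc_eq)
             (auto intro!: mult_left_mono ennreal_leI)
        also have "\<dots> = ennreal K" using True CK by (simp add: ennreal_mult'[symmetric])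
        finally have "M t * (ennreal (\<omega> t) * w t) * (\<integral>\<^sup>+s. ennreal (1 / (1 - t)) * J s t \<partial>lborel) \<le> M t * (ennreal (\<omega> t) * w t) * ennreal K"
          by (rule mult_left_mono) simp
        then show ?thesis by (subst nn_integral_cmult) (auto simp: mult.commute)
      qed (simp add: J_def)
    qed simp
    also have "\<dots> = ennreal C * (ennreal K * wint p \<omega> f)"
    proof -
      have "wint p \<omega> f = (\<integral>\<^sup>+z. pw p f z * (\<lambda>s. ennreal (\<omega> s)) (norm z) * indicator Bn z \<partial>lborel)"
        unfolding wint_def by (subst ind) simp
      also have "\<dots> = (\<integral>\<^sup>+t. M t * (ennreal (\<omega> t) * w t) \<partial>lborel)"
        unfolding M_def w_def by (rule nn_integral_Bn_polar) measurable
      finally show ?thesis by (simp add: nn_integral_cmult)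
    qed
    also have "\<dots> = ennreal (C * K) * wint p \<omega> f" using CK by (simp add: ennreal_mult mult.assoc)
    finally show "(\<integral>\<^sup>+z. pw p f z * (omega_hat \<omega> (norm z) * ennreal (1 / (1 - norm z))) \<partial>lborel) \<le> ennreal (C * K) * wint p \<omega> f" .
  qed (use CK in simp)
qed

lemma one_minus_norm_sq_bounds:
  assumes "norm z < 1"
  shows "1 - norm z \<le> 1 - (norm z)\<^sup>2" "1 - (norm z)\<^sup>2 \<le> 2 * (1 - norm z)"
proof -
  have "1 - (norm z)\<^sup>2 = (1 - norm z) * (1 + norm z)" by (simp add: power2_eq_square algebra_simps)
  moreover have "(1 - norm z) * 1 \<le> (1 - norm z) * (1 + norm z)" "(1 - norm z) * (1 + norm z) \<le> (1 - norm z) * 2"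
    using assms by (intro mult_left_mono; simp)+
  ultimately show "1 - norm z \<le> 1 - (norm z)\<^sup>2" "1 - (norm z)\<^sup>2 \<le> 2 * (1 - norm z)" by auto
qed

lemma near_norm_bounds:
  assumes "a \<in> Bn" "near a z"
  shows "1 - norm z \<le> 4 * (1 - norm a)" "(1 - norm a) / 4 \<le> 1 - norm z"
proof -
  have "norm a < 1" "norm z < 1" using assms near_imp_Bn[of a z] by (auto simp: mem_Bn_iff)
  note b = one_minus_norm_sq_bounds[OF this(1)] one_minus_norm_sq_bounds[OF this(2)]
  have "(1 - (norm a)\<^sup>2) / 2 \<le> 1 - (norm z)\<^sup>2" "1 - (norm z)\<^sup>2 \<le> 2 * (1 - (norm a)\<^sup>2)"
    using assms(2) by (auto simp: near_def)
  with b show "1 - norm z \<le> 4 * (1 - norm a)" "(1 - norm a) / 4 \<le> 1 - norm z" by argo+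
qed

text \<open>The truncation at \<open>0\<close> lets the doubling inequality hold for all scales \<open>x\<close>.\<close>

lemma omega_hat_doubling:
  assumes \<omega>: "D_class TYPE('n::finite) \<omega>"
  obtains C where "C \<ge> 1" "\<And>x. x > 0 \<Longrightarrow> omega_hat \<omega> (max 0 (1 - 2 * x)) \<le> ennreal C * omega_hat \<omega> (max 0 (1 - x))"
proof -
  obtain C where C: "C \<ge> 1" "\<forall>r\<in>{0..<1}. omega_hat \<omega> r \<le> ennreal C * omega_hat \<omega> ((1 + r) / 2)"
    using D_classD(4)[OF \<omega>] unfolding D_hat_def by blast
  show ?thesis
  proof (rule that[of C])
    fix x :: real assume x: "x > 0"
    define r where "r = max 0 (1 - 2 * x)"
    have "omega_hat \<omega> r \<le> ennreal C * omega_hat \<omega> ((1 + r) / 2)" using C(2) x by (auto simp: r_def)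
    also have "\<dots> \<le> ennreal C * omega_hat \<omega> (max 0 (1 - x))"
      by (intro mult_left_mono omega_hat_antimono) (auto simp: r_def max_def field_simps)
    finally show "omega_hat \<omega> (max 0 (1 - 2 * x)) \<le> ennreal C * omega_hat \<omega> (max 0 (1 - x))" by (simp add: r_def)
  qed (use C in auto)
qed

text \<open>The submean estimate bounds |f(a)|^p (1 - |a|^2)^(n+1) by the integral of |f|^p near a.
  There 1 - |z| <= 4 (1 - |a|), and omega^(|a|) is at most a multiple of omega^(|z|), so multiplying
  by omega^(|a|) gives at most a constant times 1 - |a| times the integral against the smoothed
  weight. Cancelling 1 - |a| leaves the exponent n.\<close>

lemma Ap_growth:
  assumes \<omega>: "D_class TYPE('n::finite) \<omega>" and p: "p > 0"
  obtains C where "C > 0" "\<And>(f :: complex ^ 'n \<Rightarrow> complex) a. holo_scalar f Bn \<Longrightarrow> a \<in> Bn \<Longrightarrow>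
    ennreal (norm (f a) powr p * (1 - norm a) ^ CARD('n)) * omega_hat \<omega> (norm a) \<le> ennreal C * wint p \<omega> f"
proof -
  note [measurable] = D_classD(2)[OF \<omega>]
  obtain C3 where C3: "C3 > 0" "\<And>f :: complex ^ 'n \<Rightarrow> complex. holo_scalar f Bn \<Longrightarrow>
    (\<integral>\<^sup>+z. pw p f z * (omega_hat \<omega> (norm z) * ennreal (1 / (1 - norm z))) \<partial>lborel) \<le> ennreal C3 * wint p \<omega> f"
    using nn_integral_omega_hat_le[OF \<omega> p] by blast
  obtain D where D: "D \<ge> 1" "\<And>x. x > 0 \<Longrightarrow> omega_hat \<omega> (max 0 (1 - 2 * x)) \<le> ennreal D * omega_hat \<omega> (max 0 (1 - x))"
    using omega_hat_doubling[OF \<omega>] by blast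
  define v where "v = measure lborel (ball (0 :: complex ^ 'n) (1/10))"
  have v: "v > 0" unfolding v_def by (simp add: content_ball_pos)
  show ?thesis
  proof (rule that[of "1 / v * (4 * D\<^sup>2 * C3)"])
    fix f :: "complex ^ 'n \<Rightarrow> complex" and a :: "complex ^ 'n"
    assume f: "holo_scalar f Bn" and a: "a \<in> Bn"
    note [measurable] = pw_measurable[OF f]
    define \<delta> where "\<delta> = 1 - norm a"
    have \<delta>: "0 < \<delta>" "\<delta> \<le> 1" using a by (auto simp: \<delta>_def mem_Bn_iff)
    define n where "n = CARD('n)"
    have na: "norm a < 1" using a by (simp add: mem_Bn_iff)
    define W where "W = omega_hat \<omega> (norm a)"
    \<comment> \<open>Points near a may be four times closer to the sphere than a, which takes two
      doublings: from delta to delta / 2 and on to delta / 4.\<close>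
    have W4: "W \<le> ennreal (D\<^sup>2) * omega_hat \<omega> (1 - \<delta> / 4)"
    proof -
      have "max 0 (1 - 2 * (\<delta> / 2)) = norm a" unfolding \<delta>_def by (simp add: field_simps)
      then have "W = omega_hat \<omega> (max 0 (1 - 2 * (\<delta> / 2)))" by (simp only: W_def)
      also have "\<dots> \<le> ennreal D * omega_hat \<omega> (max 0 (1 - \<delta> / 2))" using D(2)[of "\<delta> / 2"] \<delta> by simp
      also have "omega_hat \<omega> (max 0 (1 - \<delta> / 2)) \<le> ennreal D * omega_hat \<omega> (max 0 (1 - \<delta> / 4))"
        using D(2)[of "\<delta> / 4"] \<delta> by simp
      also have "max 0 (1 - \<delta> / 4) = 1 - \<delta> / 4" using \<delta> by simp
      finally show ?thesis
        using D(1) by (simp add: power2_eq_square ennreal_mult mult.assoc mult_left_mono)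
    qed
    have loc: "W * local_pw p f a \<le> ennreal (4 * D\<^sup>2 * \<delta>) * (ennreal C3 * wint p \<omega> f)"
    proof -
      have "W * local_pw p f a = (\<integral>\<^sup>+z. W * (pw p f z * indicator {z. near a z} z) \<partial>lborel)"
        unfolding local_pw_def by (rule nn_integral_cmult[symmetric]) measurable
      also have "\<dots> \<le> (\<integral>\<^sup>+z. ennreal (4 * D\<^sup>2 * \<delta>) * (pw p f z * (omega_hat \<omega> (norm z) * ennreal (1 / (1 - norm z)))) \<partial>lborel)"
      proof (rule nn_integral_mono)
        fix z :: "complex ^ 'n"
        show "W * (pw p f z * indicator {z. near a z} z) \<le> ennreal (4 * D\<^sup>2 * \<delta>) * (pw p f z * (omega_hat \<omega> (norm z) * ennreal (1 / (1 - norm z))))"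
        proof (cases "near a z")
          case True
          then have z: "norm z < 1" using near_imp_Bn[OF a] by (simp add: mem_Bn_iff)
          have "1 - norm z \<le> 4 * \<delta>" "\<delta> / 4 \<le> 1 - norm z"
            using near_norm_bounds[OF a True] by (simp_all add: \<delta>_def)
          then have "1 \<le> 4 * \<delta> * (1 / (1 - norm z))" "norm z \<le> 1 - \<delta> / 4" using z by (auto simp: field_simps)
          have "W \<le> ennreal (D\<^sup>2) * omega_hat \<omega> (norm z) * 1"
            using W4 omega_hat_antimono[OF \<open>norm z \<le> 1 - \<delta> / 4\<close>, of \<omega>]
            by (simp add: order_trans[OF W4] mult_left_mono)
          also have "\<dots> \<le> ennreal (D\<^sup>2) * omega_hat \<omega> (norm z) * ennreal (4 * \<delta> * (1 / (1 - norm z)))"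
            using \<open>1 \<le> 4 * \<delta> * (1 / (1 - norm z))\<close> by (intro mult_left_mono) (auto simp: ennreal_leI simp flip: ennreal_1)
          also have "\<dots> = ennreal (4 * D\<^sup>2 * \<delta>) * (omega_hat \<omega> (norm z) * ennreal (1 / (1 - norm z)))"
          proof -
            have e: "ennreal (D\<^sup>2) * ennreal (4 * \<delta> * (1 / (1 - norm z))) = ennreal (4 * D\<^sup>2 * \<delta>) * ennreal (1 / (1 - norm z))"
              using \<delta> z by (simp add: ennreal_mult'[symmetric] mult_ac)
            have "ennreal (D\<^sup>2) * omega_hat \<omega> (norm z) * ennreal (4 * \<delta> * (1 / (1 - norm z)))
              = (ennreal (D\<^sup>2) * ennreal (4 * \<delta> * (1 / (1 - norm z)))) * omega_hat \<omega> (norm z)" by (simp only: mult_ac)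
            then show ?thesis unfolding e by (simp only: mult_ac)
          qed
          finally have "W * pw p f z \<le> ennreal (4 * D\<^sup>2 * \<delta>) * (omega_hat \<omega> (norm z) * ennreal (1 / (1 - norm z))) * pw p f z"
            by (rule mult_right_mono) simp
          then show ?thesis using True by (simp add: mult_ac)
        qed simp
      qed
      also have "\<dots> = ennreal (4 * D\<^sup>2 * \<delta>) * (\<integral>\<^sup>+z. pw p f z * (omega_hat \<omega> (norm z) * ennreal (1 / (1 - norm z))) \<partial>lborel)"
        by (rule nn_integral_cmult) measurable
      also have "\<dots> \<le> ennreal (4 * D\<^sup>2 * \<delta>) * (ennreal C3 * wint p \<omega> f)"
        by (intro mult_left_mono C3 f) auto
      finally show ?thesis .
    qed
    have "ennreal \<delta> * (ennreal (norm (f a) powr p * \<delta> ^ n) * W) = (ennreal (norm (f a) powr p) * ennreal (\<delta> ^ (n + 1))) * W"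
      using \<delta> by (simp add: ennreal_mult mult_ac)
    also have "\<dots> \<le> (ennreal (norm (f a) powr p) * ennreal ((1 - (norm a)\<^sup>2) ^ (CARD('n) + 1))) * W"
      using one_minus_norm_sq_bounds(1)[OF na] \<delta> unfolding n_def
      by (intro mult_right_mono mult_left_mono ennreal_leI power_mono) (auto simp: \<delta>_def)
    also have "\<dots> \<le> (ennreal (1 / v) * local_pw p f a) * W"
      unfolding v_def by (intro mult_right_mono pw_le_local_pw a f p) auto
    also have "\<dots> = ennreal (1 / v) * (W * local_pw p f a)" by (simp add: mult_ac)
    also have "\<dots> \<le> ennreal (1 / v) * (ennreal (4 * D\<^sup>2 * \<delta>) * (ennreal C3 * wint p \<omega> f))"
      by (intro mult_left_mono loc) auto
    also have "\<dots> = ennreal \<delta> * (ennreal (1 / v * (4 * D\<^sup>2 * C3)) * wint p \<omega> f)"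
      using v C3 \<delta> by (simp add: ennreal_mult mult_ac del: times_divide_eq_left)
    finally have "ennreal (norm (f a) powr p * \<delta> ^ n) * W \<le> ennreal (1 / v * (4 * D\<^sup>2 * C3)) * wint p \<omega> f"
      using \<delta> by (subst (asm) ennreal_mult_le_mult_iff) auto
    then show "ennreal (norm (f a) powr p * (1 - norm a) ^ CARD('n)) * omega_hat \<omega> (norm a) \<le> ennreal (1 / v * (4 * D\<^sup>2 * C3)) * wint p \<omega> f"
      by (simp add: W_def n_def \<delta>_def)
  qed (use v C3 D in auto)
qed


section \<open>Kernel functions\<close>

text \<open>A nonisotropic region at the sphere in the direction of a; it contains points of the
  ball only if t > 1 - |a|.\<close>

definition cap :: "complex ^ 'n::finite \<Rightarrow> real \<Rightarrow> (complex ^ 'n) set" where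
  "cap a t = {z. norm (1 - cinner z a) < t}"

lemma cap_borel [measurable]: "cap a t \<in> sets borel"
  unfolding cap_def by (intro borel_open open_Collect_less continuous_intros)

lemma one_minus_norm_le_cinner:
  assumes "norm a < 1" "norm z \<le> 1"
  shows "1 - norm a \<le> norm (1 - cinner z a)"
proof -
  have "norm (cinner z a) \<le> norm z * norm a" by (rule norm_cinner_le)
  also have "\<dots> \<le> 1 * norm a" using assms by (intro mult_right_mono) auto
  finally show ?thesis using norm_triangle_ineq2[of 1 "cinner z a"] by simp
qed

text \<open>The region fits into a box of size about t in the complex direction of a and about sqrt
  t in the n - 1 complex directions orthogonal to it, whose volume is of order t^2 t^(n-1).\<close>

lemma emeasure_cap_le:
  obtains C where "C > 0" "\<And>(a :: complex ^ 'n::finite) t. a \<in> Bn \<Longrightarrow> t > 0 \<Longrightarrow>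
    emeasure lborel (cap a t \<inter> Bn) \<le> ennreal (C * t ^ (CARD('n) + 1))"
proof -
  define n where "n = CARD('n)"
  define V where "V = measure lborel (cball (0 :: complex ^ 'n) (real n))"
  have V: "V \<ge> 0" by (simp add: V_def)
  have eV: "emeasure lborel (cball (0 :: complex ^ 'n) (real n)) = ennreal V"
    using emeasure_lborel_cball_finite[of "0 :: complex ^ 'n" "real n"] by (simp add: V_def emeasure_eq_ennreal_measure)
  have main: "emeasure lborel (cap a t \<inter> Bn) \<le> ennreal (4 ^ n * V * t ^ (n + 1))"
    if a: "a \<in> Bn" and t: "t > 0" for a :: "complex ^ 'n" and t
  proof -
    fix i :: 'n
    have na: "norm a < 1" using a by (simp add: mem_Bn_iff)
    obtain H \<beta> where H: "unitary_map H" "H (axis i \<beta>) = a" "norm \<beta> = norm a"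
      using unitary_map_axis_exists[of i a] by blast
    \<comment> \<open>\<open>\<epsilon>\<close> is the unimodular direction of beta, so the box is
      centred at a boundary point. Exchanging beta for it costs at most 1 - |a|, which is below t at
      every point of the region in the ball.\<close>
    define \<epsilon> where "\<epsilon> = (if \<beta> = 0 then 1 else sgn \<beta>)"
    have \<epsilon>: "norm \<epsilon> = 1" "\<beta> = of_real (norm \<beta>) * \<epsilon>"
      by (simp_all add: \<epsilon>_def norm_sgn) (simp add: sgn_eq)
    define c where "c = (\<lambda>j. if j = i then 2 * t else 2 * sqrt t)"
    have c: "c j > 0" for j using t by (simp add: c_def)
    define E where "E = cap a t \<inter> Bn"
    have [measurable]: "E \<in> sets borel" by (simp add: E_def)
    have [measurable]: "H \<in> borel_measurable borel"
      using orthogonal_transformation_linear[OF unitary_map_orthogonal[OF H(1)]]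
      by (intro borel_measurable_continuous_onI linear_continuous_on) (simp add: linear_conv_bounded_linear)
    have sub: "x \<in> cball 0 (real n)" if x: "H (axis i \<epsilon> + vscale c x) \<in> E" for x
    proof -
      define y where "y = axis i \<epsilon> + vscale c x"
      have ny: "norm y < 1" using x by (simp add: E_def y_def mem_Bn_iff unitary_map_norm[OF H(1)])
      have "cinner (H y) a = y $ i * cnj \<beta>"
        unfolding H(2)[symmetric] unitary_mapD(3)[OF H(1)] by (rule cinner_axis_right)
      then have lt: "norm (1 - y $ i * cnj \<beta>) < t" using x by (simp add: E_def cap_def y_def)
      have yi: "norm (y $ i) < 1" using ny Finite_Cartesian_Product.norm_nth_le[of y i] by linarith
      have "1 - norm a \<le> norm (1 - cinner (H y) a)"
        using ny by (intro one_minus_norm_le_cinner na) (simp add: unitary_map_norm[OF H(1)])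
      then have at: "1 - norm a < t" using lt \<open>cinner (H y) a = y $ i * cnj \<beta>\<close> by simp
      have "norm (1 - y $ i * cnj \<epsilon>) \<le> norm (1 - y $ i * cnj \<beta>) + norm (y $ i * cnj \<beta> - y $ i * cnj \<epsilon>)"
        using norm_triangle_ineq[of "1 - y $ i * cnj \<beta>" "y $ i * cnj \<beta> - y $ i * cnj \<epsilon>"] by simp
      also have "norm (y $ i * cnj \<beta> - y $ i * cnj \<epsilon>) = norm (y $ i) * (1 - norm a)"
      proof -
        have "y $ i * cnj \<beta> - y $ i * cnj \<epsilon> = y $ i * (of_real (norm \<beta> - 1) * cnj \<epsilon>)"
          by (subst \<epsilon>(2)) (simp add: algebra_simps)
        then show ?thesis using na by (simp add: norm_mult \<epsilon>(1) H(3) flip: of_real_diff)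
      qed
      also have "\<dots> \<le> 1 * (1 - norm a)" using yi na by (intro mult_right_mono) auto
      finally have "norm (1 - y $ i * cnj \<epsilon>) < 2 * t" using lt at by simp
      moreover have "norm (1 - y $ i * cnj \<epsilon>) = norm (\<epsilon> - y $ i)"
      proof -
        have "\<epsilon> * cnj \<epsilon> = 1" using complex_norm_square[of \<epsilon>] \<epsilon>(1) by simp
        then have "(\<epsilon> - y $ i) * cnj \<epsilon> = 1 - y $ i * cnj \<epsilon>" by (simp add: algebra_simps)
        then show ?thesis by (metis \<epsilon>(1) complex_mod_cnj mult.right_neutral norm_mult)
      qed
      ultimately have e1: "norm (\<epsilon> - y $ i) < 2 * t" by simp
      then have e2: "1 - norm (y $ i) < 2 * t" using norm_triangle_ineq2[of \<epsilon> "y $ i"] \<epsilon>(1) by linarith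
      have xj: "norm (x $ j) \<le> 1" for j
      proof (cases "j = i")
        case True
        have "y $ i - \<epsilon> = of_real (2 * t) * x $ i" by (simp add: y_def axis_def c_def)
        then have "norm (y $ i - \<epsilon>) = 2 * t * norm (x $ i)" using t by (simp add: norm_mult)
        then show ?thesis using e1 t True by (simp add: norm_minus_commute)
      next
        case False
        \<comment> \<open>The tangential coordinates satisfy |y_j|^2 <= 1 - |y_i|^2 <= 2 (1 - |y_i|)
          <= 4 t, hence the scale 2 sqrt t.\<close>
        have "(norm (y $ j))\<^sup>2 \<le> (\<Sum>j\<in>UNIV-{i}. (norm (y $ j))\<^sup>2)"
          using False by (intro member_le_sum) auto
        also have "\<dots> = (norm y)\<^sup>2 - (norm (y $ i))\<^sup>2" by (simp add: norm_sq_vec_split[of y i])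
        also have "\<dots> \<le> 1 - (norm (y $ i))\<^sup>2" using ny by (simp add: power_le_one)
        also have "\<dots> \<le> 2 * (1 - norm (y $ i))" using yi by (rule one_minus_norm_sq_bounds)
        also have "\<dots> \<le> 4 * t" using e2 by simp
        also have "4 * t = (2 * sqrt t)\<^sup>2" using t by (simp add: power_mult_distrib)
        finally have "norm (y $ j) \<le> 2 * sqrt t" by (rule power2_le_imp_le) (use t in simp)
        moreover have "norm (y $ j) = 2 * sqrt t * norm (x $ j)"
          using False t by (simp add: y_def axis_def c_def norm_mult)
        ultimately show ?thesis using t by simp
      qed
      have "norm x \<le> (\<Sum>j\<in>UNIV. norm (x $ j))" by (simp add: norm_vec_def L2_set_le_sum)
      also have "\<dots> \<le> (\<Sum>j\<in>(UNIV :: 'n set). 1)" by (intro sum_mono xj)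
      finally show ?thesis by (simp add: n_def)
    qed
    have "emeasure lborel E = (\<integral>\<^sup>+z. indicator E z \<partial>lborel)" by simp
    also have "\<dots> = (\<integral>\<^sup>+z. indicator E (H z) \<partial>lborel)"
      by (rule nn_integral_lborel_isometry[symmetric]) (simp_all add: unitary_map_orthogonal H)
    also have "\<dots> = (\<integral>\<^sup>+z. indicator E (H (axis i \<epsilon> + z)) \<partial>lborel)"
      by (rule nn_integral_lborel_shift[symmetric]) measurable
    also have "\<dots> = ennreal (\<Prod>j\<in>UNIV. (c j)\<^sup>2) * (\<integral>\<^sup>+x. indicator E (H (axis i \<epsilon> + vscale c x)) \<partial>lborel)"
      by (rule nn_integral_lborel_vscale) (simp_all add: c)
    also have "\<dots> \<le> ennreal (\<Prod>j\<in>UNIV. (c j)\<^sup>2) * (\<integral>\<^sup>+x. indicator (cball 0 (real n)) x \<partial>(lborel :: (complex ^ 'n) measure))"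
      using sub by (intro mult_left_mono nn_integral_mono) (auto simp: indicator_def)
    also have "\<dots> = ennreal (\<Prod>j\<in>UNIV. (c j)\<^sup>2) * ennreal V" by (simp add: eV)
    also have "(\<Prod>j\<in>UNIV. (c j)\<^sup>2) = 4 ^ n * t ^ (n + 1)"
    proof -
      have "(\<Prod>j\<in>UNIV. (c j)\<^sup>2) = (2 * t)\<^sup>2 * (\<Prod>j\<in>UNIV-{i}. (2 * sqrt t)\<^sup>2)"
        by (subst prod.remove[of UNIV i]) (auto simp: c_def intro!: prod.cong)
      also have "(\<Prod>j\<in>UNIV-{i}. (2 * sqrt t)\<^sup>2) = (4 * t) ^ (n - 1)" using t by (simp add: power_mult_distrib n_def)
      also have "(2 * t)\<^sup>2 * (4 * t) ^ (n - 1) = t * ((4 * t) * (4 * t) ^ (n - 1))" by (simp add: power2_eq_square)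
      also have "(4 * t) * (4 * t) ^ (n - 1) = (4 * t) ^ n"
        using zero_less_card_finite[where 'a='n] by (simp add: power_eq_if n_def)
      finally show ?thesis by (simp add: power_mult_distrib)
    qed
    finally show ?thesis using V t by (simp add: E_def ennreal_mult'[symmetric] mult_ac)
  qed
  show ?thesis
  \<comment> \<open>\<open>V\<close> is only recorded as nonnegative; adding 1 makes the constant
    positive.\<close>
  proof (rule that[of "4 ^ n * V + 1"])
    fix a :: "complex ^ 'n" and t :: real assume a: "a \<in> Bn" and t: "t > 0"
    have "4 ^ n * V * t ^ (n + 1) \<le> (4 ^ n * V + 1) * t ^ (n + 1)" using t by (intro mult_right_mono) auto
    then show "emeasure lborel (cap a t \<inter> Bn) \<le> ennreal ((4 ^ n * V + 1) * t ^ (CARD('n) + 1))"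
      using main[OF a t] ennreal_leI order_trans unfolding n_def by blast
  qed (use V in \<open>simp add: add_nonneg_pos\<close>)
qed

text \<open>Moving along a ray from radius s to tau, both in (1 - t, 1), changes <z,a> by less than
  t, so directions that meet the region at s meet the region with 2 t at tau. Integrating over tau
  compares t times the slice with the solid volume, of order t^(n+1). For s <= 1 - t the slice is
  empty.\<close>

lemma sph_int_cap_le:
  obtains C where "C > 0" "\<And>(a :: complex ^ 'n::finite) t s. a \<in> Bn \<Longrightarrow> t > 0 \<Longrightarrow> 0 < s \<Longrightarrow> s < 1 \<Longrightarrow>
    sph_int (indicator (cap a t)) s \<le> ennreal (C * t ^ CARD('n)) * indicator {1 - t<..} s"
proof -
  define n where "n = CARD('n)"
  define d where "d = DIM(complex ^ 'n)"
  have d: "d > 0" by (simp add: d_def)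
  obtain C1 where C1: "C1 > 0" "\<And>(a :: complex ^ 'n::finite) t. a \<in> Bn \<Longrightarrow> t > 0 \<Longrightarrow>
    emeasure lborel (cap a t \<inter> Bn) \<le> ennreal (C1 * t ^ (CARD('n) + 1))"
    using emeasure_cap_le[where 'n='n] by blast
  define m where "m = real d * (1/2) ^ d"
  have m: "m > 0" using d by (simp add: m_def)
  define C where "C = volB TYPE('n) + C1 * 2 ^ (n + 1) / m"
  have C: "C > 0" "volB TYPE('n) \<le> C" "C1 * 2 ^ (n + 1) / m \<le> C"
    using volB_pos[where 'n='n] C1 m by (auto simp: C_def add_pos_pos)
  have main: "sph_int (indicator (cap a t)) s \<le> ennreal (C * t ^ n)"
    if a: "a \<in> Bn" and t: "t > 0" and s: "0 < s" "s < 1" "1 - t < s" for a :: "complex ^ 'n" and t s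
  proof (cases "t \<ge> 1")
    case True
    have "sph_int (indicator (cap a t)) s \<le> sph_int (\<lambda>_ :: complex ^ 'n. 1) s"
      unfolding sph_int_def by (intro nn_integral_mono mult_right_mono) (auto simp: indicator_def)
    also have "\<dots> = ennreal (volB TYPE('n) * 1)" by (simp add: sph_int_const)
    also have "\<dots> \<le> ennreal (C * t ^ n)"
      using True C by (intro ennreal_leI mult_mono) auto
    finally show ?thesis .
  next
    case False
    have na: "norm a < 1" using a by (simp add: mem_Bn_iff)
    define S where "S = sph_int (indicator (cap a t)) s"
    have le: "S \<le> sph_int (indicator (cap a (2 * t))) \<tau>" if \<tau>: "1 - t < \<tau>" "\<tau> < 1" for \<tau>
      unfolding S_def sph_int_def
    proof (intro nn_integral_mono mult_right_mono)
      fix z :: "complex ^ 'n"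
      define \<zeta> where "\<zeta> = (1 / norm z) *\<^sub>R z"
      have \<zeta>: "norm \<zeta> \<le> 1" by (simp add: \<zeta>_def)
      have e: "(r / norm z) *\<^sub>R z = of_real r *s \<zeta>" for r
        by (simp add: \<zeta>_def flip: scaleR_conv_vector_scale)
      have "(of_real \<tau> *s \<zeta>) \<in> cap a (2 * t)" if "(of_real s *s \<zeta>) \<in> cap a t"
      proof -
        have "norm (1 - cinner (of_real \<tau> *s \<zeta>) a) \<le> norm (1 - cinner (of_real s *s \<zeta>) a) + norm (cinner (of_real s *s \<zeta>) a - cinner (of_real \<tau> *s \<zeta>) a)"
          using norm_triangle_ineq[of "1 - cinner (of_real s *s \<zeta>) a" "cinner (of_real s *s \<zeta>) a - cinner (of_real \<tau> *s \<zeta>) a"] by simp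
        also have "norm (cinner (of_real s *s \<zeta>) a - cinner (of_real \<tau> *s \<zeta>) a) = \<bar>s - \<tau>\<bar> * norm (cinner \<zeta> a)"
          by (simp add: cinner_scale_left norm_mult flip: left_diff_distrib of_real_diff)
        also have "norm (cinner \<zeta> a) \<le> 1"
          using norm_cinner_le[of \<zeta> a] mult_mono[OF \<zeta> less_imp_le[OF na]] by simp
        then have "\<bar>s - \<tau>\<bar> * norm (cinner \<zeta> a) \<le> \<bar>s - \<tau>\<bar> * 1" by (intro mult_left_mono) auto
        finally have "norm (1 - cinner (of_real \<tau> *s \<zeta>) a) \<le> norm (1 - cinner (of_real s *s \<zeta>) a) + \<bar>s - \<tau>\<bar>" by simp
        moreover have "\<bar>s - \<tau>\<bar> < t" using s \<tau> by linarith
        ultimately show ?thesis using that by (simp add: cap_def)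
      qed
      then show "indicator (cap a t) ((s / norm z) *\<^sub>R z) \<le> (indicator (cap a (2 * t)) ((\<tau> / norm z) *\<^sub>R z) :: ennreal)"
        unfolding e by (auto simp: indicator_def)
    qed simp
    \<comment> \<open>Staying above 1/2 keeps the radial density bounded below, and since t < 1 the
      remaining interval still has length at least t / 2.\<close>
    define \<tau>0 where "\<tau>0 = max (1 - t) (1/2)"
    have \<tau>0: "t / 2 \<le> 1 - \<tau>0" "\<tau>0 < 1" using t False by (auto simp: \<tau>0_def max_def)
    have "S * ennreal (m * t) \<le> S * ennreal (real d * (1/2) ^ (d - 1) * (1 - \<tau>0))"
    proof (intro mult_left_mono ennreal_leI)
      have "m * t = real d * (1/2) ^ (d - 1) * (t / 2)" using d by (cases d) (auto simp: m_def)
      also have "\<dots> \<le> real d * (1/2) ^ (d - 1) * (1 - \<tau>0)" using \<tau>0 by (intro mult_left_mono) auto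
      finally show "m * t \<le> real d * (1/2) ^ (d - 1) * (1 - \<tau>0)" .
    qed simp
    also have "\<dots> = (\<integral>\<^sup>+\<tau>. S * ennreal (real d * (1/2) ^ (d - 1)) * indicator {\<tau>0<..<1} \<tau> \<partial>lborel)"
      using \<tau>0 by (subst nn_integral_cmult_indicator) (auto simp: ennreal_mult mult.assoc)
    also have "\<dots> \<le> (\<integral>\<^sup>+\<tau>. sph_int (indicator (cap a (2 * t))) \<tau> * (1 * rad_density TYPE('n) \<tau>) \<partial>lborel)"
    proof (rule nn_integral_mono)
      fix \<tau> :: real
      show "S * ennreal (real d * (1/2) ^ (d - 1)) * indicator {\<tau>0<..<1} \<tau> \<le> sph_int (indicator (cap a (2 * t))) \<tau> * (1 * rad_density TYPE('n) \<tau>)"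
      proof (cases "\<tau> \<in> {\<tau>0<..<1}")
        case True
        then have \<tau>: "1/2 < \<tau>" "1 - t < \<tau>" "\<tau> < 1" by (auto simp: \<tau>0_def)
        then have "ennreal (real d * (1/2) ^ (d - 1)) \<le> rad_density TYPE('n) \<tau>"
          unfolding rad_density_def d_def[symmetric] by (auto intro!: ennreal_leI mult_left_mono power_mono)
        then show ?thesis using True le[OF \<tau>(2,3)] by (auto intro: mult_mono)
      qed simp
    qed
    also have "\<dots> = (\<integral>\<^sup>+z. indicator (cap a (2 * t)) z * 1 * indicator Bn z \<partial>lborel)"
      by (rule nn_integral_Bn_polar[symmetric, where h="\<lambda>_. 1"]) auto
    also have "\<dots> = emeasure lborel (cap a (2 * t) \<inter> Bn)"
      by (simp add: indicator_inter_arith[symmetric])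
    also have "\<dots> \<le> ennreal (C1 * (2 * t) ^ (n + 1))" using C1(2)[OF a, of "2 * t"] t by (simp add: n_def)
    also have "\<dots> = ennreal (C1 * 2 ^ (n + 1) / m * t ^ n * (m * t))"
      using m by (simp add: power_mult_distrib mult_ac)
    also have "\<dots> \<le> ennreal (C * t ^ n * (m * t))"
      using C m t by (intro ennreal_leI mult_right_mono) auto
    also have "\<dots> = ennreal (C * t ^ n) * ennreal (m * t)" using m t by (subst ennreal_mult'') auto
    finally have "ennreal (m * t) * S \<le> ennreal (m * t) * ennreal (C * t ^ n)" by (simp add: mult.commute)
    then show ?thesis using m t unfolding S_def by (subst (asm) ennreal_mult_le_mult_iff) auto
  qed
  show ?thesis
  proof (rule that[OF C(1)])
    fix a :: "complex ^ 'n" and t s :: real assume a: "a \<in> Bn" and t: "t > 0" and s: "0 < s" "s < 1"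
    show "sph_int (indicator (cap a t)) s \<le> ennreal (C * t ^ CARD('n)) * indicator {1 - t<..} s"
    proof (cases "1 - t < s")
      case True
      then show ?thesis using main[OF a t s] by (simp add: n_def)
    next
      case False
      have na: "norm a < 1" using a by (simp add: mem_Bn_iff)
      have "indicator (cap a t) ((s / norm z) *\<^sub>R z) = (0 :: ennreal)" for z :: "complex ^ 'n"
      proof -
        have "norm (cinner ((s / norm z) *\<^sub>R z) a) \<le> norm ((s / norm z) *\<^sub>R z) * norm a" by (rule norm_cinner_le)
        also have "\<dots> \<le> s * 1" using s na by (intro mult_mono) auto
        finally have "1 - s \<le> norm (1 - cinner ((s / norm z) *\<^sub>R z) a)"
          using norm_triangle_ineq2[of 1 "cinner ((s / norm z) *\<^sub>R z) a"] by simp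
        then show ?thesis using False by (simp add: cap_def)
      qed
      then show ?thesis by (simp add: sph_int_def)
    qed
  qed
qed


text \<open>The classical test functions for Carleson measures: equal to 1 at a, with modulus of
  order ((1 - |a|) / |1 - <z,a>|)^N. The power N will be chosen large against the doubling constant
  of the weight.\<close>

definition kern :: "nat \<Rightarrow> complex ^ 'n::finite \<Rightarrow> complex ^ 'n \<Rightarrow> complex" where
  "kern N a z = (of_real (1 - (norm a)\<^sup>2) / (1 - cinner z a)) ^ N"

lemma holo_scalar_kern:
  fixes a :: "complex ^ 'n::finite"
  assumes a: "a \<in> Bn"
  shows "holo_scalar (kern N a) Bn"
  unfolding holo_scalar_def
proof
  fix z :: "complex ^ 'n" assume z: "z \<in> Bn"
  have nz: "1 - cinner z a \<noteq> 0" using one_minus_cinner_nonzero[of a z] a z by (simp add: mem_Bn_iff)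
  define g where "g = (\<lambda>w::complex. (of_real (1 - (norm a)\<^sup>2) / (1 - w)) ^ N)"
  have "\<exists>D. (g has_field_derivative D) (at (cinner z a))"
    unfolding g_def using nz by (intro exI) (auto intro!: derivative_eq_intros)
  then obtain D where D: "(g has_derivative (\<lambda>h. D * h)) (at (cinner z a))"
    by (auto simp: has_field_derivative_def)
  have "linear (\<lambda>z. cinner z a)"
    by (rule linearI) (simp_all add: cinner_add_left scaleR_conv_vector_scale cinner_scale_left scaleR_conv_of_real)
  then have "((\<lambda>z. cinner z a) has_derivative (\<lambda>z. cinner z a)) (at z)"
    by (rule linear_imp_has_derivative)
  from has_derivative_compose[OF this D]
  have "(kern N a has_derivative (\<lambda>h. D * cinner h a)) (at z)"
    by (simp add: kern_def[abs_def] g_def)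
  then show "\<exists>f'. (kern N a has_derivative f') (at z) \<and> (\<forall>c x. f' (c *s x) = c * f' x)"
    by (intro exI[of _ "\<lambda>h. D * cinner h a"]) (auto simp: cinner_scale_left)
qed

text \<open>In polar coordinates the slices have size at most a multiple of t^n and occur only for s
  > 1 - t, where omega integrates to its tail.\<close>

lemma nn_integral_cap_le:
  assumes \<omega>: "D_class TYPE('n::finite) \<omega>"
  obtains C where "C > 0" "\<And>(a :: complex ^ 'n) t. a \<in> Bn \<Longrightarrow> t > 0 \<Longrightarrow>
    (\<integral>\<^sup>+z. indicator (cap a t) z * ennreal (\<omega> (norm z)) * indicator Bn z \<partial>lborel)
      \<le> ennreal (C * t ^ CARD('n)) * omega_hat \<omega> (max 0 (1 - t))"
proof -
  note [measurable] = D_classD(2)[OF \<omega>]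
  define d where "d = DIM(complex ^ 'n)"
  have d: "d > 0" by (simp add: d_def)
  obtain C where C: "C > 0" "\<And>(a :: complex ^ 'n::finite) t s. a \<in> Bn \<Longrightarrow> t > 0 \<Longrightarrow> 0 < s \<Longrightarrow> s < 1 \<Longrightarrow>
    sph_int (indicator (cap a t)) s \<le> ennreal (C * t ^ CARD('n)) * indicator {1 - t<..} s"
    using sph_int_cap_le[where 'n='n] by blast
  show ?thesis
  proof (rule that[of "C * real d"])
    fix a :: "complex ^ 'n" and t :: real assume a: "a \<in> Bn" and t: "t > 0"
    have "(\<integral>\<^sup>+z. indicator (cap a t) z * ennreal (\<omega> (norm z)) * indicator Bn z \<partial>lborel)
      = (\<integral>\<^sup>+s. sph_int (indicator (cap a t)) s * (ennreal (\<omega> s) * rad_density TYPE('n) s) \<partial>lborel)"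
      by (rule nn_integral_Bn_polar) measurable
    also have "\<dots> \<le> (\<integral>\<^sup>+s. ennreal (C * real d * t ^ CARD('n)) * (ennreal (\<omega> s) * indicator {max 0 (1 - t)<..<1} s) \<partial>lborel)"
    proof (rule nn_integral_mono)
      fix s :: real
      show "sph_int (indicator (cap a t)) s * (ennreal (\<omega> s) * rad_density TYPE('n) s)
         \<le> ennreal (C * real d * t ^ CARD('n)) * (ennreal (\<omega> s) * indicator {max 0 (1 - t)<..<1} s)"
      proof (cases "s \<in> {0<..<1}")
        case True
        then have s: "0 < s" "s < 1" by auto
        have "rad_density TYPE('n) s \<le> ennreal (real d)"
          unfolding rad_density_def d_def[symmetric] using s
          by (auto intro!: ennreal_leI mult_left_le simp: indicator_def power_le_one)
        then have "sph_int (indicator (cap a t)) s * (ennreal (\<omega> s) * rad_density TYPE('n) s)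
           \<le> (ennreal (C * t ^ CARD('n)) * indicator {1 - t<..} s) * (ennreal (\<omega> s) * ennreal (real d))"
          by (intro mult_mono C(2) a t s) auto
        also have "\<dots> = (ennreal (C * t ^ CARD('n)) * ennreal (real d)) * (ennreal (\<omega> s) * indicator {1 - t<..} s)"
          by (simp only: mult_ac)
        also have "ennreal (C * t ^ CARD('n)) * ennreal (real d) = ennreal (C * real d * t ^ CARD('n))"
          using C t by (simp add: ennreal_mult'[symmetric] mult_ac)
        also have "indicator {1 - t<..} s = (indicator {max 0 (1 - t)<..<1} s :: ennreal)"
          using s by (auto simp: indicator_def)
        finally show ?thesis .
      qed (simp add: rad_density_def)
    qed
    also have "\<dots> = ennreal (C * real d * t ^ CARD('n)) * omega_hat \<omega> (max 0 (1 - t))"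
      unfolding omega_hat_def by (rule nn_integral_cmult) measurable
    finally show "(\<integral>\<^sup>+z. indicator (cap a t) z * ennreal (\<omega> (norm z)) * indicator Bn z \<partial>lborel)
      \<le> ennreal (C * real d * t ^ CARD('n)) * omega_hat \<omega> (max 0 (1 - t))" .
  qed (use C d in auto)
qed

lemma dyadic_between:
  fixes x \<delta> :: real
  assumes "0 < \<delta>" "\<delta> \<le> x"
  obtains k where "2 ^ k * \<delta> \<le> x" "x < 2 ^ Suc k * \<delta>"
proof -
  obtain m where "x / \<delta> < 2 ^ m" using real_arch_pow[of 2 "x / \<delta>"] by auto
  then have ex: "x < 2 ^ Suc m * \<delta>" using assms by (simp add: field_simps)
  define k where "k = (LEAST k. x < 2 ^ Suc k * \<delta>)"
  have k: "x < 2 ^ Suc k * \<delta>" unfolding k_def using ex by (rule LeastI)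
  moreover have "2 ^ k * \<delta> \<le> x"
  proof (cases k)
    case (Suc j)
    then have "\<not> x < 2 ^ Suc j * \<delta>" using not_less_Least[of j "\<lambda>k. x < 2 ^ Suc k * \<delta>"] by (simp add: k_def)
    then show ?thesis by (simp add: Suc)
  qed (use assms in simp)
  ultimately show ?thesis using that by blast
qed

lemma ennreal_mult3:
  "0 \<le> x \<Longrightarrow> 0 \<le> y \<Longrightarrow> 0 \<le> z \<Longrightarrow> ennreal x * (ennreal y * (ennreal z * w)) = ennreal (x * y * z) * w"
  by (simp add: ennreal_mult mult.assoc)

text \<open>Dyadic decomposition by |1 - <z,a>| in multiples 2^k delta of delta = 1 - |a|. In the
  k-th ring the p-th power of the kernel is at most B / B^k, while the weighted mass of the
  corresponding region grows at most like (2^n D)^k: 2^n from its size, D from one doubling of the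
  tail.\<close>

lemma wint_kern_le:
  assumes \<omega>: "D_class TYPE('n::finite) \<omega>" and p: "p > 0"
  obtains N C where "C > 0" "\<And>a :: complex ^ 'n. a \<in> Bn \<Longrightarrow>
    wint p \<omega> (kern N a) \<le> ennreal (C * (1 - norm a) ^ CARD('n)) * omega_hat \<omega> (norm a)"
proof -
  note [measurable] = D_classD(2)[OF \<omega>]
  define n where "n = CARD('n)"
  obtain C where C: "C > 0" "\<And>(a :: complex ^ 'n) t. a \<in> Bn \<Longrightarrow> t > 0 \<Longrightarrow>
    (\<integral>\<^sup>+z. indicator (cap a t) z * ennreal (\<omega> (norm z)) * indicator Bn z \<partial>lborel)
      \<le> ennreal (C * t ^ CARD('n)) * omega_hat \<omega> (max 0 (1 - t))"
    using nn_integral_cap_le[OF \<omega>] by blast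
  obtain D where D: "D \<ge> 1" "\<And>x. x > 0 \<Longrightarrow> omega_hat \<omega> (max 0 (1 - 2 * x)) \<le> ennreal D * omega_hat \<omega> (max 0 (1 - x))"
    using omega_hat_doubling[OF \<omega>] by blast
  \<comment> \<open>N makes the decay \<open>B\<close> per ring beat the growth 2^n D by a factor 2,
    so that the series is dominated by a geometric one with ratio 1/2.\<close>
  obtain N :: nat where N: "2 * (2 ^ n * D) \<le> (2 powr p) ^ N"
  proof -
    have "1 < 2 powr p" using p by simp
    then obtain N where "2 * (2 ^ n * D) < (2 powr p) ^ N" using real_arch_pow by blast
    then show ?thesis using that less_imp_le by blast
  qed
  define B where "B = (2 powr p) ^ N"
  have B: "B > 0" by (simp add: B_def)
  show ?thesis
  proof (rule that[of "B * (C * (2 ^ n * D)) * 2" N])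
    fix a :: "complex ^ 'n" assume a: "a \<in> Bn"
    define \<delta> where "\<delta> = 1 - norm a"
    have na: "norm a < 1" using a by (simp add: mem_Bn_iff)
    have \<delta>: "0 < \<delta>" "\<delta> \<le> 1" using na by (auto simp: \<delta>_def)
    define W where "W = omega_hat \<omega> (norm a)"
    have W: "omega_hat \<omega> (max 0 (1 - 2 ^ k * \<delta>)) \<le> ennreal (D ^ k) * W" for k
    proof (induction k)
      case 0
      then show ?case by (simp add: W_def \<delta>_def)
    next
      case (Suc k)
      have "omega_hat \<omega> (max 0 (1 - 2 ^ Suc k * \<delta>)) \<le> ennreal D * omega_hat \<omega> (max 0 (1 - 2 ^ k * \<delta>))"
        using D(2)[of "2 ^ k * \<delta>"] \<delta> by (simp add: mult.assoc)
      also have "\<dots> \<le> ennreal D * (ennreal (D ^ k) * W)" by (intro mult_left_mono Suc.IH) simp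
      also have "\<dots> = ennreal (D ^ Suc k) * W" using D(1) by (simp add: ennreal_mult mult.assoc)
      finally show ?case .
    qed
    \<comment> \<open>The summand of the ring containing z already dominates; as the others are
      nonnegative, whole regions can replace the rings.\<close>
    have pt: "pw p (kern N a) z \<le> (\<Sum>k. ennreal (B / B ^ k) * (indicator (cap a (2 ^ Suc k * \<delta>)) z * indicator Bn z))" for z
    proof (cases "z \<in> Bn")
      case True
      define x where "x = norm (1 - cinner z a)"
      have "\<delta> \<le> x" unfolding \<delta>_def x_def using True na by (intro one_minus_norm_le_cinner) (auto simp: mem_Bn_iff)
      then obtain k where k: "2 ^ k * \<delta> \<le> x" "x < 2 ^ Suc k * \<delta>" using dyadic_between[of \<delta> x] \<delta> by blast
      have x0: "x > 0" using \<open>\<delta> \<le> x\<close> \<delta> by simp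
      have "norm (kern N a z) = ((1 - (norm a)\<^sup>2) / x) ^ N"
        using one_minus_norm_sq_bounds(1)[OF na] na unfolding kern_def x_def norm_power norm_divide norm_of_real by simp
      also have "\<dots> \<le> (2 / 2 ^ k) ^ N"
      proof (rule power_mono)
        have "1 - (norm a)\<^sup>2 \<le> 2 * \<delta>" using one_minus_norm_sq_bounds(2)[OF na] by (simp add: \<delta>_def)
        moreover have "\<delta> \<le> x / 2 ^ k" using k(1) by (simp add: field_simps)
        ultimately have "1 - (norm a)\<^sup>2 \<le> 2 * (x / 2 ^ k)" by linarith
        then show "(1 - (norm a)\<^sup>2) / x \<le> 2 / 2 ^ k" using x0 by (simp add: divide_le_eq)
        show "0 \<le> (1 - (norm a)\<^sup>2) / x" using x0 a by (simp add: mem_Bn_iff_sq)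
      qed
      finally have "norm (kern N a z) powr p \<le> ((2 / 2 ^ k) ^ N) powr p"
        using p by (intro powr_mono2) auto
      also have "((2 / 2 ^ k) ^ N :: real) powr p = B / B ^ k"
      proof -
        have "((2 / 2 ^ k) ^ N :: real) powr p = ((2 / 2 ^ k) powr p) ^ N"
          by (simp add: powr_powr mult.commute flip: powr_realpow)
        also have "(2 / 2 ^ k :: real) powr p = 2 powr p / (2 powr p) ^ k"
          by (simp add: powr_divide powr_powr mult.commute flip: powr_realpow)
        also have "(2 powr p / (2 powr p) ^ k) ^ N = B / B ^ k"
          by (simp add: B_def power_divide flip: power_mult) (simp add: mult.commute)
        finally show ?thesis .
      qed
      finally have "pw p (kern N a) z \<le> ennreal (B / B ^ k) * (indicator (cap a (2 ^ Suc k * \<delta>)) z * indicator Bn z)"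
        using True k(2) by (simp add: pw_def cap_def x_def ennreal_leI)
      also have "\<dots> \<le> (\<Sum>k. ennreal (B / B ^ k) * (indicator (cap a (2 ^ Suc k * \<delta>)) z * indicator Bn z))"
        using sum_le_suminf[of "\<lambda>k. ennreal (B / B ^ k) * (indicator (cap a (2 ^ Suc k * \<delta>)) z * indicator Bn z)" "{k}"] by simp
      finally show ?thesis .
    qed (simp add: pw_def)
    have "wint p \<omega> (kern N a) \<le> (\<integral>\<^sup>+z. (\<Sum>k. ennreal (B / B ^ k) * (indicator (cap a (2 ^ Suc k * \<delta>)) z * indicator Bn z)) * ennreal (\<omega> (norm z)) \<partial>lborel)"
      unfolding wint_def by (intro nn_integral_mono mult_right_mono pt) simp
    also have "\<dots> = (\<integral>\<^sup>+z. (\<Sum>k. ennreal (B / B ^ k) * (indicator (cap a (2 ^ Suc k * \<delta>)) z * ennreal (\<omega> (norm z)) * indicator Bn z)) \<partial>lborel)"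
      by (intro nn_integral_cong) (simp add: ennreal_suminf_multc[symmetric] mult_ac)
    also have "\<dots> = (\<Sum>k. \<integral>\<^sup>+z. ennreal (B / B ^ k) * (indicator (cap a (2 ^ Suc k * \<delta>)) z * ennreal (\<omega> (norm z)) * indicator Bn z) \<partial>lborel)"
      by (rule nn_integral_suminf) measurable
    also have "\<dots> \<le> (\<Sum>k. ennreal (B * (C * (2 ^ n * D)) * \<delta> ^ n) * W * ennreal ((1/2) ^ k))"
    proof (intro suminf_le allI)
      fix k
      have "(\<integral>\<^sup>+z. ennreal (B / B ^ k) * (indicator (cap a (2 ^ Suc k * \<delta>)) z * ennreal (\<omega> (norm z)) * indicator Bn z) \<partial>lborel)
         = ennreal (B / B ^ k) * (\<integral>\<^sup>+z. indicator (cap a (2 ^ Suc k * \<delta>)) z * ennreal (\<omega> (norm z)) * indicator Bn z \<partial>lborel)"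
        by (rule nn_integral_cmult) measurable
      also have "\<dots> \<le> ennreal (B / B ^ k) * (ennreal (C * (2 ^ Suc k * \<delta>) ^ n) * (ennreal (D ^ Suc k) * W))"
        unfolding n_def using \<delta> by (intro mult_left_mono order_trans[OF C(2)] W a) auto
      also have "\<dots> = ennreal (B / B ^ k * (C * (2 ^ Suc k * \<delta>) ^ n) * D ^ Suc k) * W"
        by (rule ennreal_mult3) (use B C(1) \<delta> D(1) in auto)
      also have "B / B ^ k * (C * (2 ^ Suc k * \<delta>) ^ n) * D ^ Suc k = B * (C * (2 ^ n * D)) * \<delta> ^ n * ((2 ^ n * D) ^ k / B ^ k)"
        by (simp add: power_mult_distrib mult_ac flip: power_mult)
      also have "ennreal (B * (C * (2 ^ n * D)) * \<delta> ^ n * ((2 ^ n * D) ^ k / B ^ k)) * W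
          \<le> ennreal (B * (C * (2 ^ n * D)) * \<delta> ^ n * (1/2) ^ k) * W"
      proof (intro mult_right_mono ennreal_leI mult_left_mono)
        have "(2 ^ n * D) / B \<le> 1/2" using N B by (simp add: B_def field_simps)
        then show "(2 ^ n * D) ^ k / B ^ k \<le> (1/2) ^ k"
          using D(1) B by (subst power_divide[symmetric], intro power_mono) auto
      qed (use B C \<delta> D(1) in auto)
      also have "\<dots> = ennreal (B * (C * (2 ^ n * D)) * \<delta> ^ n) * W * ennreal ((1/2) ^ k)"
        using B C \<delta> D(1) by (subst ennreal_mult) (auto simp: mult_ac)
      finally show "(\<integral>\<^sup>+z. ennreal (B / B ^ k) * (indicator (cap a (2 ^ Suc k * \<delta>)) z * ennreal (\<omega> (norm z)) * indicator Bn z) \<partial>lborel)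
         \<le> ennreal (B * (C * (2 ^ n * D)) * \<delta> ^ n) * W * ennreal ((1/2) ^ k)" .
    qed auto
    also have "\<dots> = ennreal (B * (C * (2 ^ n * D)) * \<delta> ^ n) * W * (\<Sum>k. ennreal ((1/2) ^ k))"
      by (rule ennreal_suminf_cmult)
    also have "(\<Sum>k. ennreal ((1/2) ^ k)) = ennreal 2"
      using geometric_sums[of "1/2::real"] by (intro suminf_ennreal_eq) auto
    also have "ennreal (B * (C * (2 ^ n * D)) * \<delta> ^ n) * W * ennreal 2 = ennreal (B * (C * (2 ^ n * D)) * \<delta> ^ n) * ennreal 2 * W"
      by (simp only: mult_ac)
    also have "ennreal (B * (C * (2 ^ n * D)) * \<delta> ^ n) * ennreal 2 = ennreal (B * (C * (2 ^ n * D)) * 2 * \<delta> ^ n)"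
      using B C \<delta> D(1) by (subst ennreal_mult[symmetric]) (auto simp: mult_ac)
    finally show "wint p \<omega> (kern N a) \<le> ennreal (B * (C * (2 ^ n * D)) * 2 * (1 - norm a) ^ CARD('n)) * omega_hat \<omega> (norm a)"
      by (simp only: W_def \<delta>_def n_def)
  qed (use B C D(1) in auto)
qed


section \<open>Carleson measures and local averages\<close>

lemma Ap_iff_wint:
  fixes f :: "complex ^ 'n::finite \<Rightarrow> complex"
  assumes \<omega>: "D_class TYPE('n) \<omega>"
  shows "f \<in> Ap p \<omega> \<longleftrightarrow> holo_scalar f Bn \<and> wint p \<omega> f < top"
proof -
  have "Ap_integral p \<omega> f < \<infinity> \<longleftrightarrow> wint p \<omega> f < top" if "holo_scalar f Bn"
    unfolding Ap_integral_eq[OF that D_classD(2)[OF \<omega>]]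
    using volB_pos[where 'n='n] by (auto simp: ennreal_mult_less_top)
  then show ?thesis by (auto simp: Ap_def)
qed

text \<open>The kernel is centred at z and evaluated at b: for fixed z, the indicator of all b with
  \<open>near b z\<close> is dominated by a multiple of a single test function of b.\<close>

lemma near_imp_kern_ge:
  fixes b z :: "complex ^ 'n::finite"
  assumes b: "b \<in> Bn" and near: "near b z"
  shows "1 \<le> 4 ^ N * norm (kern N z b)"
proof -
  have z: "z \<in> Bn" using near_imp_Bn[OF b near] .
  have s: "0 < 1 - (norm z)\<^sup>2" using z by (simp add: mem_Bn_iff_sq)
  define y where "y = norm (1 - cinner b z)"
  have y: "0 < y" unfolding y_def using one_minus_cinner_nonzero[of z b] b z by (simp add: mem_Bn_iff)
  have "(1 - (norm b)\<^sup>2) / 2 \<le> 1 - (norm z)\<^sup>2" "y \<le> 2 * (1 - (norm b)\<^sup>2)"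
    using near by (auto simp: near_def y_def)
  then have "y \<le> 4 * (1 - (norm z)\<^sup>2)" by argo
  then have "1 \<le> 4 * ((1 - (norm z)\<^sup>2) / y)" using y by (simp add: field_simps)
  then have "1 \<le> (4 * ((1 - (norm z)\<^sup>2) / y)) ^ N" by (rule one_le_power)
  also have "\<dots> = 4 ^ N * norm (kern N z b)"
    using s unfolding kern_def power_mult_distrib norm_power norm_divide y_def norm_of_real by simp
  finally show ?thesis .
qed

text \<open>Only the kernel functions enter the hypothesis: they bound the \<open>\<nu>\<close>-measure of the sets
  \<open>{b. near b z}\<close>, and after Tonelli the growth estimate trades \<open>|f|\<^sup>q\<close> for \<open>|f|\<^sup>p\<close>.\<close>

lemma carleson_local_average:
  assumes \<omega>: "D_class TYPE('n::finite) \<omega>" and p: "0 < p" and pq: "p \<le> q"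
  obtains N K where "K > 0"
    "\<And>a :: complex ^ 'n. a \<in> Bn \<Longrightarrow> kern N a \<in> Ap p \<omega>"
    "\<And>(\<nu> :: (complex ^ 'n) measure) A f. \<lbrakk>sets \<nu> = sets (restrict_space borel Bn); finite_measure \<nu>; A \<ge> 0;
       \<And>a. a \<in> Bn \<Longrightarrow> (\<integral>\<^sup>+b. pw q (kern N a) b \<partial>\<nu>) \<le> ennreal (A * enn2real (wint p \<omega> (kern N a)) powr (q / p));
       f \<in> Ap p \<omega>\<rbrakk> \<Longrightarrow>
       (\<integral>\<^sup>+b. ennreal (1 / (1 - (norm b)\<^sup>2) ^ (CARD('n) + 1)) * local_pw q f b \<partial>\<nu>)
         \<le> ennreal (K * A * enn2real (wint p \<omega> f) powr (q / p))"
proof -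
  note [measurable] = D_classD(2)[OF \<omega>]
  have q: "q > 0" using p pq by simp
  define n where "n = CARD('n)"
  obtain N C where C: "C > 0" "\<And>a :: complex ^ 'n. a \<in> Bn \<Longrightarrow>
    wint p \<omega> (kern N a) \<le> ennreal (C * (1 - norm a) ^ CARD('n)) * omega_hat \<omega> (norm a)"
    using wint_kern_le[OF \<omega> p] by blast
  obtain C2 where C2: "C2 > 0" "\<And>(f :: complex ^ 'n \<Rightarrow> complex) a. holo_scalar f Bn \<Longrightarrow> a \<in> Bn \<Longrightarrow>
    ennreal (norm (f a) powr p * (1 - norm a) ^ CARD('n)) * omega_hat \<omega> (norm a) \<le> ennreal C2 * wint p \<omega> f"
    using Ap_growth[OF \<omega> p] by blast
  obtain C3 where C3: "C3 > 0" "\<And>f :: complex ^ 'n \<Rightarrow> complex. holo_scalar f Bn \<Longrightarrow>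
    (\<integral>\<^sup>+z. pw p f z * (omega_hat \<omega> (norm z) * ennreal (1 / (1 - norm z))) \<partial>lborel) \<le> ennreal C3 * wint p \<omega> f"
    using nn_integral_omega_hat_le[OF \<omega> p] by blast
  define W where "W = (\<lambda>z :: complex ^ 'n. enn2real (omega_hat \<omega> (norm z)))"
  have eW: "omega_hat \<omega> (norm z) = ennreal (W z)" for z
    unfolding W_def using omega_hat_finite[OF \<omega>, of "norm z"] by simp
  have W0: "W z \<ge> 0" for z by (simp add: W_def)
  have kernAp: "kern N a \<in> Ap p \<omega>" if a: "a \<in> Bn" for a :: "complex ^ 'n"
  proof -
    have "wint p \<omega> (kern N a) < top"
      using C(2)[OF a] unfolding eW by (rule le_less_trans) (simp add: ennreal_mult_less_top)
    then show ?thesis using holo_scalar_kern[OF a] by (simp add: Ap_iff_wint[OF \<omega>])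
  qed
  have kernW: "enn2real (wint p \<omega> (kern N a)) \<le> C * ((1 - norm a) ^ n * W a)" if a: "a \<in> Bn" for a
  proof -
    have "wint p \<omega> (kern N a) \<le> ennreal (C * ((1 - norm a) ^ n * W a))"
      using C(2)[OF a] unfolding eW n_def by (simp add: ennreal_mult''[symmetric] W0 mult.assoc)
    then show ?thesis using a C(1) by (intro enn2real_leI) (auto simp: W0 mem_Bn_iff)
  qed
  define c where "c = 2 ^ (n + 1) * (4 ^ N) powr q * C powr (q / p)"
  have c: "c > 0" using C by (simp add: c_def)
  define K where "K = c * C2 powr ((q - p) / p) * C3"
  have K: "K > 0" using c C2 C3 by (simp add: K_def)
  show ?thesis
  proof (rule that[of K N])
    fix \<nu> :: "(complex ^ 'n) measure" and A and f :: "complex ^ 'n \<Rightarrow> complex"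
    assume sets: "sets \<nu> = sets (restrict_space borel Bn)" and fin: "finite_measure \<nu>" and A: "A \<ge> 0"
      and car: "\<And>a. a \<in> Bn \<Longrightarrow> (\<integral>\<^sup>+b. pw q (kern N a) b \<partial>\<nu>) \<le> ennreal (A * enn2real (wint p \<omega> (kern N a)) powr (q / p))"
      and fAp: "f \<in> Ap p \<omega>"
    interpret \<nu>: finite_measure \<nu> by (rule fin)
    interpret pair_sigma_finite lborel \<nu> ..
    have space: "space \<nu> = Bn" using sets_eq_imp_space_eq[OF sets] by (simp add: space_restrict_space)
    have f: "holo_scalar f Bn" and fw: "wint p \<omega> f < top" using fAp by (auto simp: Ap_iff_wint[OF \<omega>])
    note [measurable] = pw_measurable[OF f]
    define J where "J = enn2real (wint p \<omega> f)"
    have eJ: "wint p \<omega> f = ennreal J" using fw by (simp add: J_def)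
    have J0: "J \<ge> 0" by (simp add: J_def)
    have borel\<nu>: "g \<in> borel_measurable \<nu>" if "g \<in> borel_measurable borel" for g :: "complex ^ 'n \<Rightarrow> ennreal"
      using measurable_restrict_space1[OF that, of Bn] sets measurable_cong_sets by blast
    define S where "S = (\<lambda>b :: complex ^ 'n. ennreal (1 / (1 - (norm b)\<^sup>2) ^ (n + 1)))"
    have [measurable]: "S \<in> borel_measurable borel" unfolding S_def by measurable
    have idm: "(\<lambda>x :: complex ^ 'n. x) \<in> \<nu> \<rightarrow>\<^sub>M borel"
      using measurable_restrict_space1[OF measurable_ident_sets[OF refl], of borel Bn] sets
      by (simp add: measurable_cong_sets[OF sets refl])
    \<comment> \<open>The product space lists z before b, whereas \<open>near\<close> takes b
      first.\<close>
    have [measurable]: "(\<lambda>x. (snd x, fst x)) \<in> (lborel \<Otimes>\<^sub>M \<nu>) \<rightarrow>\<^sub>M (borel :: ((complex ^ 'n) \<times> (complex ^ 'n)) measure)"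
      unfolding borel_prod[symmetric] using measurable_compose[OF measurable_snd idm] by measurable
    have nearm: "(\<lambda>x. indicator {x. near (fst x) (snd x)} (snd x, fst x) :: ennreal) \<in> borel_measurable (lborel \<Otimes>\<^sub>M \<nu>)"
      by measurable
    have [measurable]: "(\<lambda>x. S (snd x)) \<in> borel_measurable (lborel \<Otimes>\<^sub>M \<nu>)"
      by (rule measurable_compose[OF measurable_snd]) (rule borel\<nu>, measurable)
    have m2: "(\<lambda>(z, b). S b * (pw q f z * indicator {z. near b z} z)) \<in> borel_measurable (lborel \<Otimes>\<^sub>M \<nu>)"
    proof -
      have "(\<lambda>(z, b). S b * (pw q f z * indicator {z. near b z} z)) = (\<lambda>x. S (snd x) * (pw q f (fst x) * indicator {x. near (fst x) (snd x)} (snd x, fst x)))"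
        by (auto simp: fun_eq_iff indicator_def)
      also have "\<dots> \<in> borel_measurable (lborel \<Otimes>\<^sub>M \<nu>)" using nearm by measurable
      finally show ?thesis .
    qed
    \<comment> \<open>On the set in question \<open>S b\<close> is at most a constant times (1 -
      |z|)^(-(n+1)), and the indicator is at most (4^N |kern N z b|)^q. The hypothesis for this
      kernel, together with the bound on its norm, gives the estimate.\<close>
    have inner: "(\<integral>\<^sup>+b. S b * indicator {z. near b z} z \<partial>\<nu>) \<le> ennreal (c * A * ((1 - norm z) ^ n * W z) powr (q / p) / (1 - norm z) ^ (n + 1))"
      if z: "z \<in> Bn" for z
    proof -
      have nz: "norm z < 1" using z by (simp add: mem_Bn_iff)
      define c1 where "c1 = 2 ^ (n + 1) / (1 - norm z) ^ (n + 1) * (4 ^ N) powr q"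
      have c1: "c1 \<ge> 0" using nz by (simp add: c1_def)
      note [measurable] = pw_measurable[OF holo_scalar_kern[OF z]]
      have "(\<integral>\<^sup>+b. S b * indicator {z. near b z} z \<partial>\<nu>) \<le> (\<integral>\<^sup>+b. ennreal c1 * pw q (kern N z) b \<partial>\<nu>)"
      proof (rule nn_integral_mono)
        fix b assume "b \<in> space \<nu>"
        then have b: "b \<in> Bn" by (simp add: space)
        show "S b * indicator {z. near b z} z \<le> ennreal c1 * pw q (kern N z) b"
        proof (cases "near b z")
          case True
          have "1 - norm z \<le> 2 * (1 - (norm b)\<^sup>2)"
            using True one_minus_norm_sq_bounds(1)[OF nz] by (auto simp: near_def)
          then have "(1 - norm z) / 2 \<le> 1 - (norm b)\<^sup>2" by argo
          then have "((1 - norm z) / 2) ^ (n + 1) \<le> (1 - (norm b)\<^sup>2) ^ (n + 1)" using nz by (intro power_mono) auto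
          then have "1 / (1 - (norm b)\<^sup>2) ^ (n + 1) \<le> 1 / ((1 - norm z) / 2) ^ (n + 1)"
            using nz by (intro frac_le zero_less_power) auto
          also have "\<dots> = 2 ^ (n + 1) / (1 - norm z) ^ (n + 1)" by (simp add: power_divide)
          finally have "S b \<le> ennreal (2 ^ (n + 1) / (1 - norm z) ^ (n + 1) * 1)"
            unfolding S_def by (intro ennreal_leI) simp
          also have "\<dots> \<le> ennreal (2 ^ (n + 1) / (1 - norm z) ^ (n + 1) * ((4 ^ N) powr q * norm (kern N z b) powr q))"
          proof (intro ennreal_leI mult_left_mono)
            have "1 powr q \<le> (4 ^ N * norm (kern N z b)) powr q"
              using near_imp_kern_ge[OF b True] q by (intro powr_mono2) auto
            then show "1 \<le> (4 ^ N) powr q * norm (kern N z b) powr q" by (simp add: powr_mult)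
          qed (use nz in simp)
          also have "\<dots> = ennreal c1 * pw q (kern N z) b"
            using c1 b by (simp add: pw_def c1_def ennreal_mult''[symmetric] mult.assoc)
          finally show ?thesis using True by simp
        qed simp
      qed
      also have "\<dots> = ennreal c1 * (\<integral>\<^sup>+b. pw q (kern N z) b \<partial>\<nu>)"
        by (rule nn_integral_cmult) (rule borel\<nu>, measurable)
      also have "\<dots> \<le> ennreal c1 * ennreal (A * enn2real (wint p \<omega> (kern N z)) powr (q / p))"
        by (intro mult_left_mono car z) simp
      also have "\<dots> \<le> ennreal c1 * ennreal (A * (C * ((1 - norm z) ^ n * W z)) powr (q / p))"
        using kernW[OF z] A p q by (intro mult_left_mono ennreal_leI powr_mono2) auto
      also have "\<dots> = ennreal (c1 * (A * (C * ((1 - norm z) ^ n * W z)) powr (q / p)))"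
        using c1 A by (simp add: ennreal_mult)
      also have "c1 * (A * (C * ((1 - norm z) ^ n * W z)) powr (q / p))
          = c * A * ((1 - norm z) ^ n * W z) powr (q / p) / (1 - norm z) ^ (n + 1)"
        using C nz W0[of z] by (simp add: c1_def c_def powr_mult)
      finally show ?thesis .
    qed
    have pt: "pw q f z * ennreal (c * A * ((1 - norm z) ^ n * W z) powr (q / p) / (1 - norm z) ^ (n + 1))
        \<le> ennreal (c * A * (C2 * J) powr ((q - p) / p)) * (pw p f z * (omega_hat \<omega> (norm z) * ennreal (1 / (1 - norm z))))" for z
    proof (cases "z \<in> Bn")
      case True
      then have nz: "norm z < 1" by (simp add: mem_Bn_iff)
      define \<delta> where "\<delta> = 1 - norm z"
      have \<delta>: "\<delta> > 0" using nz by (simp add: \<delta>_def)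
      \<comment> \<open>\<open>X\<close> is the left side of the growth estimate. The integrand
        contains X^(q/p) = X X^((q-p)/p). Since p <= q the second factor is at most (C2
        J)^((q-p)/p), and X divided by delta^(n+1) is |f|^p times the smoothed weight.\<close>
      define X where "X = norm (f z) powr p * (\<delta> ^ n * W z)"
      have X0: "X \<ge> 0" using \<delta> W0 by (simp add: X_def)
      have "ennreal X \<le> ennreal (C2 * J)"
        using C2(2)[OF f True] C2(1) W0[of z] J0 unfolding eW eJ X_def \<delta>_def n_def by (simp add: ennreal_mult''[symmetric] mult.assoc)
      then have XJ: "X \<le> C2 * J" using C2 J0 by simp
      have "norm (f z) powr q * (\<delta> ^ n * W z) powr (q / p) = X powr (q / p)"
        using p \<delta> W0[of z] by (simp add: X_def powr_mult powr_powr)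
      also have "\<dots> = X * X powr ((q - p) / p)"
      proof (cases "X = 0")
        case False
        then have "X powr (q / p) = X powr (1 + (q - p) / p)" using p by (simp add: field_simps)
        also have "\<dots> = X * X powr ((q - p) / p)" using X0 False by (simp add: powr_add)
        finally show ?thesis .
      qed (use p q in simp)
      also have "\<dots> \<le> X * (C2 * J) powr ((q - p) / p)"
        using XJ X0 p pq by (intro mult_left_mono powr_mono2) auto
      finally have "norm (f z) powr q * (\<delta> ^ n * W z) powr (q / p) \<le> X * (C2 * J) powr ((q - p) / p)" .
      then have "norm (f z) powr q * (\<delta> ^ n * W z) powr (q / p) * (c * A / \<delta> ^ (n + 1)) \<le> X * (C2 * J) powr ((q - p) / p) * (c * A / \<delta> ^ (n + 1))"
        using c A \<delta> by (intro mult_right_mono) auto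
      also have "\<dots> = c * A * (C2 * J) powr ((q - p) / p) * (norm (f z) powr p * (W z * (1 / \<delta>)))"
        using \<delta> by (simp add: X_def field_simps)
      finally have "ennreal (norm (f z) powr q * (c * A * (\<delta> ^ n * W z) powr (q / p) / \<delta> ^ (n + 1)))
          \<le> ennreal (c * A * (C2 * J) powr ((q - p) / p) * (norm (f z) powr p * (W z * (1 / \<delta>))))"
        by (intro ennreal_leI) (simp add: mult_ac)
      moreover have "0 \<le> c * A * (C2 * J) powr ((q - p) / p)" using c A by simp
      ultimately have "ennreal (norm (f z) powr q) * ennreal (c * A * (\<delta> ^ n * W z) powr (q / p) / \<delta> ^ (n + 1))
          \<le> ennreal (c * A * (C2 * J) powr ((q - p) / p)) * (ennreal (norm (f z) powr p) * (ennreal (W z) * ennreal (1 / \<delta>)))"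
        by (simp only: ennreal_mult' powr_ge_zero W0)
      then show ?thesis
        using True unfolding pw_def eW \<delta>_def[symmetric] by simp
    qed (simp add: pw_def)
    have "(\<integral>\<^sup>+b. S b * local_pw q f b \<partial>\<nu>) = (\<integral>\<^sup>+b. \<integral>\<^sup>+z. S b * (pw q f z * indicator {z. near b z} z) \<partial>lborel \<partial>\<nu>)"
      unfolding local_pw_def by (intro nn_integral_cong nn_integral_cmult[symmetric]) measurable
    also have "\<dots> = (\<integral>\<^sup>+z. \<integral>\<^sup>+b. S b * (pw q f z * indicator {z. near b z} z) \<partial>\<nu> \<partial>lborel)"
      by (rule Fubini'[OF m2])
    also have "\<dots> = (\<integral>\<^sup>+z. pw q f z * (\<integral>\<^sup>+b. S b * indicator {z. near b z} z \<partial>\<nu>) \<partial>lborel)"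
    proof (rule nn_integral_cong)
      fix z :: "complex ^ 'n"
      have "(\<lambda>b. S b * indicator {b. near b z} b) \<in> borel_measurable \<nu>" by (rule borel\<nu>) measurable
      then have m: "(\<lambda>b. S b * indicator {z. near b z} z) \<in> borel_measurable \<nu>" by (simp add: indicator_def)
      show "(\<integral>\<^sup>+b. S b * (pw q f z * indicator {z. near b z} z) \<partial>\<nu>) = pw q f z * (\<integral>\<^sup>+b. S b * indicator {z. near b z} z \<partial>\<nu>)"
        by (subst nn_integral_cmult[OF m, symmetric]) (simp add: mult_ac)
    qed
    also have "\<dots> \<le> (\<integral>\<^sup>+z. ennreal (c * A * (C2 * J) powr ((q - p) / p)) * (pw p f z * (omega_hat \<omega> (norm z) * ennreal (1 / (1 - norm z)))) \<partial>lborel)"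
    proof (rule nn_integral_mono)
      fix z :: "complex ^ 'n"
      have "pw q f z * (\<integral>\<^sup>+b. S b * indicator {z. near b z} z \<partial>\<nu>)
         \<le> pw q f z * ennreal (c * A * ((1 - norm z) ^ n * W z) powr (q / p) / (1 - norm z) ^ (n + 1))"
      proof (cases "z \<in> Bn")
        case True
        from inner[OF this] show ?thesis by (rule mult_left_mono) simp
      qed (simp add: pw_def)
      also note pt
      finally show "pw q f z * (\<integral>\<^sup>+b. S b * indicator {z. near b z} z \<partial>\<nu>)
         \<le> ennreal (c * A * (C2 * J) powr ((q - p) / p)) * (pw p f z * (omega_hat \<omega> (norm z) * ennreal (1 / (1 - norm z))))" .
    qed
    also have "\<dots> = ennreal (c * A * (C2 * J) powr ((q - p) / p)) * (\<integral>\<^sup>+z. pw p f z * (omega_hat \<omega> (norm z) * ennreal (1 / (1 - norm z))) \<partial>lborel)"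
      by (rule nn_integral_cmult) measurable
    also have "\<dots> \<le> ennreal (c * A * (C2 * J) powr ((q - p) / p)) * (ennreal C3 * wint p \<omega> f)"
      by (intro mult_left_mono C3 f) auto
    also have "\<dots> = ennreal (c * A * (C2 * J) powr ((q - p) / p) * (C3 * J))"
      unfolding eJ using c A C3 J0 by (simp add: ennreal_mult)
    also have "c * A * (C2 * J) powr ((q - p) / p) * (C3 * J) = K * A * J powr (q / p)"
    proof (cases "J = 0")
      case False
      then have "J powr (q / p) = J powr (1 + (q - p) / p)" using p by (simp add: field_simps)
      also have "\<dots> = J * J powr ((q - p) / p)" using J0 False by (simp add: powr_add)
      finally show ?thesis using C2 J0 by (simp add: K_def powr_mult)
    qed (use p q in simp)
    finally show "(\<integral>\<^sup>+b. ennreal (1 / (1 - (norm b)\<^sup>2) ^ (CARD('n) + 1)) * local_pw q f b \<partial>\<nu>)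
         \<le> ennreal (K * A * enn2real (wint p \<omega> f) powr (q / p))"
      by (simp add: S_def n_def J_def)
  qed (use K kernAp in auto)
qed


text \<open>Comparable to the mean of |f|^q over the set of z with \<open>near b z\<close>, whose
  volume is of order (1 - |b|^2)^(n+1).\<close>

definition avg :: "real \<Rightarrow> (complex ^ 'n::finite \<Rightarrow> complex) \<Rightarrow> complex ^ 'n \<Rightarrow> ennreal" where
  "avg q f b = ennreal (1 / (1 - (norm b)\<^sup>2) ^ (CARD('n) + 1)) * local_pw q f b"

lemma avg_measurable:
  fixes f :: "complex ^ 'n::finite \<Rightarrow> complex"
  assumes f: "holo_scalar f Bn"
  shows "avg q f \<in> borel_measurable borel"
proof -
  note [measurable] = pw_measurable[OF f]
  have "(\<lambda>b. \<integral>\<^sup>+z. pw q f z * indicator {x. near (fst x) (snd x)} (b, z) \<partial>lborel) \<in> borel_measurable borel"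
  proof (rule lborel.borel_measurable_nn_integral)
    have "(\<lambda>x :: (complex ^ 'n) \<times> (complex ^ 'n). pw q f (snd x)) \<in> borel_measurable (borel \<Otimes>\<^sub>M borel)" by measurable
    moreover have "(indicator {x :: (complex ^ 'n) \<times> (complex ^ 'n). near (fst x) (snd x)} :: _ \<Rightarrow> ennreal) \<in> borel_measurable (borel \<Otimes>\<^sub>M borel)"
      unfolding borel_prod by (intro borel_measurable_indicator near_measurable)
    ultimately have "(\<lambda>x. pw q f (snd x) * indicator {x. near (fst x) (snd x)} x) \<in> borel_measurable (borel \<Otimes>\<^sub>M borel)"
      by (rule borel_measurable_times_ennreal)
    then show "(\<lambda>(b, z). pw q f z * indicator {x. near (fst x) (snd x)} (b, z)) \<in> borel_measurable (borel \<Otimes>\<^sub>M lborel)"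
      by (simp add: measurable_cong_sets[OF sets_pair_measure_cong[OF refl sets_lborel] refl] case_prod_unfold)
  qed
  then have "local_pw q f \<in> borel_measurable borel"
    unfolding local_pw_def[abs_def] by (simp add: indicator_def)
  then show ?thesis unfolding avg_def[abs_def] by measurable
qed

lemma measurable_restrict_borel:
  "g \<in> borel_measurable borel \<Longrightarrow> sets \<nu> = sets (restrict_space borel Bn) \<Longrightarrow> g \<in> borel_measurable \<nu>"
  using measurable_restrict_space1[of g borel borel Bn] measurable_cong_sets by blast

lemma powr_add_le:
  fixes x y q :: real
  assumes "0 \<le> x" "0 \<le> y" "0 \<le> q"
  shows "(x + y) powr q \<le> 2 powr q * (x powr q + y powr q)"
proof -
  have "(x + y) powr q \<le> (2 * max x y) powr q" using assms by (intro powr_mono2) auto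
  also have "\<dots> = 2 powr q * max x y powr q" using assms by (simp add: powr_mult max_def)
  also have "max x y powr q \<le> x powr q + y powr q" by (simp add: max_def)
  finally show ?thesis by (simp add: mult_left_mono)
qed

section \<open>Pointwise estimates by local averages\<close>

lemma pw_le_avg:
  fixes b :: "complex ^ 'n::finite"
  assumes b: "b \<in> Bn" and f: "holo_scalar f Bn" and p: "p > 0"
  shows "ennreal (norm (f b) powr p) \<le> ennreal (1 / measure lborel (ball (0 :: complex ^ 'n) (1/10))) * avg p f b"
proof -
  define S where "S = (1 - (norm b)\<^sup>2) ^ (CARD('n) + 1)"
  have S: "S > 0" using b by (simp add: S_def mem_Bn_iff_sq)
  have e: "ennreal S * ennreal (1 / S) = 1" using S by (simp add: ennreal_mult'[symmetric])
  have "ennreal (norm (f b) powr p) = ennreal (norm (f b) powr p) * ennreal S * ennreal (1 / S)"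
    by (simp add: mult.assoc e)
  also have "\<dots> \<le> ennreal (1 / measure lborel (ball (0 :: complex ^ 'n) (1/10))) * local_pw p f b * ennreal (1 / S)"
    unfolding S_def by (intro mult_right_mono pw_le_local_pw assms) simp
  finally show ?thesis by (simp add: avg_def S_def mult_ac)
qed

lemma pw_diff_le_avg:
  fixes b :: "complex ^ 'n::finite"
  assumes b: "b \<in> Bn" and a: "a \<in> Bn" and f: "holo_scalar f Bn" and p: "p > 0" and \<rho>: "pseudo_hyp b a \<le> 1/40"
  shows "ennreal (norm (f a - f b) powr p)
     \<le> ennreal (60 powr p / measure lborel (ball (0 :: complex ^ 'n) (1/10))) * (ennreal (pseudo_hyp b a powr p) * avg p f b)"
proof -
  define S where "S = (1 - (norm b)\<^sup>2) ^ (CARD('n) + 1)"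
  have S: "S > 0" using b by (simp add: S_def mem_Bn_iff_sq)
  have e: "ennreal S * ennreal (1 / S) = 1" using S by (simp add: ennreal_mult'[symmetric])
  have "ennreal (norm (f a - f b) powr p) = ennreal (norm (f a - f b) powr p) * ennreal S * ennreal (1 / S)"
    by (simp add: mult.assoc e)
  also have "\<dots> \<le> ennreal (60 powr p / measure lborel (ball (0 :: complex ^ 'n) (1/10))) * (ennreal (pseudo_hyp b a powr p) * local_pw p f b) * ennreal (1 / S)"
    unfolding S_def by (intro mult_right_mono pw_diff_le_local_pw assms) simp
  finally show ?thesis by (simp add: avg_def S_def mult_ac)
qed

text \<open>Two regimes, separated by a threshold for rho. The constant is fixed before f, the
  points and the coefficients, so the inequality can be integrated in z and used again with the two
  maps exchanged.\<close>

lemma wcd_pointwise_le: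
  assumes r: "0 < r" and q: "0 < q"
  obtains K where "K > 0" "\<And>(f :: complex ^ 'n::finite \<Rightarrow> complex) a b u v. holo_scalar f Bn \<Longrightarrow> a \<in> Bn \<Longrightarrow> b \<in> Bn \<Longrightarrow>
     ennreal (norm (u * f a - v * f b) powr q) \<le> ennreal K *
       (ennreal ((pseudo_hyp a b * norm u) powr q) * avg q f a + ennreal ((pseudo_hyp a b * norm v) powr q) * avg q f b
        + ennreal ((if pseudo_hyp a b < r then 1 else 0) * norm (u - v) powr q) * avg q f a)"
proof -
  define V where "V = measure lborel (ball (0 :: complex ^ 'n) (1/10))"
  have V: "V > 0" unfolding V_def by (simp add: content_ball_pos)
  \<comment> \<open>Below \<open>r0\<close> the point lies in G_r, so the sigma term is available
    and the oscillation estimate applies. From \<open>r0\<close> on, 1 <= (rho / r0)^q inserts the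
    factor rho^q of eta at the price r0^(-q).\<close>
  define r0 where "r0 = min r (1/40)"
  have r0: "0 < r0" "r0 \<le> r" "r0 \<le> 1/40" using r by (auto simp: r0_def)
  define c where "c = 60 powr q / V"
  \<comment> \<open>\<open>c\<close> dominates the constant 1 / V of the value estimate as well as
    60^q / V of the oscillation estimate; \<open>K\<close> then dominates the constants of both
    regimes.\<close>
  have c: "c > 0" "1 / V \<le> c" using V q by (auto simp: c_def ge_one_powr_ge_zero divide_right_mono)
  define K where "K = 2 powr q * (c * (1 + 1 / r0 powr q))"
  have K: "K > 0" "2 powr q * c \<le> K" "2 powr q * (c / r0 powr q) \<le> K"
  proof -
    show "K > 0" using c r0 unfolding K_def by (intro mult_pos_pos add_pos_pos) auto
    show "2 powr q * c \<le> K" "2 powr q * (c / r0 powr q) \<le> K"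
      unfolding K_def using c r0 by (intro mult_left_mono; simp add: algebra_simps)+
  qed
  show ?thesis
  proof (rule that[OF K(1)])
    fix f :: "complex ^ 'n \<Rightarrow> complex" and a b :: "complex ^ 'n" and u v :: complex
    assume f: "holo_scalar f Bn" and a: "a \<in> Bn" and b: "b \<in> Bn"
    define \<rho> where "\<rho> = pseudo_hyp a b"
    have \<rho>0: "\<rho> \<ge> 0" by (simp add: \<rho>_def pseudo_hyp_def)
    have \<rho>': "pseudo_hyp b a = \<rho>" unfolding \<rho>_def using a b by (intro pseudo_hyp_commute) (auto simp: mem_Bn_iff)
    define Aa where "Aa = avg q f a"
    define Ab where "Ab = avg q f b"
    have fa: "ennreal (norm (f a) powr q) \<le> ennreal c * Aa"
      using pw_le_avg[OF a f q] ennreal_leI[OF c(2)] unfolding V_def[symmetric] Aa_def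
      by (meson mult_right_mono order_trans zero_le)
    have fb: "ennreal (norm (f b) powr q) \<le> ennreal c * Ab"
      using pw_le_avg[OF b f q] ennreal_leI[OF c(2)] unfolding V_def[symmetric] Ab_def
      by (meson mult_right_mono order_trans zero_le)
    have two: "ennreal (norm (x + y) powr q) \<le> ennreal (2 powr q) * (ennreal (norm x powr q) + ennreal (norm y powr q))" for x y :: complex
    proof -
      have "norm (x + y) powr q \<le> (norm x + norm y) powr q" using q by (intro powr_mono2 norm_triangle_ineq) auto
      also have "\<dots> \<le> 2 powr q * (norm x powr q + norm y powr q)" using q by (intro powr_add_le) auto
      finally show ?thesis by (simp add: ennreal_mult'[symmetric] ennreal_plus[symmetric] ennreal_leI del: ennreal_plus)
    qed
    define G where "G = ennreal ((\<rho> * norm u) powr q) * Aa + ennreal ((\<rho> * norm v) powr q) * Ab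
        + ennreal ((if \<rho> < r then 1 else 0) * norm (u - v) powr q) * Aa"
    have "ennreal (norm (u * f a - v * f b) powr q) \<le> ennreal K * G"
    proof (cases "\<rho> < r0")
      case True
      have fab: "ennreal (norm (f a - f b) powr q) \<le> ennreal c * (ennreal (\<rho> powr q) * Ab)"
        using pw_diff_le_avg[OF b a f q] True r0 unfolding \<rho>' Ab_def c_def V_def by simp
      have "ennreal (norm (u * f a - v * f b) powr q) = ennreal (norm ((u - v) * f a + v * (f a - f b)) powr q)"
        by (simp add: algebra_simps)
      also have "\<dots> \<le> ennreal (2 powr q) * (ennreal (norm ((u - v) * f a) powr q) + ennreal (norm (v * (f a - f b)) powr q))"
        by (rule two)
      also have "ennreal (norm ((u - v) * f a) powr q) \<le> ennreal (norm (u - v) powr q) * (ennreal c * Aa)"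
        using fa by (simp add: norm_mult powr_mult ennreal_mult mult_left_mono)
      also have "ennreal (norm (v * (f a - f b)) powr q) \<le> ennreal (norm v powr q) * (ennreal c * (ennreal (\<rho> powr q) * Ab))"
        using fab by (simp add: norm_mult powr_mult ennreal_mult mult_left_mono)
      also have "ennreal (2 powr q) * (ennreal (norm (u - v) powr q) * (ennreal c * Aa) + ennreal (norm v powr q) * (ennreal c * (ennreal (\<rho> powr q) * Ab)))
          = ennreal (2 powr q * c) * (ennreal ((if \<rho> < r then 1 else 0) * norm (u - v) powr q) * Aa + ennreal ((\<rho> * norm v) powr q) * Ab)"
        using True r0 c \<rho>0 by (simp add: powr_mult ennreal_mult distrib_left mult_ac)
      also have "\<dots> \<le> ennreal K * G"
        using K(2) unfolding G_def by (intro mult_mono ennreal_leI) (auto simp: add_ac intro!: add_increasing)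
      finally show ?thesis by (simp add: add_mono mult_left_mono)
    next
      case False
      then have \<rho>: "r0 \<le> \<rho>" by simp
      have up: "ennreal (norm w powr q) \<le> ennreal (1 / r0 powr q) * ennreal ((\<rho> * norm w) powr q)" for w :: complex
      proof -
        have "r0 powr q \<le> \<rho> powr q" using \<rho> r0 q by (intro powr_mono2) auto
        then have "r0 powr q * norm w powr q \<le> (\<rho> * norm w) powr q"
          using \<rho>0 by (simp add: powr_mult mult_right_mono)
        then have "norm w powr q \<le> 1 / r0 powr q * (\<rho> * norm w) powr q" using r0 by (simp add: field_simps)
        then show ?thesis by (simp add: ennreal_mult'[symmetric] ennreal_leI)
      qed
      have "ennreal (norm (u * f a - v * f b) powr q) \<le> ennreal (2 powr q) * (ennreal (norm (u * f a) powr q) + ennreal (norm (v * f b) powr q))"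
        using two[of "u * f a" "- (v * f b)"] by simp
      also have "ennreal (norm (u * f a) powr q) \<le> ennreal (1 / r0 powr q) * ennreal ((\<rho> * norm u) powr q) * (ennreal c * Aa)"
        using mult_mono[OF up[of u] fa] by (simp add: norm_mult powr_mult ennreal_mult)
      also have "ennreal (norm (v * f b) powr q) \<le> ennreal (1 / r0 powr q) * ennreal ((\<rho> * norm v) powr q) * (ennreal c * Ab)"
        using mult_mono[OF up[of v] fb] by (simp add: norm_mult powr_mult ennreal_mult)
      also have "ennreal (2 powr q) * (ennreal (1 / r0 powr q) * ennreal ((\<rho> * norm u) powr q) * (ennreal c * Aa) + ennreal (1 / r0 powr q) * ennreal ((\<rho> * norm v) powr q) * (ennreal c * Ab))
          = (ennreal (2 powr q) * ennreal c * ennreal (1 / r0 powr q)) * (ennreal ((\<rho> * norm u) powr q) * Aa + ennreal ((\<rho> * norm v) powr q) * Ab)"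
        by (simp add: distrib_left mult_ac)
      also have "ennreal (2 powr q) * ennreal c * ennreal (1 / r0 powr q) = ennreal (2 powr q * (c / r0 powr q))"
        using c by (simp add: ennreal_mult'[symmetric])
      also have "ennreal (2 powr q * (c / r0 powr q)) * (ennreal ((\<rho> * norm u) powr q) * Aa + ennreal ((\<rho> * norm v) powr q) * Ab) \<le> ennreal K * G"
        using K(3) unfolding G_def by (intro mult_mono ennreal_leI) auto
      finally show ?thesis by (simp add: add_mono mult_left_mono)
    qed
    then show "ennreal (norm (u * f a - v * f b) powr q) \<le> ennreal K *
       (ennreal ((pseudo_hyp a b * norm u) powr q) * avg q f a + ennreal ((pseudo_hyp a b * norm v) powr q) * avg q f b
        + ennreal ((if pseudo_hyp a b < r then 1 else 0) * norm (u - v) powr q) * avg q f a)"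
      by (simp add: G_def Aa_def Ab_def \<rho>_def)
  qed
qed

section \<open>Sums of measures\<close>

lemma
  assumes "sets N = sets M"
  shows sets_measure_plus [simp]: "sets (measure_plus M N) = sets M"
    and emeasure_measure_plus: "A \<in> sets M \<Longrightarrow> emeasure (measure_plus M N) A = emeasure M A + emeasure N A"
proof -
  show s: "sets (measure_plus M N) = sets M"
    by (simp add: measure_plus_def sets.sigma_sets_eq)
  show "emeasure (measure_plus M N) A = emeasure M A + emeasure N A" if A: "A \<in> sets M"
  proof (rule emeasure_measure_of[OF measure_plus_def])
    show "sets M \<subseteq> Pow (space M)" by (rule sets.space_closed)
    show "A \<in> sets (measure_plus M N)" using A s by simp
    show "positive (sets (measure_plus M N)) (\<lambda>A. emeasure M A + emeasure N A)" by (simp add: positive_def)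
    \<comment> \<open>\<open>measure_of\<close> keeps the prescribed set function only if it is
      countably additive, and otherwise yields the zero measure.\<close>
    show "countably_additive (sets (measure_plus M N)) (\<lambda>A. emeasure M A + emeasure N A)"
    proof (rule countably_additiveI)
      fix A :: "nat \<Rightarrow> _" assume A: "range A \<subseteq> sets (measure_plus M N)" "disjoint_family A"
      then show "(\<Sum>i. emeasure M (A i) + emeasure N (A i)) = emeasure M (\<Union> (range A)) + emeasure N (\<Union> (range A))"
        using assms s by (subst suminf_add[symmetric]) (auto simp: suminf_emeasure)
    qed
  qed
qed

lemma nn_integral_measure_plus:
  assumes s: "sets N = sets M" and F: "F \<in> borel_measurable M"
  shows "(\<integral>\<^sup>+x. F x \<partial>measure_plus M N) = (\<integral>\<^sup>+x. F x \<partial>M) + (\<integral>\<^sup>+x. F x \<partial>N)"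
  using F
proof (induction rule: borel_measurable_induct)
  case (cong f g)
  have sp: "space N = space M" "space (measure_plus M N) = space M"
    using sets_eq_imp_space_eq[OF s] sets_eq_imp_space_eq[OF sets_measure_plus[OF s]] by auto
  have "(\<integral>\<^sup>+x. f x \<partial>M') = (\<integral>\<^sup>+x. g x \<partial>M')" if "space M' = space M" for M'
    using cong(3) that by (intro nn_integral_cong) simp
  with sp cong(4) show ?case by metis
next
  case (set A)
  then show ?case using s by (simp add: emeasure_measure_plus[OF s])
next
  case (mult u c)
  then have "u \<in> borel_measurable N" "u \<in> borel_measurable (measure_plus M N)"
    using s by (auto simp: measurable_cong_sets[OF s] measurable_cong_sets[OF sets_measure_plus[OF s]])
  then show ?case using mult by (simp add: nn_integral_cmult distrib_left)
next
  case (add u v)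
  then have "u \<in> borel_measurable N" "u \<in> borel_measurable (measure_plus M N)" "v \<in> borel_measurable N" "v \<in> borel_measurable (measure_plus M N)"
    using s by (auto simp: measurable_cong_sets[OF s] measurable_cong_sets[OF sets_measure_plus[OF s]])
  then show ?case using add by (simp add: nn_integral_add add_ac)
next
  case (seq U)
  have m: "U i \<in> borel_measurable M" "U i \<in> borel_measurable N" "U i \<in> borel_measurable (measure_plus M N)" for i
    using seq s by (auto simp: measurable_cong_sets[OF s] measurable_cong_sets[OF sets_measure_plus[OF s]])
  have sup: "(\<integral>\<^sup>+x. (SUP i. U i) x \<partial>M') = (SUP i. \<integral>\<^sup>+x. U i x \<partial>M')" if "\<And>i. U i \<in> borel_measurable M'" for M'
    unfolding SUP_apply using seq that by (intro nn_integral_monotone_convergence_SUP) auto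
  have inc: "incseq (\<lambda>i. \<integral>\<^sup>+x. U i x \<partial>M')" for M'
    using seq by (auto simp: incseq_def le_fun_def intro!: nn_integral_mono)
  show ?case
    unfolding sup[OF m(1)] sup[OF m(2)] sup[OF m(3)]
    using seq by (simp add: ennreal_SUP_add[OF inc inc])
qed


section \<open>Boundedness from domination by averages\<close>

lemma const_one_in_Ap:
  assumes \<omega>: "D_class TYPE('n::finite) \<omega>"
  shows "(\<lambda>_. 1) \<in> (Ap p \<omega> :: (complex ^ 'n \<Rightarrow> complex) set)"
proof -
  have "holo_scalar (\<lambda>_ :: complex ^ 'n. 1) Bn"
    unfolding holo_scalar_def by (auto intro!: exI[of _ "\<lambda>_. 0"])
  moreover have "wint p \<omega> (\<lambda>_ :: complex ^ 'n. 1) = (\<integral>\<^sup>+z. ennreal (\<omega> (norm z)) * indicator (Bn :: (complex ^ 'n) set) z \<partial>lborel)"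
    unfolding wint_def by (simp add: pw_def mult.commute)
  ultimately show ?thesis
    using nn_integral_radial_weight_finite[OF \<omega>] by (simp add: Ap_iff_wint[OF \<omega>])
qed

lemma space_restrict_Bn: "sets \<nu> = sets (restrict_space borel Bn) \<Longrightarrow> space \<nu> = Bn"
  by (drule sets_eq_imp_space_eq) (simp add: space_restrict_space)

lemma Lq_integral_eq_pw:
  assumes "sets \<nu> = sets (restrict_space borel Bn)"
  shows "Lq_integral q \<nu> f = (\<integral>\<^sup>+z. pw q f z \<partial>\<nu>)"
  unfolding Lq_integral_def by (intro nn_integral_cong) (simp add: pw_def space_restrict_Bn[OF assms])

lemma finite_measure_if_in_Lq_one:
  assumes "in_Lq q \<nu> (\<lambda>_. 1)"
  shows "finite_measure \<nu>"
  using assms by (intro finite_measureI) (simp add: in_Lq_def Lq_integral_def)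

lemma Ap_norm_powr:
  fixes f :: "complex ^ 'n::finite \<Rightarrow> complex"
  assumes \<omega>: "D_class TYPE('n) \<omega>" and f: "holo_scalar f Bn" and C: "C \<ge> 0" and p: "p > 0"
  shows "(C * Ap_norm p \<omega> f) powr q = C powr q * (1 / volB TYPE('n)) powr (q / p) * enn2real (wint p \<omega> f) powr (q / p)"
proof -
  define i where "i = 1 / volB TYPE('n)"
  have i: "i > 0" using volB_pos[where 'n='n] by (simp add: i_def)
  have "Ap_norm p \<omega> f = (i * enn2real (wint p \<omega> f)) powr (1 / p)"
    unfolding Ap_norm_def Ap_integral_eq[OF f D_classD(2)[OF \<omega>]] i_def[symmetric] using i by (simp add: enn2real_mult)
  then show ?thesis using C i p unfolding i_def[symmetric] by (simp add: powr_mult powr_powr)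
qed

text \<open>Stated for any operator dominated by averages, so that it serves for either of the two
  measures built from eta and sigma.\<close>

lemma bounded_if_avg_bound:
  fixes \<mu> \<nu> :: "(complex ^ 'n::finite) measure"
  assumes \<omega>: "D_class TYPE('n) \<omega>" and pq: "0 < p" "p \<le> q"
    and \<nu>: "sets \<nu> = sets (restrict_space borel Bn)"
    and meas: "\<And>f. f \<in> Ap p \<omega> \<Longrightarrow> T f \<in> borel_measurable \<mu>"
    and K0: "K0 > 0" "\<And>f. f \<in> Ap p \<omega> \<Longrightarrow> Lq_integral q \<mu> (T f) \<le> ennreal K0 * (\<integral>\<^sup>+b. avg q f b \<partial>\<nu>)"
    and car: "carleson p q \<omega> \<nu>"
  shows "bounded_Ap_Lq p q \<omega> \<mu> T"
proof -
  have q: "q > 0" using pq by simp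
  define w where "w = (\<lambda>f :: complex ^ 'n \<Rightarrow> complex. enn2real (wint p \<omega> f) powr (q / p))"
  define V where "V = (1 / volB TYPE('n)) powr (q / p)"
  have V: "V > 0" using volB_pos[where 'n='n] by (simp add: V_def)
  have holo: "holo_scalar f Bn" if "f \<in> Ap p \<omega>" for f :: "complex ^ 'n \<Rightarrow> complex"
    using that by (simp add: Ap_iff_wint[OF \<omega>])
  obtain C where C: "C \<ge> 0" "\<And>f. f \<in> Ap p \<omega> \<Longrightarrow> Lq_integral q \<nu> f \<le> ennreal ((C * Ap_norm p \<omega> f) powr q)"
    using car unfolding carleson_def bounded_Ap_Lq_def by blast
  \<comment> \<open>The constant 1 belongs to the Bergman space because omega is integrable; hence
    it lies in L^q of the measure, which is therefore finite. The averaging inequality needs this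
    for Tonelli.\<close>
  have fin: "finite_measure \<nu>"
    using car const_one_in_Ap[OF \<omega>] unfolding carleson_def bounded_Ap_Lq_def
    by (intro finite_measure_if_in_Lq_one[of q]) blast
  define A where "A = C powr q * V"
  have A: "A \<ge> 0" using V by (simp add: A_def)
  have carA: "(\<integral>\<^sup>+b. pw q f b \<partial>\<nu>) \<le> ennreal (A * w f)" if "f \<in> Ap p \<omega>" for f
    using C(2)[OF that] unfolding Lq_integral_eq_pw[OF \<nu>] Ap_norm_powr[OF \<omega> holo[OF that] C(1) pq(1)]
    by (simp add: A_def V_def w_def)
  show ?thesis
  proof (rule carleson_local_average[OF \<omega> pq], goal_cases)
    case (1 N K)
    note K = 1(1,2) and key = 1(3)
    \<comment> \<open>Dividing by \<open>V\<close> undoes the normalization of \<open>dV\<close>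
      that enters through \<open>Ap_norm\<close>.\<close>
    define C' where "C' = (K0 * (K * A) / V) powr (1 / q)"
    have C': "C' \<ge> 0" "C' powr q = K0 * (K * A) / V" using q K0(1) K(1) A V by (auto simp: C'_def powr_powr)
    have bd: "Lq_integral q \<mu> (T f) \<le> ennreal ((C' * Ap_norm p \<omega> f) powr q)" if f: "f \<in> Ap p \<omega>" for f
    proof -
      have "(\<integral>\<^sup>+b. avg q f b \<partial>\<nu>) \<le> ennreal (K * A * w f)"
        unfolding avg_def w_def by (rule key[OF \<nu> fin A _ f]) (use carA K(2) in \<open>auto simp: w_def\<close>)
      then have "Lq_integral q \<mu> (T f) \<le> ennreal K0 * ennreal (K * A * w f)"
        using K0(2)[OF f] by (meson mult_left_mono order_trans zero_le)
      also have "\<dots> = ennreal (K0 * (K * A) / V * V * w f)"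
        using K0(1) K(1) A V by (simp add: ennreal_mult'[symmetric] w_def mult_ac)
      also have "K0 * (K * A) / V * V * w f = (C' * Ap_norm p \<omega> f) powr q"
        unfolding Ap_norm_powr[OF \<omega> holo[OF f] C'(1) pq(1)] C'(2) V_def w_def ..
      finally show ?thesis .
    qed
    show ?thesis
      unfolding bounded_Ap_Lq_def in_Lq_def infinity_ennreal_def
      using meas bd C'(1) le_less_trans[OF bd ennreal_less_top] by blast
  qed
qed

section \<open>Local boundedness and normal families\<close>

lemma omega_hat_pos:
  assumes \<omega>: "D_class TYPE('n::finite) \<omega>" and r: "r < 1"
  shows "omega_hat \<omega> r > 0"
proof (rule ccontr)
  note [measurable] = D_classD(2)[OF \<omega>]
  assume "\<not> omega_hat \<omega> r > 0"
  then have "(\<integral>\<^sup>+s. ennreal (\<omega> s) * indicator {r<..<1} s \<partial>lborel) = 0"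
    by (simp add: omega_hat_def zero_less_iff_neq_zero)
  then have ae: "AE s in lborel. ennreal (\<omega> s) * indicator {r<..<1} s = 0"
    by (subst (asm) nn_integral_0_iff_AE) auto
  define r' where "r' = max r 0"
  have r': "r' < 1" "r \<le> r'" "0 \<le> r'" using r by (auto simp: r'_def)
  from ae have "AE s in lborel. s \<notin> {r'<..<1}"
  proof eventually_elim
    case (elim s)
    show ?case
    proof
      assume "s \<in> {r'<..<1}"
      then have "\<omega> s > 0" "s \<in> {r<..<1}" using D_classD(1)[OF \<omega>, of s] r' by auto
      then show False using elim by (simp add: ennreal_eq_0_iff)
    qed
  qed
  then have "emeasure lborel {r'<..<1} = 0"
    by (subst (asm) AE_iff_measurable[of "{r'<..<1}"]) auto
  then show False using r' by simp
qed

text \<open>On |z| <= R the coefficients in the growth estimate are bounded below: both (1 - |z|)^n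
  and the tail of omega decrease in |z|, and the tail at R is positive because omega is.\<close>

lemma locally_bounded_Ap:
  assumes \<omega>: "D_class TYPE('n::finite) \<omega>" and p: "0 < p" and R: "R < 1"
  obtains M where "M \<ge> 0" "\<And>(f :: complex ^ 'n \<Rightarrow> complex) z. f \<in> Ap p \<omega> \<Longrightarrow> norm z \<le> R \<Longrightarrow>
    norm (f z) \<le> M * enn2real (wint p \<omega> f) powr (1 / p)"
proof -
  obtain C2 where C2: "C2 > 0" "\<And>(f :: complex ^ 'n \<Rightarrow> complex) a. holo_scalar f Bn \<Longrightarrow> a \<in> Bn \<Longrightarrow>
    ennreal (norm (f a) powr p * (1 - norm a) ^ CARD('n)) * omega_hat \<omega> (norm a) \<le> ennreal C2 * wint p \<omega> f"
    using Ap_growth[OF \<omega> p] by blast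
  \<comment> \<open>The tail integral is known to be finite at nonnegative radii, hence the
    truncation.\<close>
  define R' where "R' = max R 0"
  have R': "R' < 1" "0 \<le> R'" "R \<le> R'" using R by (auto simp: R'_def)
  obtain w where w: "omega_hat \<omega> R' = ennreal w" "w > 0"
    using omega_hat_finite[OF \<omega> R'(2)] omega_hat_pos[OF \<omega> R'(1)]
    by (cases "omega_hat \<omega> R'") auto
  define c where "c = (1 - R') ^ CARD('n) * w"
  have c: "c > 0" using R' w by (simp add: c_def)
  define k where "k = C2 / c"
  have k: "k \<ge> 0" using c C2(1) by (simp add: k_def)
  show ?thesis
  proof (rule that[of "k powr (1 / p)"])
    fix f :: "complex ^ 'n \<Rightarrow> complex" and z :: "complex ^ 'n"
    assume f: "f \<in> Ap p \<omega>" and z: "norm z \<le> R"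
    have zB: "z \<in> Bn" using z R by (simp add: mem_Bn_iff)
    have hf: "holo_scalar f Bn" and "wint p \<omega> f < top" using f by (auto simp: Ap_iff_wint[OF \<omega>])
    then obtain J where J: "wint p \<omega> f = ennreal J" "J \<ge> 0" by (cases "wint p \<omega> f") auto
    have "ennreal (norm (f z) powr p * c) = ennreal (norm (f z) powr p * (1 - R') ^ CARD('n)) * ennreal w"
      using w R' by (simp add: c_def ennreal_mult''[symmetric] mult.assoc)
    also have "\<dots> \<le> ennreal (norm (f z) powr p * (1 - norm z) ^ CARD('n)) * omega_hat \<omega> (norm z)"
      unfolding w(1)[symmetric] using z R'
      by (intro mult_mono ennreal_leI mult_left_mono power_mono omega_hat_antimono) auto
    also have "\<dots> \<le> ennreal C2 * wint p \<omega> f" by (rule C2(2)[OF hf zB])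
    finally have "norm (f z) powr p * c \<le> C2 * J"
      using C2(1) J by (simp add: ennreal_mult'[symmetric])
    then have "norm (f z) powr p \<le> k * J" using c by (simp add: k_def field_simps)
    then have "(norm (f z) powr p) powr (1 / p) \<le> (k * J) powr (1 / p)"
      using p by (intro powr_mono2) auto
    then show "norm (f z) \<le> k powr (1 / p) * enn2real (wint p \<omega> f) powr (1 / p)"
      using p k J by (simp add: powr_powr powr_mult)
  qed simp
qed


lemma Ap_scale:
  fixes f :: "complex ^ 'n::finite \<Rightarrow> complex"
  assumes \<omega>: "D_class TYPE('n) \<omega>" and f: "f \<in> Ap p \<omega>"
  shows "(\<lambda>z. c * f z) \<in> Ap p \<omega>" "wint p \<omega> (\<lambda>z. c * f z) = ennreal (norm c powr p) * wint p \<omega> f"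
proof -
  note [measurable] = D_classD(2)[OF \<omega>]
  have hf: "holo_scalar f Bn" and fw: "wint p \<omega> f < top" using f by (auto simp: Ap_iff_wint[OF \<omega>])
  note [measurable] = pw_measurable[OF hf]
  have "holo_scalar (\<lambda>z. c * f z) Bn"
    unfolding holo_scalar_def
  proof
    fix z :: "complex ^ 'n" assume "z \<in> Bn"
    then obtain f' where f': "(f has_derivative f') (at z)" "\<And>c x. f' (c *s x) = c * f' x"
      using hf unfolding holo_scalar_def by blast
    then show "\<exists>f'. ((\<lambda>z. c * f z) has_derivative f') (at z) \<and> (\<forall>c x. f' (c *s x) = c * f' x)"
      by (intro exI[of _ "\<lambda>h. c * f' h"]) (auto intro!: derivative_eq_intros)
  qed
  moreover have "pw p (\<lambda>z. c * f z) z = ennreal (norm c powr p) * pw p f z" for z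
    by (simp add: pw_def norm_mult powr_mult ennreal_mult mult.assoc)
  then show w: "wint p \<omega> (\<lambda>z. c * f z) = ennreal (norm c powr p) * wint p \<omega> f"
    unfolding wint_def by (simp add: mult.assoc nn_integral_cmult)
  ultimately show "(\<lambda>z. c * f z) \<in> Ap p \<omega>"
    using fw by (simp add: Ap_iff_wint[OF \<omega>] ennreal_mult_less_top)
qed

text \<open>The crude factor 2^p treats all positive p at once, including p < 1.\<close>

lemma Ap_diff:
  fixes f g :: "complex ^ 'n::finite \<Rightarrow> complex"
  assumes \<omega>: "D_class TYPE('n) \<omega>" and p: "p > 0" and f: "f \<in> Ap p \<omega>" and g: "g \<in> Ap p \<omega>"
  shows "(\<lambda>z. f z - g z) \<in> Ap p \<omega>"
    "enn2real (wint p \<omega> (\<lambda>z. f z - g z)) \<le> 2 powr p * (enn2real (wint p \<omega> f) + enn2real (wint p \<omega> g))"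
proof -
  note [measurable] = D_classD(2)[OF \<omega>]
  have hf: "holo_scalar f Bn" and fw: "wint p \<omega> f < top" using f by (auto simp: Ap_iff_wint[OF \<omega>])
  have hg: "holo_scalar g Bn" and gw: "wint p \<omega> g < top" using g by (auto simp: Ap_iff_wint[OF \<omega>])
  note [measurable] = pw_measurable[OF hf] pw_measurable[OF hg]
  have holo: "holo_scalar (\<lambda>z. f z - g z) Bn"
    unfolding holo_scalar_def
  proof
    fix z :: "complex ^ 'n" assume z: "z \<in> Bn"
    obtain f' where f': "(f has_derivative f') (at z)" "\<And>c x. f' (c *s x) = c * f' x"
      using hf z unfolding holo_scalar_def by blast
    obtain g' where g': "(g has_derivative g') (at z)" "\<And>c x. g' (c *s x) = c * g' x"
      using hg z unfolding holo_scalar_def by blast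
    from f' g' show "\<exists>f'. ((\<lambda>z. f z - g z) has_derivative f') (at z) \<and> (\<forall>c x. f' (c *s x) = c * f' x)"
      by (intro exI[of _ "\<lambda>h. f' h - g' h"]) (auto intro!: derivative_eq_intros simp: algebra_simps)
  qed
  have "pw p (\<lambda>z. f z - g z) z \<le> ennreal (2 powr p) * (pw p f z + pw p g z)" for z
  proof -
    have "norm (f z - g z) powr p \<le> (norm (f z) + norm (g z)) powr p"
      using p by (intro powr_mono2 norm_triangle_ineq4) auto
    also have "\<dots> \<le> 2 powr p * (norm (f z) powr p + norm (g z) powr p)" using p by (intro powr_add_le) auto
    finally show ?thesis
      by (auto simp: pw_def indicator_def ennreal_mult'[symmetric] ennreal_plus[symmetric] ennreal_leI simp del: ennreal_plus)
  qed
  then have "wint p \<omega> (\<lambda>z. f z - g z) \<le> (\<integral>\<^sup>+z. ennreal (2 powr p) * (pw p f z + pw p g z) * ennreal (\<omega> (norm z)) \<partial>lborel)"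
    unfolding wint_def by (intro nn_integral_mono mult_right_mono) auto
  also have "\<dots> = ennreal (2 powr p) * (wint p \<omega> f + wint p \<omega> g)"
    unfolding wint_def by (simp add: nn_integral_cmult nn_integral_add mult.assoc distrib_right)
  finally have le: "wint p \<omega> (\<lambda>z. f z - g z) \<le> ennreal (2 powr p) * (wint p \<omega> f + wint p \<omega> g)" .
  also have lt: "\<dots> < top" using fw gw by (simp add: ennreal_mult_less_top)
  finally show "(\<lambda>z. f z - g z) \<in> Ap p \<omega>" using holo by (simp add: Ap_iff_wint[OF \<omega>])
  have "enn2real (wint p \<omega> (\<lambda>z. f z - g z)) \<le> enn2real (ennreal (2 powr p) * (wint p \<omega> f + wint p \<omega> g))"
    using le lt by (intro enn2real_mono)
  also have "\<dots> = 2 powr p * (enn2real (wint p \<omega> f) + enn2real (wint p \<omega> g))"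
    using fw gw by (simp add: enn2real_mult enn2real_plus)
  finally show "enn2real (wint p \<omega> (\<lambda>z. f z - g z)) \<le> 2 powr p * (enn2real (wint p \<omega> f) + enn2real (wint p \<omega> g))" .
qed

text \<open>Montel's theorem, by Arzela-Ascoli on the balls |z| <= 1 - 1/(i+2) and a diagonal
  subsequence. The bounds come from the growth estimate, equicontinuity from a one-variable
  Lipschitz estimate along complex lines.\<close>

lemma Ap_montel:
  fixes fs :: "nat \<Rightarrow> complex ^ 'n::finite \<Rightarrow> complex"
  assumes \<omega>: "D_class TYPE('n) \<omega>" and p: "p > 0" and fs: "\<And>k. fs k \<in> Ap p \<omega>"
    and B: "\<And>k. enn2real (wint p \<omega> (fs k)) \<le> B"
  obtains s :: "nat \<Rightarrow> nat" and F where "strict_mono s"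
    "\<And>R e. R < 1 \<Longrightarrow> e > 0 \<Longrightarrow> \<exists>N. \<forall>k\<ge>N. \<forall>z. norm z \<le> R \<longrightarrow> norm (fs (s k) z - F z) < e"
proof -
  have bdd: "\<exists>M\<ge>0. \<forall>k z. norm z \<le> R \<longrightarrow> norm (fs k z) \<le> M" if R: "R < 1" for R
  proof -
    obtain M where M: "M \<ge> 0" "\<And>(f :: complex ^ 'n \<Rightarrow> complex) z. f \<in> Ap p \<omega> \<Longrightarrow> norm z \<le> R \<Longrightarrow>
      norm (f z) \<le> M * enn2real (wint p \<omega> f) powr (1 / p)"
      using locally_bounded_Ap[OF \<omega> p R] by blast
    have "norm (fs k z) \<le> M * B powr (1 / p)" if "norm z \<le> R" for k z
    proof -
      have "norm (fs k z) \<le> M * enn2real (wint p \<omega> (fs k)) powr (1 / p)" using M(2)[OF fs that] .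
      also have "\<dots> \<le> M * B powr (1 / p)" using M(1) B p by (intro mult_left_mono powr_mono2) auto
      finally show ?thesis .
    qed
    then show ?thesis using M(1) by (intro exI[of _ "M * B powr (1 / p)"]) auto
  qed
  define R where "R = (\<lambda>i::nat. 1 - 1 / real (i + 2))"
  have R: "R i < 1" for i by (simp add: R_def)
  define P where "P = (\<lambda>i (k :: nat \<Rightarrow> nat). \<exists>g. \<forall>e>0. \<exists>N. \<forall>n\<ge>N. \<forall>x. norm x \<le> R i \<longrightarrow> norm (fs (k n) x - g x) < e)"
  have "\<exists>k :: nat \<Rightarrow> nat. strict_mono k \<and> P i (r \<circ> k)" for i and r :: "nat \<Rightarrow> nat"
  proof -
    obtain M where M: "M \<ge> 0" "\<And>k z. norm z \<le> R i \<Longrightarrow> norm (fs k z) \<le> M" using bdd[OF R] by metis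
    \<comment> \<open>Half the distance to the unit sphere: a complex disc of radius
      \<open>d\<close> around a point of the ball of radius \<open>R i\<close> stays where one bound
      \<open>M'\<close> holds for all the functions.\<close>
    define d where "d = (1 - R i) / 2"
    have d: "d > 0" using R[of i] by (simp add: d_def)
    have "R i + d < 1" using R[of i] unfolding d_def by argo
    then obtain M' where M': "M' \<ge> 0" "\<And>k z. norm z \<le> R i + d \<Longrightarrow> norm (fs k z) \<le> M'" using bdd by metis
    have lip: "norm (fs k x - fs k y) \<le> 3 * M' * norm (x - y) / d" if x: "norm x \<le> R i" and y: "norm (x - y) < d" for k x y
    proof (cases "x = y")
      case False
      define e where "e = (1 / complex_of_real (norm (y - x))) *s (y - x)"
      have ne: "norm e = 1" unfolding e_def norm_vector_scale using False by (simp add: norm_divide)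
      have in': "norm (x + w *s e) \<le> R i + d" if "norm w < d" for w
        using norm_triangle_ineq[of x "w *s e"] x that by (simp add: norm_vector_scale ne)
      have hol: "holo_scalar (fs k) Bn" using fs[of k] by (simp add: Ap_iff_wint[OF \<omega>])
      have "(\<lambda>w. fs k (x + w *s e)) holomorphic_on ball 0 d"
        using in' \<open>R i + d < 1\<close> by (intro holo_scalar_slice[OF hol]) (auto simp: mem_Bn_iff intro: le_less_trans)
      moreover have "norm (fs k (x + w *s e)) \<le> M'" if "norm w < d" for w
        using in'[OF that] by (rule M'(2))
      ultimately have "norm (fs k (x + of_real (norm (y - x)) *s e) - fs k (x + 0 *s e)) \<le> 3 * M' * norm (complex_of_real (norm (y - x))) / d"
        using y by (intro holomorphic_bounded_lipschitz[of "\<lambda>w. fs k (x + w *s e)"]) (auto simp: norm_minus_commute)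
      moreover have "of_real (norm (y - x)) *s e = y - x"
        unfolding e_def vector_smult_assoc using False by simp
      ultimately show ?thesis by (simp add: norm_minus_commute)
    qed simp
    obtain g k where gk: "strict_mono (k :: nat \<Rightarrow> nat)"
      "\<And>e. 0 < e \<Longrightarrow> \<exists>N. \<forall>n x. n \<ge> N \<and> x \<in> cball 0 (R i) \<longrightarrow> norm (fs (r (k n)) x - g x) < e"
    proof (rule Arzela_Ascoli[of "cball 0 (R i)" "\<lambda>n. fs (r n)" M])
      show "compact (cball (0 :: complex ^ 'n) (R i))" by simp
      show "norm (fs (r n) x) \<le> M" if "x \<in> cball 0 (R i)" for n x using that by (intro M(2)) simp
      fix x :: "complex ^ 'n" and e :: real assume x: "x \<in> cball 0 (R i)" and e: "0 < e"
      \<comment> \<open>The second entry turns the Lipschitz constant 3 M' / d into oscillation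
        below e; the summand 1 keeps the denominator positive when M' = 0.\<close>
      define t where "t = min d (e * d / (3 * M' + 1))"
      have t: "t > 0" using d e M'(1) by (simp add: t_def)
      have "norm (fs (r n) x - fs (r n) y) < e" if y: "norm (x - y) < t" for n y
      proof -
        have "norm (fs (r n) x - fs (r n) y) \<le> 3 * M' * norm (x - y) / d"
          using x y by (intro lip) (auto simp: t_def)
        also have "\<dots> \<le> (3 * M' + 1) * norm (x - y) / d"
          using d by (intro divide_right_mono mult_right_mono) auto
        also have "\<dots> < e"
        proof -
          have "norm (x - y) < e * d / (3 * M' + 1)" using y by (simp add: t_def)
          then have "(3 * M' + 1) * norm (x - y) < e * d" using M'(1) by (simp add: field_simps)
          then show ?thesis using d by (simp add: field_simps)
        qed
        finally show ?thesis .
      qed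
      then show "\<exists>d>0. \<forall>n y. y \<in> cball 0 (R i) \<and> norm (x - y) < d \<longrightarrow> norm (fs (r n) x - fs (r n) y) < e"
        using t by blast
    qed blast
    have "P i (r \<circ> k)"
      unfolding P_def
    proof (intro exI[of _ g] allI impI)
      fix e :: real assume "e > 0"
      then obtain N where "\<forall>n x. n \<ge> N \<and> x \<in> cball 0 (R i) \<longrightarrow> norm (fs (r (k n)) x - g x) < e" using gk(2) by blast
      then show "\<exists>N. \<forall>n\<ge>N. \<forall>x. norm x \<le> R i \<longrightarrow> norm (fs ((r \<circ> k) n) x - g x) < e" by (intro exI[of _ N]) auto
    qed
    then show ?thesis using gk(1) by blast
  qed
  \<comment> \<open>The diagonal sequence is a subsequence of the i-th one only from some index on;
    convergence depends on the tail alone.\<close>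
  moreover have "P i (r \<circ> k2)" if P1: "P i (r \<circ> k1)" and N: "\<And>j. N \<le> j \<Longrightarrow> \<exists>j'. j \<le> j' \<and> k2 j = k1 j'"
    for i and r k1 k2 :: "nat \<Rightarrow> nat" and N
  proof -
    obtain g where g: "\<forall>e>0. \<exists>N. \<forall>n\<ge>N. \<forall>x. norm x \<le> R i \<longrightarrow> norm (fs ((r \<circ> k1) n) x - g x) < e"
      using P1 unfolding P_def by blast
    show ?thesis
      unfolding P_def
    proof (intro exI[of _ g] allI impI)
      fix e :: real assume "e > 0"
      then obtain N' where N': "\<forall>n\<ge>N'. \<forall>x. norm x \<le> R i \<longrightarrow> norm (fs ((r \<circ> k1) n) x - g x) < e" using g by blast
      have "norm (fs ((r \<circ> k2) n) x - g x) < e" if n: "n \<ge> max N N'" and x: "norm x \<le> R i" for n x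
      proof -
        obtain j' where "n \<le> j'" "k2 n = k1 j'" using N[of n] n by auto
        then show ?thesis using N' n x by (metis comp_apply max.bounded_iff order_trans)
      qed
      then show "\<exists>N. \<forall>n\<ge>N. \<forall>x. norm x \<le> R i \<longrightarrow> norm (fs ((r \<circ> k2) n) x - g x) < e" by blast
    qed
  qed
  ultimately obtain s where s: "strict_mono (s :: nat \<Rightarrow> nat)" "\<And>i. P i (id \<circ> s)"
    using subsequence_diagonalization_lemma[of P id] by blast
  have lims: "\<exists>g. \<forall>e>0. \<exists>N. \<forall>n\<ge>N. \<forall>x. norm x \<le> R i \<longrightarrow> norm (fs (s n) x - g x) < e" for i
    using s(2)[of i] by (simp add: P_def)
  then obtain G where G: "\<And>i e. e > 0 \<Longrightarrow> \<exists>N. \<forall>n\<ge>N. \<forall>x. norm x \<le> R i \<longrightarrow> norm (fs (s n) x - G i x) < e"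
    by metis
  \<comment> \<open>The limits on different balls were chosen independently; the pointwise limit
    \<open>F\<close> agrees with each of them on its own ball.\<close>
  define F where "F = (\<lambda>z. lim (\<lambda>k. fs (s k) z))"
  have FG: "F z = G i z" if "norm z \<le> R i" for z i
  proof -
    have "(\<lambda>k. fs (s k) z) \<longlonglongrightarrow> G i z"
      using G[of _ i] that unfolding LIMSEQ_iff by meson
    then show ?thesis unfolding F_def by (rule limI)
  qed
  show ?thesis
  proof (rule that[OF s(1), of F])
    fix R' e :: real assume R': "R' < 1" and e: "e > 0"
    obtain i where "1 / real (i + 2) < 1 - R'"
    proof -
      obtain i where "inverse (real (Suc i)) < 1 - R'" using reals_Archimedean[of "1 - R'"] R' by auto
      moreover have "1 / real (i + 2) \<le> inverse (real (Suc i))" by (simp add: field_simps)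
      ultimately show ?thesis using that[of i] by linarith
    qed
    then have "R' \<le> R i" by (simp add: R_def)
    with G[OF e, of i] FG[of _ i] show "\<exists>N. \<forall>k\<ge>N. \<forall>z. norm z \<le> R' \<longrightarrow> norm (fs (s k) z - F z) < e"
      by (metis order_trans)
  qed
qed


section \<open>Vanishing Carleson measures near the boundary\<close>

lemma Lq_integral_tail_tendsto_0:
  fixes g :: "complex ^ 'n::finite \<Rightarrow> complex"
  assumes \<nu>: "sets \<nu> = sets (restrict_space borel Bn)" and g: "in_Lq q \<nu> g"
  shows "(\<lambda>k. \<integral>\<^sup>+z. ennreal (norm (g z) powr q) * indicator {z. norm z > 1 - 1 / real (k + 2)} z \<partial>\<nu>) \<longlonglongrightarrow> 0"
proof -
  have [measurable]: "g \<in> borel_measurable \<nu>" and fin: "(\<integral>\<^sup>+z. ennreal (norm (g z) powr q) \<partial>\<nu>) < \<infinity>"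
    using g by (auto simp: in_Lq_def Lq_integral_def)
  have ind: "(indicator {z :: complex ^ 'n. norm z > c} :: _ \<Rightarrow> ennreal) \<in> borel_measurable \<nu>" for c
    by (rule measurable_restrict_borel[OF _ \<nu>]) measurable
  have "(\<lambda>k. \<integral>\<^sup>+z. ennreal (norm (g z) powr q) * indicator {z. norm z > 1 - 1 / real (k + 2)} z \<partial>\<nu>) \<longlonglongrightarrow> (\<integral>\<^sup>+z. 0 \<partial>\<nu>)"
  proof (rule nn_integral_dominated_convergence[where w="\<lambda>z. ennreal (norm (g z) powr q)"])
    show "AE z in \<nu>. (\<lambda>k. ennreal (norm (g z) powr q) * indicator {z. norm z > 1 - 1 / real (k + 2)} z) \<longlonglongrightarrow> 0"
    proof (rule AE_I2)
      fix z assume "z \<in> space \<nu>"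
      then have z: "norm z < 1" using space_restrict_Bn[OF \<nu>] by (simp add: mem_Bn_iff)
      obtain N where N: "inverse (real (Suc N)) < 1 - norm z" using reals_Archimedean[of "1 - norm z"] z by auto
      have "ennreal (norm (g z) powr q) * indicator {z. norm z > 1 - 1 / real (k + 2)} z = 0" if "k \<ge> N" for k
      proof -
        have "1 / real (k + 2) \<le> inverse (real (Suc N))" using that by (simp add: field_simps)
        then show ?thesis using N by simp
      qed
      then show "(\<lambda>k. ennreal (norm (g z) powr q) * indicator {z. norm z > 1 - 1 / real (k + 2)} z) \<longlonglongrightarrow> 0"
        by (intro tendsto_eventually) (auto simp: eventually_sequentially)
    qed
    show "AE z in \<nu>. ennreal (norm (g z) powr q) * indicator {z. norm z > 1 - 1 / real (k + 2)} z \<le> ennreal (norm (g z) powr q)" for k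
      by (auto split: split_indicator)
    show gm: "(\<lambda>z. ennreal (norm (g z) powr q)) \<in> borel_measurable \<nu>" by measurable
    show "(\<lambda>z. ennreal (norm (g z) powr q) * indicator {z. norm z > 1 - 1 / real (k + 2)} z) \<in> borel_measurable \<nu>" for k
      by (rule borel_measurable_times_ennreal[OF gm ind])
    show "(\<integral>\<^sup>+z. ennreal (norm (g z) powr q) \<partial>\<nu>) < \<infinity>" by (rule fin)
  qed simp
  then show ?thesis by simp
qed

text \<open>Otherwise there are f_k with weighted integral at most 1 whose mass on |z| > R_k exceeds
  epsilon, where R_k tends to 1. A subsequence converges in L^q to some g. The mass of g on |z| >
  R_k tends to 0, hence so does that of the subsequence, a contradiction. Homogeneity removes the
  normalization.\<close>

lemma vanishing_carleson_tail:
  fixes \<nu> :: "(complex ^ 'n::finite) measure"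
  assumes \<omega>: "D_class TYPE('n) \<omega>" and pq: "0 < p" "p \<le> q"
    and \<nu>: "sets \<nu> = sets (restrict_space borel Bn)"
    and van: "vanishing_carleson p q \<omega> \<nu>" and \<epsilon>: "\<epsilon> > 0"
  obtains R where "R < 1" "\<And>f. f \<in> Ap p \<omega> \<Longrightarrow>
    (\<integral>\<^sup>+z. pw q f z * indicator {z. norm z > R} z \<partial>\<nu>) \<le> ennreal (\<epsilon> * enn2real (wint p \<omega> f) powr (q / p))"
proof -
  have q: "q > 0" using pq by simp
  define R where "R = (\<lambda>k::nat. 1 - 1 / real (k + 2))"
  have ind [measurable]: "(indicator {z :: complex ^ 'n. norm z > c} :: _ \<Rightarrow> ennreal) \<in> borel_measurable \<nu>" for c
    by (rule measurable_restrict_borel[OF _ \<nu>]) measurable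
  have "\<exists>k. \<forall>f. f \<in> Ap p \<omega> \<and> enn2real (wint p \<omega> f) \<le> 1 \<longrightarrow> (\<integral>\<^sup>+z. pw q f z * indicator {z. norm z > R k} z \<partial>\<nu>) \<le> ennreal \<epsilon>"
  proof (rule ccontr)
    assume "\<not> ?thesis"
    then have "\<forall>k. \<exists>f. f \<in> Ap p \<omega> \<and> enn2real (wint p \<omega> f) \<le> 1 \<and> \<not> (\<integral>\<^sup>+z. pw q f z * indicator {z. norm z > R k} z \<partial>\<nu>) \<le> ennreal \<epsilon>"
      by blast
    then obtain fs where fs: "\<And>k. fs k \<in> Ap p \<omega>" "\<And>k. enn2real (wint p \<omega> (fs k)) \<le> 1"
      "\<And>k. \<not> (\<integral>\<^sup>+z. pw q (fs k) z * indicator {z. norm z > R k} z \<partial>\<nu>) \<le> ennreal \<epsilon>"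
      by metis
    have holo: "holo_scalar (fs k) Bn" for k using fs(1)[of k] by (simp add: Ap_iff_wint[OF \<omega>])
    have "Ap_norm p \<omega> (fs k) \<le> (1 / volB TYPE('n)) powr (1 / p)" for k
    proof -
      have "Ap_norm p \<omega> (fs k) = (1 * Ap_norm p \<omega> (fs k)) powr 1" by (simp add: Ap_norm_def)
      also have "\<dots> = (1 / volB TYPE('n)) powr (1 / p) * enn2real (wint p \<omega> (fs k)) powr (1 / p)"
        by (subst Ap_norm_powr[OF \<omega> holo _ pq(1)]) auto
      also have "\<dots> \<le> (1 / volB TYPE('n)) powr (1 / p) * 1"
        using fs(2)[of k] pq by (intro mult_left_mono) (auto simp: powr_le1)
      finally show ?thesis by simp
    qed
    then have "bounded (range (\<lambda>k. Ap_norm p \<omega> (fs k)))"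
      by (intro boundedI[of _ "(1 / volB TYPE('n)) powr (1 / p)"]) (auto simp: Ap_norm_def)
    then obtain s :: "nat \<Rightarrow> nat" and g where s: "strict_mono s" and g: "in_Lq q \<nu> g"
      and lim: "(\<lambda>k. Lq_integral q \<nu> (\<lambda>z. fs (s k) z - g z)) \<longlonglongrightarrow> 0"
      using van fs(1) unfolding vanishing_carleson_def compact_Ap_Lq_def by blast
    have [measurable]: "g \<in> borel_measurable \<nu>" using g by (simp add: in_Lq_def)
    have [measurable]: "fs k \<in> borel_measurable \<nu>" for k
      using van fs(1) unfolding vanishing_carleson_def compact_Ap_Lq_def in_Lq_def by blast
    define G where "G = (\<lambda>k. \<integral>\<^sup>+z. ennreal (norm (g z) powr q) * indicator {z. norm z > R k} z \<partial>\<nu>)"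
    have "G \<longlonglongrightarrow> 0" unfolding G_def R_def by (rule Lq_integral_tail_tendsto_0[OF \<nu> g])
    then have "(\<lambda>k. G (s k)) \<longlonglongrightarrow> 0" using s by (rule LIMSEQ_subseq_LIMSEQ[unfolded o_def])
    then have "(\<lambda>k. ennreal (2 powr q) * (Lq_integral q \<nu> (\<lambda>z. fs (s k) z - g z) + G (s k))) \<longlonglongrightarrow> ennreal (2 powr q) * (0 + 0)"
      using lim by (intro ennreal_tendsto_cmult tendsto_add) auto
    then have "\<forall>\<^sub>F k in sequentially. ennreal (2 powr q) * (Lq_integral q \<nu> (\<lambda>z. fs (s k) z - g z) + G (s k)) < ennreal \<epsilon>"
      using \<epsilon> by (intro order_tendstoD) auto
    then obtain k where k: "ennreal (2 powr q) * (Lq_integral q \<nu> (\<lambda>z. fs (s k) z - g z) + G (s k)) < ennreal \<epsilon>"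
      by (auto simp: eventually_sequentially)
    have "(\<integral>\<^sup>+z. pw q (fs (s k)) z * indicator {z. norm z > R (s k)} z \<partial>\<nu>)
       \<le> (\<integral>\<^sup>+z. ennreal (2 powr q) * (ennreal (norm (fs (s k) z - g z) powr q) + ennreal (norm (g z) powr q) * indicator {z. norm z > R (s k)} z) \<partial>\<nu>)"
    proof (rule nn_integral_mono)
      fix z :: "complex ^ 'n"
      have "norm (fs (s k) z) powr q \<le> (norm (fs (s k) z - g z) + norm (g z)) powr q"
        using q norm_triangle_ineq[of "fs (s k) z - g z" "g z"] by (intro powr_mono2) auto
      also have "\<dots> \<le> 2 powr q * (norm (fs (s k) z - g z) powr q + norm (g z) powr q)" using q by (intro powr_add_le) auto
      finally have "ennreal (norm (fs (s k) z) powr q) \<le> ennreal (2 powr q) * (ennreal (norm (fs (s k) z - g z) powr q) + ennreal (norm (g z) powr q))"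
        by (simp add: ennreal_mult'[symmetric] ennreal_plus[symmetric] ennreal_leI del: ennreal_plus)
      then show "pw q (fs (s k)) z * indicator {z. norm z > R (s k)} z
         \<le> ennreal (2 powr q) * (ennreal (norm (fs (s k) z - g z) powr q) + ennreal (norm (g z) powr q) * indicator {z. norm z > R (s k)} z)"
        by (auto simp: pw_def indicator_def)
    qed
    also have "\<dots> = ennreal (2 powr q) * (Lq_integral q \<nu> (\<lambda>z. fs (s k) z - g z) + G (s k))"
      unfolding Lq_integral_def G_def by (simp add: nn_integral_cmult nn_integral_add)
    finally show False using k fs(3)[of "s k"] by simp
  qed
  then obtain k where k: "\<And>f. f \<in> Ap p \<omega> \<Longrightarrow> enn2real (wint p \<omega> f) \<le> 1 \<Longrightarrow> (\<integral>\<^sup>+z. pw q f z * indicator {z. norm z > R k} z \<partial>\<nu>) \<le> ennreal \<epsilon>"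
    by blast
  show ?thesis
  proof (rule that[of "R k"])
    fix f :: "complex ^ 'n \<Rightarrow> complex" assume f: "f \<in> Ap p \<omega>"
    define J where "J = enn2real (wint p \<omega> f)"
    have holo: "holo_scalar f Bn" using f by (simp add: Ap_iff_wint[OF \<omega>])
    have "J \<ge> 0" by (simp add: J_def)
    show "(\<integral>\<^sup>+z. pw q f z * indicator {z. norm z > R k} z \<partial>\<nu>) \<le> ennreal (\<epsilon> * enn2real (wint p \<omega> f) powr (q / p))"
    \<comment> \<open>A function of norm zero cannot be rescaled to norm one; it vanishes on the
      ball by the local bound.\<close>
    proof (cases "J = 0")
      case True
      have "pw q f z = 0" for z
      proof (cases "z \<in> Bn")
        case zB: True
        then have "norm z < 1" by (simp add: mem_Bn_iff)
        then obtain M where "norm (f z) \<le> M * J powr (1 / p)"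
          using locally_bounded_Ap[OF \<omega> pq(1), of "norm z"] f unfolding J_def by (metis order_refl)
        then show ?thesis using True q by (simp add: pw_def)
      qed (simp add: pw_def)
      then show ?thesis by simp
    next
      case False
      with \<open>J \<ge> 0\<close> have J: "J > 0" by simp
      define t where "t = J powr (- 1 / p)"
      have t: "t > 0" using J by (simp add: t_def)
      define g where "g = (\<lambda>z. complex_of_real t * f z)"
      have g: "g \<in> Ap p \<omega>" unfolding g_def by (rule Ap_scale[OF \<omega> f])
      have "enn2real (wint p \<omega> g) = t powr p * J"
        unfolding g_def Ap_scale(2)[OF \<omega> f] J_def using t by (simp add: enn2real_mult)
      also have "t powr p = 1 / J" unfolding t_def powr_powr using J pq by (simp add: powr_minus_divide)
      finally have "enn2real (wint p \<omega> g) \<le> 1" using J by simp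
      then have le: "(\<integral>\<^sup>+z. pw q g z * indicator {z. norm z > R k} z \<partial>\<nu>) \<le> ennreal \<epsilon>" by (rule k[OF g])
      have tq: "t powr q = 1 / J powr (q / p)" unfolding t_def powr_powr using J pq by (simp add: powr_minus_divide)
      have "pw q f z = ennreal (J powr (q / p)) * pw q g z" for z
      proof -
        have "norm (g z) powr q = norm (f z) powr q / J powr (q / p)"
          using t by (simp add: g_def norm_mult powr_mult tq)
        then have "norm (f z) powr q = J powr (q / p) * norm (g z) powr q" using J by simp
        then show ?thesis by (simp add: pw_def ennreal_mult mult.assoc)
      qed
      then have "(\<integral>\<^sup>+z. pw q f z * indicator {z. norm z > R k} z \<partial>\<nu>) = ennreal (J powr (q / p)) * (\<integral>\<^sup>+z. pw q g z * indicator {z. norm z > R k} z \<partial>\<nu>)"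
        using measurable_restrict_borel[OF pw_measurable \<nu>] g
        by (subst nn_integral_cmult[symmetric]) (auto simp: mult.assoc Ap_iff_wint[OF \<omega>])
      also have "\<dots> \<le> ennreal (J powr (q / p)) * ennreal \<epsilon>" using le by (rule mult_left_mono) simp
      finally show ?thesis using \<epsilon> by (simp add: J_def ennreal_mult'[symmetric] mult.commute)
    qed
  qed (simp add: R_def)
qed

text \<open>Points near b with |b| <= R satisfy |z| <= 1 - (1 - R) / 4, so only the values of f on
  this smaller ball enter.\<close>

lemma avg_le_if_bounded:
  fixes f :: "complex ^ 'n::finite \<Rightarrow> complex"
  assumes R: "0 \<le> R" "R < 1" and b: "norm b \<le> R" and q: "q > 0" and e: "e \<ge> 0"
    and f: "\<And>z. norm z \<le> 1 - (1 - R) / 4 \<Longrightarrow> norm (f z) \<le> e"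
  shows "avg q f b \<le> ennreal (1 / (1 - R) ^ (CARD('n) + 1) * volB TYPE('n) * e powr q)"
proof -
  have nb: "norm b < 1" using b R by simp
  then have bB: "b \<in> Bn" by (simp add: mem_Bn_iff)
  have "local_pw q f b \<le> (\<integral>\<^sup>+z. ennreal (e powr q) * indicator (Bn :: (complex ^ 'n) set) z \<partial>lborel)"
    unfolding local_pw_def
  proof (rule nn_integral_mono)
    fix z :: "complex ^ 'n"
    show "pw q f z * indicator {z. near b z} z \<le> ennreal (e powr q) * indicator Bn z"
    proof (cases "near b z")
      case True
      have "(1 - norm b) / 4 \<le> 1 - norm z" by (rule near_norm_bounds[OF bB True])
      then have "norm z \<le> 1 - (1 - R) / 4" using b by argo
      then have "norm (f z) powr q \<le> e powr q" using f q by (intro powr_mono2) auto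
      then show ?thesis by (auto simp: pw_def indicator_def ennreal_leI)
    qed simp
  qed
  also have "\<dots> = ennreal (e powr q * volB TYPE('n))"
    using volB_pos[where 'n='n] by (simp add: nn_integral_cmult_indicator emeasure_Bn ennreal_mult)
  finally have "avg q f b \<le> ennreal (1 / (1 - (norm b)\<^sup>2) ^ (CARD('n) + 1)) * ennreal (e powr q * volB TYPE('n))"
    unfolding avg_def by (rule mult_left_mono) simp
  also have "\<dots> \<le> ennreal (1 / (1 - R) ^ (CARD('n) + 1)) * ennreal (e powr q * volB TYPE('n))"
  proof (intro mult_right_mono ennreal_leI frac_le power_mono)
    show "1 - R \<le> 1 - (norm b)\<^sup>2" using one_minus_norm_sq_bounds(1)[OF nb] b by linarith
  qed (use R in auto)
  also have "\<dots> = ennreal (1 / (1 - R) ^ (CARD('n) + 1) * volB TYPE('n) * e powr q)"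
    using R volB_pos[where 'n='n] by (subst ennreal_mult[symmetric]) (auto simp: mult_ac)
  finally show ?thesis .
qed

text \<open>Split the measure at a radius. Inside, the averages are controlled by the supremum of f
  on a slightly larger ball and by the total mass. Outside, the restricted measure satisfies the
  testing condition with a small constant, and the averaging inequality applies to it.\<close>

lemma vanishing_avg_bound:
  fixes \<nu> :: "(complex ^ 'n::finite) measure"
  assumes \<omega>: "D_class TYPE('n) \<omega>" and pq: "0 < p" "p \<le> q"
    and \<nu>: "sets \<nu> = sets (restrict_space borel Bn)"
    and van: "vanishing_carleson p q \<omega> \<nu>" and \<epsilon>: "\<epsilon> > 0"
  obtains c R where "c \<ge> 0" "R < 1" "\<And>f e. f \<in> Ap p \<omega> \<Longrightarrow> e \<ge> 0 \<Longrightarrow> (\<And>z. norm z \<le> R \<Longrightarrow> norm (f z) \<le> e) \<Longrightarrow>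
    (\<integral>\<^sup>+b. avg q f b \<partial>\<nu>) \<le> ennreal (c * e powr q + \<epsilon> * enn2real (wint p \<omega> f) powr (q / p))"
proof (rule carleson_local_average[OF \<omega> pq], goal_cases)
  case (1 N K)
  note K = 1(2,3) and key = 1(4)
  have q: "q > 0" using pq by simp
  have fin: "finite_measure \<nu>"
    using van const_one_in_Ap[OF \<omega>] unfolding vanishing_carleson_def compact_Ap_Lq_def
    by (intro finite_measure_if_in_Lq_one[of q]) blast
  interpret \<nu>: finite_measure \<nu> by (rule fin)
  \<comment> \<open>Dividing by \<open>K\<close> in advance cancels the constant of the averaging
    inequality. Here its independence of the measure matters: it is applied to the restriction
    \<open>\<nu>'\<close>, which depends on epsilon.\<close>
  have "\<epsilon> / K > 0" using \<epsilon> K by simp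
  obtain R0 where R0: "R0 < 1" "\<And>f. f \<in> Ap p \<omega> \<Longrightarrow>
    (\<integral>\<^sup>+z. pw q f z * indicator {z. norm z > R0} z \<partial>\<nu>) \<le> ennreal (\<epsilon> / K * enn2real (wint p \<omega> f) powr (q / p))"
    using vanishing_carleson_tail[OF \<omega> pq \<nu> van \<open>\<epsilon> / K > 0\<close>] by blast
  define R where "R = max R0 0"
  have R: "0 \<le> R" "R < 1" "R0 \<le> R" using R0 by (auto simp: R_def)
  have ind [measurable]: "(indicator {z :: complex ^ 'n. norm z > R} :: _ \<Rightarrow> ennreal) \<in> borel_measurable \<nu>"
    by (rule measurable_restrict_borel[OF _ \<nu>]) measurable
  have ind' [measurable]: "(indicator {z :: complex ^ 'n. norm z \<le> R} :: _ \<Rightarrow> ennreal) \<in> borel_measurable \<nu>"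
    by (rule measurable_restrict_borel[OF _ \<nu>]) measurable
  define \<nu>' where "\<nu>' = density \<nu> (indicator {z :: complex ^ 'n. norm z > R})"
  have \<nu>'s: "sets \<nu>' = sets (restrict_space borel Bn)" by (simp add: \<nu>'_def \<nu>)
  have \<nu>'i: "(\<integral>\<^sup>+z. h z \<partial>\<nu>') = (\<integral>\<^sup>+z. h z * indicator {z. norm z > R} z \<partial>\<nu>)" if "h \<in> borel_measurable \<nu>" for h
    unfolding \<nu>'_def using that by (subst nn_integral_density) (auto simp: mult.commute)
  have fin': "finite_measure \<nu>'"
  proof (rule finite_measureI)
    have "emeasure \<nu>' (space \<nu>') = (\<integral>\<^sup>+z. indicator {z. norm z > R} z \<partial>\<nu>)"
      using \<nu>'i[of "\<lambda>_. 1"] by simp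
    also have "\<dots> \<le> (\<integral>\<^sup>+z. 1 \<partial>\<nu>)" by (intro nn_integral_mono) (auto simp: indicator_def)
    also have "\<dots> < top" using \<nu>.emeasure_finite[of "space \<nu>"] by (simp add: less_top[symmetric])
    finally show "emeasure \<nu>' (space \<nu>') \<noteq> \<infinity>" by simp
  qed
  define c where "c = 1 / (1 - R) ^ (CARD('n) + 1) * volB TYPE('n) * measure \<nu> (space \<nu>)"
  have c: "c \<ge> 0" using R volB_pos[where 'n='n] by (simp add: c_def)
  have R1: "1 - (1 - R) / 4 < 1" using R by simp
  show ?thesis
  proof (rule that[OF c R1])
    fix f :: "complex ^ 'n \<Rightarrow> complex" and e :: real
    assume f: "f \<in> Ap p \<omega>" and e: "e \<ge> 0" and fe: "\<And>z. norm z \<le> 1 - (1 - R) / 4 \<Longrightarrow> norm (f z) \<le> e"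
    have holo: "holo_scalar f Bn" using f by (simp add: Ap_iff_wint[OF \<omega>])
    have [measurable]: "avg q f \<in> borel_measurable \<nu>" by (rule measurable_restrict_borel[OF avg_measurable[OF holo] \<nu>])
    have "(\<integral>\<^sup>+b. avg q f b \<partial>\<nu>) = (\<integral>\<^sup>+b. avg q f b * indicator {z. norm z \<le> R} b + avg q f b * indicator {z. norm z > R} b \<partial>\<nu>)"
      by (intro nn_integral_cong) (auto simp: indicator_def)
    also have "\<dots> = (\<integral>\<^sup>+b. avg q f b * indicator {z. norm z \<le> R} b \<partial>\<nu>) + (\<integral>\<^sup>+b. avg q f b * indicator {z. norm z > R} b \<partial>\<nu>)"
      by (rule nn_integral_add) measurable
    also have "(\<integral>\<^sup>+b. avg q f b * indicator {z. norm z \<le> R} b \<partial>\<nu>) \<le> (\<integral>\<^sup>+b. ennreal (1 / (1 - R) ^ (CARD('n) + 1) * volB TYPE('n) * e powr q) \<partial>\<nu>)"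
      using avg_le_if_bounded[OF R(1,2) _ q e fe] by (intro nn_integral_mono) (auto simp: indicator_def)
    also have "\<dots> = ennreal (c * e powr q)"
      using R volB_pos[where 'n='n] by (simp add: c_def \<nu>.emeasure_eq_measure ennreal_mult'[symmetric] mult_ac)
    also have "(\<integral>\<^sup>+b. avg q f b * indicator {z. norm z > R} b \<partial>\<nu>) \<le> ennreal (\<epsilon> * enn2real (wint p \<omega> f) powr (q / p))"
    proof -
      have "(\<integral>\<^sup>+b. avg q f b * indicator {z. norm z > R} b \<partial>\<nu>) = (\<integral>\<^sup>+b. avg q f b \<partial>\<nu>')" by (simp add: \<nu>'i)
      also have "\<dots> \<le> ennreal (K * (\<epsilon> / K) * enn2real (wint p \<omega> f) powr (q / p))"
        unfolding avg_def
      proof (rule key[OF \<nu>'s fin' _ _ f])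
        show "0 \<le> \<epsilon> / K" using \<open>\<epsilon> / K > 0\<close> by simp
        fix a :: "complex ^ 'n" assume a: "a \<in> Bn"
        have "(\<integral>\<^sup>+b. pw q (kern N a) b \<partial>\<nu>') = (\<integral>\<^sup>+b. pw q (kern N a) b * indicator {z. norm z > R} b \<partial>\<nu>)"
          by (rule \<nu>'i) (rule measurable_restrict_borel[OF pw_measurable[OF holo_scalar_kern[OF a]] \<nu>])
        also have "\<dots> \<le> (\<integral>\<^sup>+b. pw q (kern N a) b * indicator {z. norm z > R0} b \<partial>\<nu>)"
          using R(3) by (intro nn_integral_mono) (auto simp: indicator_def)
        also have "\<dots> \<le> ennreal (\<epsilon> / K * enn2real (wint p \<omega> (kern N a)) powr (q / p))"
          by (rule R0(2)[OF K(2)[OF a]])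
        finally show "(\<integral>\<^sup>+b. pw q (kern N a) b \<partial>\<nu>') \<le> ennreal (\<epsilon> / K * enn2real (wint p \<omega> (kern N a)) powr (q / p))" .
      qed
      finally show ?thesis using K(1) by simp
    qed
    finally show "(\<integral>\<^sup>+b. avg q f b \<partial>\<nu>) \<le> ennreal (c * e powr q + \<epsilon> * enn2real (wint p \<omega> f) powr (q / p))"
      using c \<epsilon> by (simp add: add_mono)
  qed
qed


text \<open>Of T only compatibility with differences and pointwise continuity on the ball are used.
  The bounds are applied to differences of members of the sequence, which lie in the Bergman space;
  Fatou's lemma then carries the Cauchy estimate to the limit, so that \<open>F\<close> enters only
  as a pointwise limit.\<close>

lemma compact_if_avg_bound:
  fixes \<mu> \<nu> :: "(complex ^ 'n::finite) measure"
  assumes \<omega>: "D_class TYPE('n) \<omega>" and pq: "0 < p" "p \<le> q"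
    and \<nu>: "sets \<nu> = sets (restrict_space borel Bn)" and \<mu>: "space \<mu> = Bn"
    and meas: "\<And>f. f \<in> Ap p \<omega> \<Longrightarrow> T f \<in> borel_measurable \<mu>"
    and K0: "K0 > 0" "\<And>f. f \<in> Ap p \<omega> \<Longrightarrow> Lq_integral q \<mu> (T f) \<le> ennreal K0 * (\<integral>\<^sup>+b. avg q f b \<partial>\<nu>)"
    and diff: "\<And>f g z. z \<in> Bn \<Longrightarrow> T (\<lambda>z. f z - g z) z = T f z - T g z"
    and lim: "\<And>fs F z. (\<And>w. w \<in> Bn \<Longrightarrow> (\<lambda>k. fs k w) \<longlonglongrightarrow> F w) \<Longrightarrow> z \<in> Bn \<Longrightarrow> (\<lambda>k. T (fs k) z) \<longlonglongrightarrow> T F z"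
    and van: "vanishing_carleson p q \<omega> \<nu>"
  shows "compact_Ap_Lq p q \<omega> \<mu> T"
proof -
  have q: "q > 0" using pq by simp
  define J where "J = (\<lambda>f :: complex ^ 'n \<Rightarrow> complex. enn2real (wint p \<omega> f))"
  have J0: "J f \<ge> 0" for f by (simp add: J_def)
  \<comment> \<open>The bound with epsilon = 1 suffices here, with the supremum of f on the inner
    ball supplied by local boundedness.\<close>
  have inLq: "in_Lq q \<mu> (T f)" if f: "f \<in> Ap p \<omega>" for f
  proof -
    obtain c R where cR: "c \<ge> 0" "R < 1" "\<And>f e. f \<in> Ap p \<omega> \<Longrightarrow> e \<ge> 0 \<Longrightarrow> (\<And>z. norm z \<le> R \<Longrightarrow> norm (f z) \<le> e) \<Longrightarrow>
      (\<integral>\<^sup>+b. avg q f b \<partial>\<nu>) \<le> ennreal (c * e powr q + 1 * J f powr (q / p))"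
      using vanishing_avg_bound[OF \<omega> pq \<nu> van zero_less_one] unfolding J_def by blast
    obtain M where M: "M \<ge> 0" "\<And>(f :: complex ^ 'n \<Rightarrow> complex) z. f \<in> Ap p \<omega> \<Longrightarrow> norm z \<le> R \<Longrightarrow> norm (f z) \<le> M * J f powr (1 / p)"
      using locally_bounded_Ap[OF \<omega> pq(1) cR(2)] unfolding J_def by blast
    have "(\<integral>\<^sup>+b. avg q f b \<partial>\<nu>) \<le> ennreal (c * (M * J f powr (1 / p)) powr q + 1 * J f powr (q / p))"
      using M(1) M(2)[OF f] by (intro cR(3) f) auto
    then have "(\<integral>\<^sup>+b. avg q f b \<partial>\<nu>) < top" by (rule le_less_trans) simp
    then have "ennreal K0 * (\<integral>\<^sup>+b. avg q f b \<partial>\<nu>) < top" by (simp add: ennreal_mult_less_top)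
    then have "Lq_integral q \<mu> (T f) < \<infinity>" using K0(2)[OF f] by (simp add: le_less_trans)
    then show ?thesis using meas[OF f] by (simp add: in_Lq_def)
  qed
  show ?thesis
    unfolding compact_Ap_Lq_def
  proof (intro conjI ballI allI impI inLq)
    fix fs :: "nat \<Rightarrow> complex ^ 'n \<Rightarrow> complex"
    assume *: "(\<forall>k. fs k \<in> Ap p \<omega>) \<and> bounded (range (\<lambda>k. Ap_norm p \<omega> (fs k)))"
    then have fs: "fs k \<in> Ap p \<omega>" for k by blast
    have v: "volB TYPE('n) > 0" by (rule volB_pos)
    obtain b where b: "\<And>k. norm (Ap_norm p \<omega> (fs k)) \<le> b" using * unfolding bounded_iff by blast
    have Jb: "J (fs k) \<le> volB TYPE('n) * b powr p" for k
    proof -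
      have "(1 * Ap_norm p \<omega> (fs k)) powr p = 1 powr p * (1 / volB TYPE('n)) powr (p / p) * J (fs k) powr (p / p)"
        unfolding J_def using fs[of k] by (intro Ap_norm_powr[OF \<omega> _ _ pq(1)]) (auto simp: Ap_iff_wint[OF \<omega>])
      then have "J (fs k) = volB TYPE('n) * Ap_norm p \<omega> (fs k) powr p"
        using pq v J0[of "fs k"] by (simp add: field_simps)
      also have "\<dots> \<le> volB TYPE('n) * b powr p"
        using b[of k] v pq by (intro mult_left_mono powr_mono2) (auto simp: Ap_norm_def)
      finally show ?thesis .
    qed
    obtain s :: "nat \<Rightarrow> nat" and F where s: "strict_mono s"
      and F: "\<And>R e. R < 1 \<Longrightarrow> e > 0 \<Longrightarrow> \<exists>N. \<forall>k\<ge>N. \<forall>z. norm z \<le> R \<longrightarrow> norm (fs (s k) z - F z) < e"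
      by (rule Ap_montel[OF \<omega> pq(1) fs Jb[unfolded J_def]]) (erule that, assumption)
    have Flim: "(\<lambda>k. fs (s k) z) \<longlonglongrightarrow> F z" if z: "z \<in> Bn" for z
    proof (rule LIMSEQ_I)
      fix e :: real assume "e > 0"
      then obtain N where "\<forall>k\<ge>N. \<forall>w. norm w \<le> norm z \<longrightarrow> norm (fs (s k) w - F w) < e"
        using F[of "norm z" e] z by (auto simp: mem_Bn_iff)
      then show "\<exists>N. \<forall>k\<ge>N. norm (fs (s k) z - F z) < e" by blast
    qed
    have Tlim: "(\<lambda>k. T (fs (s k)) z) \<longlonglongrightarrow> T F z" if "z \<in> Bn" for z
      using Flim that by (rule lim)
    have TF [measurable]: "T F \<in> borel_measurable \<mu>"
      by (rule borel_measurable_LIMSEQ_metric[of "\<lambda>k. T (fs (s k))"]) (use meas fs Tlim \<mu> in auto)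
    \<comment> \<open>A bound for the (q/p)-th power of the weighted integral of f_j - f_k, uniform
      in j and k.\<close>
    define Jd where "Jd = (2 powr p * (2 * (volB TYPE('n) * b powr p))) powr (q / p)"
    have Jd: "Jd \<ge> 0" by (simp add: Jd_def)
    have cauchy: "\<exists>N. \<forall>j\<ge>N. \<forall>k\<ge>N. Lq_integral q \<mu> (T (\<lambda>z. fs (s j) z - fs (s k) z)) \<le> ennreal \<delta>" if \<delta>: "\<delta> > 0" for \<delta>
    proof -
      have cancel: "x * (\<delta> / (2 * K0 * x)) = \<delta> / (2 * K0)" if "x > 0" for x
        using that by simp
      \<comment> \<open>\<open>\<epsilon>\<close> and \<open>e\<close> are fixed so that each of the
        two terms contributes at most delta / (2 K0); the summands 1 in Jd + 1 and c + 1 avoid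
        division by zero.\<close>
      define \<epsilon> where "\<epsilon> = \<delta> / (2 * K0 * (Jd + 1))"
      have \<epsilon>: "\<epsilon> > 0" using \<delta> K0(1) Jd by (simp add: \<epsilon>_def)
      obtain c R where cR: "c \<ge> 0" "R < 1" "\<And>f e. f \<in> Ap p \<omega> \<Longrightarrow> e \<ge> 0 \<Longrightarrow> (\<And>z. norm z \<le> R \<Longrightarrow> norm (f z) \<le> e) \<Longrightarrow>
        (\<integral>\<^sup>+b. avg q f b \<partial>\<nu>) \<le> ennreal (c * e powr q + \<epsilon> * J f powr (q / p))"
        using vanishing_avg_bound[OF \<omega> pq \<nu> van \<epsilon>] unfolding J_def by blast
      define e where "e = (\<delta> / (2 * K0 * (c + 1))) powr (1 / q)"
      have e: "e > 0" using \<delta> K0(1) cR(1) by (simp add: e_def)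
      have eq: "e powr q = \<delta> / (2 * K0 * (c + 1))" unfolding e_def powr_powr using \<delta> K0(1) cR(1) q by simp
      obtain N where N: "\<And>k z. k \<ge> N \<Longrightarrow> norm z \<le> R \<Longrightarrow> norm (fs (s k) z - F z) < e / 2"
        using F[OF cR(2), of "e / 2"] e by auto
      have "Lq_integral q \<mu> (T (\<lambda>z. fs (s j) z - fs (s k) z)) \<le> ennreal \<delta>" if jk: "j \<ge> N" "k \<ge> N" for j k
      proof -
        define h where "h = (\<lambda>z. fs (s j) z - fs (s k) z)"
        have h: "h \<in> Ap p \<omega>" unfolding h_def by (rule Ap_diff[OF \<omega> pq(1) fs fs])
        have "J h \<le> 2 powr p * (J (fs (s j)) + J (fs (s k)))" unfolding h_def J_def by (rule Ap_diff[OF \<omega> pq(1) fs fs])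
        also have "\<dots> \<le> 2 powr p * (2 * (volB TYPE('n) * b powr p))"
          using Jb[of "s j"] Jb[of "s k"] by (intro mult_left_mono) auto
        finally have Jh: "J h powr (q / p) \<le> Jd" unfolding Jd_def using J0 pq by (intro powr_mono2) auto
        have "norm (h z) \<le> e" if "norm z \<le> R" for z
          using norm_triangle_ineq4[of "fs (s j) z - F z" "fs (s k) z - F z"] N[OF jk(1) that] N[OF jk(2) that]
          by (simp add: h_def)
        then have "(\<integral>\<^sup>+b. avg q h b \<partial>\<nu>) \<le> ennreal (c * e powr q + \<epsilon> * J h powr (q / p))"
          using e by (intro cR(3) h) auto
        also have "\<dots> \<le> ennreal (\<delta> / K0)"
        proof (rule ennreal_leI)
          have "c * e powr q \<le> (c + 1) * e powr q" by (intro mult_right_mono) auto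
          also have "\<dots> = \<delta> / (2 * K0)" unfolding eq by (rule cancel) (use cR(1) in simp)
          finally have 1: "c * e powr q \<le> \<delta> / (2 * K0)" .
          have "\<epsilon> * J h powr (q / p) \<le> \<epsilon> * (Jd + 1)" using Jh \<epsilon> by (intro mult_left_mono) auto
          also have "\<dots> = \<delta> / (2 * K0)" using cancel[of "Jd + 1"] Jd by (simp add: \<epsilon>_def mult.commute)
          finally have 2: "\<epsilon> * J h powr (q / p) \<le> \<delta> / (2 * K0)" .
          have "\<delta> / (2 * K0) + \<delta> / (2 * K0) = \<delta> / K0" using K0(1) by (simp add: field_simps)
          with 1 2 show "c * e powr q + \<epsilon> * J h powr (q / p) \<le> \<delta> / K0" by linarith
        qed
        finally have "ennreal K0 * (\<integral>\<^sup>+b. avg q h b \<partial>\<nu>) \<le> ennreal K0 * ennreal (\<delta> / K0)" by (rule mult_left_mono) simp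
        also have "\<dots> = ennreal \<delta>" using K0(1) \<delta> by (simp add: ennreal_mult'[symmetric])
        finally show ?thesis using K0(2)[OF h] unfolding h_def by (rule order_trans[rotated])
      qed
      then show ?thesis by blast
    qed
    have conv: "\<exists>N. \<forall>j\<ge>N. Lq_integral q \<mu> (\<lambda>z. T (fs (s j)) z - T F z) \<le> ennreal \<delta>" if \<delta>: "\<delta> > 0" for \<delta>
    proof -
      obtain N where N: "\<And>j k. j \<ge> N \<Longrightarrow> k \<ge> N \<Longrightarrow> Lq_integral q \<mu> (T (\<lambda>z. fs (s j) z - fs (s k) z)) \<le> ennreal \<delta>"
        using cauchy[OF \<delta>] by blast
      have "Lq_integral q \<mu> (\<lambda>z. T (fs (s j)) z - T F z) \<le> ennreal \<delta>" if j: "j \<ge> N" for j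
      proof -
        note [measurable] = meas[OF fs]
        \<comment> \<open>With j fixed, \<open>D k z\<close> converges to |T f_j - T F|^q at every
          point of the ball. The shift by \<open>N\<close> places every index in the range of the
          Cauchy estimate, so all its integrals are at most delta.\<close>
        define D where "D = (\<lambda>k z. ennreal (norm (T (fs (s j)) z - T (fs (s (k + N))) z) powr q))"
        have "Lq_integral q \<mu> (\<lambda>z. T (fs (s j)) z - T F z) = (\<integral>\<^sup>+z. liminf (\<lambda>k. D k z) \<partial>\<mu>)"
          unfolding Lq_integral_def
        proof (rule nn_integral_cong)
          fix z assume "z \<in> space \<mu>"
          then have z: "z \<in> Bn" by (simp add: \<mu>)
          have "(\<lambda>k. T (fs (s (k + N))) z) \<longlonglongrightarrow> T F z" using Tlim[OF z] by (rule LIMSEQ_ignore_initial_segment)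
          then have "(\<lambda>k. D k z) \<longlonglongrightarrow> ennreal (norm (T (fs (s j)) z - T F z) powr q)"
            unfolding D_def using q by (intro tendsto_ennrealI tendsto_powr' tendsto_norm tendsto_diff tendsto_const) auto
          then show "ennreal (norm (T (fs (s j)) z - T F z) powr q) = liminf (\<lambda>k. D k z)"
            by (intro lim_imp_Liminf[symmetric]) auto
        qed
        also have "\<dots> \<le> liminf (\<lambda>k. \<integral>\<^sup>+z. D k z \<partial>\<mu>)"
          by (rule nn_integral_liminf) (simp add: D_def)
        also have "\<dots> \<le> liminf (\<lambda>k::nat. ennreal \<delta>)"
        proof (intro Liminf_mono always_eventually allI)
          fix k
          have "(\<integral>\<^sup>+z. D k z \<partial>\<mu>) = Lq_integral q \<mu> (T (\<lambda>z. fs (s j) z - fs (s (k + N)) z))"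
            unfolding Lq_integral_def D_def by (intro nn_integral_cong) (simp add: \<mu> diff)
          then show "(\<integral>\<^sup>+z. D k z \<partial>\<mu>) \<le> ennreal \<delta>" using N[OF j, of "k + N"] by simp
        qed
        also have "\<dots> = ennreal \<delta>" by (simp add: Liminf_const)
        finally show ?thesis .
      qed
      then show ?thesis by blast
    qed
    have "in_Lq q \<mu> (T F)"
    proof -
      note [measurable] = meas[OF fs]
      \<comment> \<open>T F differs from some T f_j in L^q by a function with finite integral, so
        the quasi-triangle inequality puts T F itself into L^q.\<close>
      obtain j where j: "Lq_integral q \<mu> (\<lambda>z. T (fs (s j)) z - T F z) \<le> ennreal 1" using conv[of 1] by auto
      have "Lq_integral q \<mu> (T F) \<le> (\<integral>\<^sup>+z. ennreal (2 powr q) * (ennreal (norm (T (fs (s j)) z) powr q) + ennreal (norm (T (fs (s j)) z - T F z) powr q)) \<partial>\<mu>)"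
        unfolding Lq_integral_def
      proof (rule nn_integral_mono)
        fix z
        have "norm (T F z) powr q \<le> (norm (T (fs (s j)) z) + norm (T (fs (s j)) z - T F z)) powr q"
          using q norm_triangle_ineq4[of "T (fs (s j)) z" "T (fs (s j)) z - T F z"] by (intro powr_mono2) auto
        also have "\<dots> \<le> 2 powr q * (norm (T (fs (s j)) z) powr q + norm (T (fs (s j)) z - T F z) powr q)"
          using q by (intro powr_add_le) auto
        finally show "ennreal (norm (T F z) powr q) \<le> ennreal (2 powr q) * (ennreal (norm (T (fs (s j)) z) powr q) + ennreal (norm (T (fs (s j)) z - T F z) powr q))"
          by (simp add: ennreal_mult'[symmetric] ennreal_plus[symmetric] ennreal_leI del: ennreal_plus)
      qed
      also have "\<dots> = ennreal (2 powr q) * (Lq_integral q \<mu> (T (fs (s j))) + Lq_integral q \<mu> (\<lambda>z. T (fs (s j)) z - T F z))"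
        unfolding Lq_integral_def by (simp add: nn_integral_cmult nn_integral_add)
      also have "\<dots> < \<infinity>"
        using inLq[OF fs[of "s j"]] le_less_trans[OF j ennreal_less_top] by (simp add: in_Lq_def ennreal_mult_less_top)
      finally show ?thesis using TF by (simp add: in_Lq_def)
    qed
    moreover have "(\<lambda>k. Lq_integral q \<mu> (\<lambda>z. T (fs (s k)) z - T F z)) \<longlonglongrightarrow> 0"
    proof (rule order_tendstoI)
      fix a :: ennreal assume "0 < a"
      then obtain x where x: "0 < x" "x < a" using dense by blast
      then obtain \<delta> where \<delta>: "x = ennreal \<delta>" "\<delta> > 0" by (cases x) auto
      obtain N where "\<forall>j\<ge>N. Lq_integral q \<mu> (\<lambda>z. T (fs (s j)) z - T F z) \<le> ennreal \<delta>" using conv[OF \<delta>(2)] by blast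
      then show "\<forall>\<^sub>F k in sequentially. Lq_integral q \<mu> (\<lambda>z. T (fs (s k)) z - T F z) < a"
        using x(2) unfolding \<delta>(1) eventually_sequentially by (meson le_less_trans)
    qed simp
    ultimately show "\<exists>(s :: nat \<Rightarrow> nat) g. strict_mono s \<and> in_Lq q \<mu> g \<and> (\<lambda>k. Lq_integral q \<mu> (\<lambda>z. T (fs (s k)) z - g z)) \<longlonglongrightarrow> 0"
      using s by blast
  qed
qed

section \<open>Difference of weighted composition operators\<close>

lemma sets_push [simp]: "sets (push \<mu> g F) = sets (restrict_space borel Bn)"
  by (simp add: push_def)

lemma nn_integral_push:
  assumes "g \<in> borel_measurable \<mu>" "F \<in> \<mu> \<rightarrow>\<^sub>M restrict_space borel Bn" "h \<in> borel_measurable borel"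
  shows "(\<integral>\<^sup>+b. h b \<partial>push \<mu> g F) = (\<integral>\<^sup>+z. ennreal (g z) * h (F z) \<partial>\<mu>)"
proof -
  have h: "h \<in> borel_measurable (restrict_space borel Bn)" using assms(3) by (rule measurable_restrict_space1)
  have "(\<integral>\<^sup>+b. h b \<partial>push \<mu> g F) = (\<integral>\<^sup>+z. h (F z) \<partial>density \<mu> (\<lambda>z. ennreal (g z)))"
    unfolding push_def by (rule nn_integral_distr) (use assms(2) h in simp_all)
  also have "\<dots> = (\<integral>\<^sup>+z. ennreal (g z) * h (F z) \<partial>\<mu>)"
    using assms(1) measurable_compose[OF assms(2) h] by (subst nn_integral_density) auto
  finally show ?thesis .
qed

lemma holo_self_map_measurable:
  fixes \<phi> :: "complex ^ 'n::finite \<Rightarrow> complex ^ 'n"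
  assumes \<phi>: "holo_self_map \<phi>" and \<mu>: "sets \<mu> = sets (restrict_space borel Bn)"
  shows "\<phi> \<in> \<mu> \<rightarrow>\<^sub>M restrict_space borel Bn"
proof -
  have "continuous_on Bn \<phi>"
    using \<phi> unfolding holo_self_map_def holo_map_def
    by (meson continuous_at_imp_continuous_on has_derivative_continuous)
  then have "\<phi> \<in> borel_measurable (restrict_space borel Bn)"
    by (rule borel_measurable_continuous_on_restrict)
  then have "\<phi> \<in> restrict_space borel Bn \<rightarrow>\<^sub>M restrict_space borel Bn"
    using \<phi> by (intro measurable_restrict_space2) (auto simp: holo_self_map_def space_restrict_space)
  then show ?thesis using measurable_cong_sets[OF \<mu> refl] by blast
qed

text \<open>The identity for 1 - rho^2 expresses rho through continuous functions of both points,
  which bypasses the case distinction at a = 0 in \<open>ball_aut\<close>.\<close>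

lemma pseudo_hyp_measurable:
  fixes \<phi> \<psi> :: "complex ^ 'n::finite \<Rightarrow> complex ^ 'n"
  assumes \<phi>: "\<phi> \<in> \<mu> \<rightarrow>\<^sub>M restrict_space borel Bn" and \<psi>: "\<psi> \<in> \<mu> \<rightarrow>\<^sub>M restrict_space borel Bn"
  shows "(\<lambda>z. pseudo_hyp (\<phi> z) (\<psi> z)) \<in> borel_measurable \<mu>"
proof -
  have B: "norm (\<phi> z) < 1" "norm (\<psi> z) < 1" if "z \<in> space \<mu>" for z
    using measurable_space[OF \<phi> that] measurable_space[OF \<psi> that] by (auto simp: space_restrict_space mem_Bn_iff)
  have [measurable]: "\<phi> \<in> borel_measurable \<mu>" "\<psi> \<in> borel_measurable \<mu>"
    using \<phi> \<psi> by (auto simp: measurable_restrict_space2_iff)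
  have "continuous_on UNIV (\<lambda>x :: (complex ^ 'n) \<times> (complex ^ 'n). cinner (fst x) (snd x))"
    by (intro continuous_intros)
  then have "(\<lambda>x :: (complex ^ 'n) \<times> (complex ^ 'n). cinner (fst x) (snd x)) \<in> borel_measurable (borel \<Otimes>\<^sub>M borel)"
    unfolding borel_prod by (rule borel_measurable_continuous_onI)
  from measurable_compose[OF _ this, of "\<lambda>z. (\<psi> z, \<phi> z)" \<mu>]
  have [measurable]: "(\<lambda>z. cinner (\<psi> z) (\<phi> z)) \<in> borel_measurable \<mu>" by simp
  have eq: "pseudo_hyp (\<phi> z) (\<psi> z) = sqrt (1 - (1 - (norm (\<phi> z))\<^sup>2) * (1 - (norm (\<psi> z))\<^sup>2) / (norm (1 - cinner (\<psi> z) (\<phi> z)))\<^sup>2)"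
    if "z \<in> space \<mu>" for z
    unfolding one_minus_pseudo_hyp_sq[OF B[OF that], symmetric] by (simp add: pseudo_hyp_def)
  show ?thesis
    by (subst measurable_cong[OF eq]) measurable
qed

lemma wcd_integral_le:
  assumes r: "0 < r" and q: "0 < q"
  obtains K where "K > 0" "\<And>(\<mu> :: (complex ^ 'n::finite) measure) \<phi> \<psi> u v f.
    \<lbrakk>\<phi> \<in> \<mu> \<rightarrow>\<^sub>M restrict_space borel Bn; \<psi> \<in> \<mu> \<rightarrow>\<^sub>M restrict_space borel Bn; space \<mu> = Bn;
     u \<in> borel_measurable \<mu>; v \<in> borel_measurable \<mu>; holo_scalar f Bn\<rbrakk> \<Longrightarrow>
    Lq_integral q \<mu> (wcd u \<phi> v \<psi> f) \<le> ennreal K *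
      ((\<integral>\<^sup>+z. ennreal (norm (complex_of_real (pseudo_hyp (\<phi> z) (\<psi> z)) * u z) powr q) * avg q f (\<phi> z) \<partial>\<mu>)
     + (\<integral>\<^sup>+z. ennreal (norm (complex_of_real (pseudo_hyp (\<phi> z) (\<psi> z)) * v z) powr q) * avg q f (\<psi> z) \<partial>\<mu>)
     + (\<integral>\<^sup>+z. ennreal (indicator {z \<in> Bn. pseudo_hyp (\<phi> z) (\<psi> z) < r} z * norm (u z - v z) powr q) * avg q f (\<phi> z) \<partial>\<mu>))"
proof -
  obtain K where K: "K > 0" "\<And>(f :: complex ^ 'n::finite \<Rightarrow> complex) a b u v. holo_scalar f Bn \<Longrightarrow> a \<in> Bn \<Longrightarrow> b \<in> Bn \<Longrightarrow>
     ennreal (norm (u * f a - v * f b) powr q) \<le> ennreal K *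
       (ennreal ((pseudo_hyp a b * norm u) powr q) * avg q f a + ennreal ((pseudo_hyp a b * norm v) powr q) * avg q f b
        + ennreal ((if pseudo_hyp a b < r then 1 else 0) * norm (u - v) powr q) * avg q f a)"
    using wcd_pointwise_le[OF r q, where 'n='n] by blast
  show ?thesis
  proof (rule that[OF K(1)])
    fix \<mu> :: "(complex ^ 'n) measure" and \<phi> \<psi> :: "complex ^ 'n \<Rightarrow> complex ^ 'n" and u v f :: "complex ^ 'n \<Rightarrow> complex"
    assume \<phi>: "\<phi> \<in> \<mu> \<rightarrow>\<^sub>M restrict_space borel Bn" and \<psi>: "\<psi> \<in> \<mu> \<rightarrow>\<^sub>M restrict_space borel Bn" and \<mu>: "space \<mu> = Bn"
      and [measurable]: "u \<in> borel_measurable \<mu>" "v \<in> borel_measurable \<mu>" and f: "holo_scalar f Bn"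
    note [measurable] = pseudo_hyp_measurable[OF \<phi> \<psi>]
    have B: "\<phi> z \<in> Bn" "\<psi> z \<in> Bn" if "z \<in> space \<mu>" for z
      using measurable_space[OF \<phi> that] measurable_space[OF \<psi> that] by (auto simp: space_restrict_space)
    have h: "avg q f \<in> borel_measurable (restrict_space borel Bn)"
      using avg_measurable[OF f] by (rule measurable_restrict_space1)
    note [measurable] = measurable_compose[OF \<phi> h] measurable_compose[OF \<psi> h]
    define I where "I = (\<lambda>z. (if pseudo_hyp (\<phi> z) (\<psi> z) < r then 1 else 0 :: real))"
    have [measurable]: "I \<in> borel_measurable \<mu>" unfolding I_def by measurable
    have "Lq_integral q \<mu> (wcd u \<phi> v \<psi> f) \<le> (\<integral>\<^sup>+z. ennreal K *
       (ennreal ((pseudo_hyp (\<phi> z) (\<psi> z) * norm (u z)) powr q) * avg q f (\<phi> z) + ennreal ((pseudo_hyp (\<phi> z) (\<psi> z) * norm (v z)) powr q) * avg q f (\<psi> z)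
        + ennreal (I z * norm (u z - v z) powr q) * avg q f (\<phi> z)) \<partial>\<mu>)"
      unfolding Lq_integral_def wcd_def I_def by (intro nn_integral_mono K(2) f B)
    also have "\<dots> = ennreal K * ((\<integral>\<^sup>+z. ennreal ((pseudo_hyp (\<phi> z) (\<psi> z) * norm (u z)) powr q) * avg q f (\<phi> z) \<partial>\<mu>)
      + (\<integral>\<^sup>+z. ennreal ((pseudo_hyp (\<phi> z) (\<psi> z) * norm (v z)) powr q) * avg q f (\<psi> z) \<partial>\<mu>)
      + (\<integral>\<^sup>+z. ennreal (I z * norm (u z - v z) powr q) * avg q f (\<phi> z) \<partial>\<mu>))"
      by (simp add: nn_integral_cmult nn_integral_add)
    also have "(\<integral>\<^sup>+z. ennreal (I z * norm (u z - v z) powr q) * avg q f (\<phi> z) \<partial>\<mu>)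
      = (\<integral>\<^sup>+z. ennreal (indicator {z \<in> Bn. pseudo_hyp (\<phi> z) (\<psi> z) < r} z * norm (u z - v z) powr q) * avg q f (\<phi> z) \<partial>\<mu>)"
      by (intro nn_integral_cong) (auto simp: I_def indicator_def \<mu>)
    finally show "Lq_integral q \<mu> (wcd u \<phi> v \<psi> f) \<le> ennreal K *
      ((\<integral>\<^sup>+z. ennreal (norm (complex_of_real (pseudo_hyp (\<phi> z) (\<psi> z)) * u z) powr q) * avg q f (\<phi> z) \<partial>\<mu>)
     + (\<integral>\<^sup>+z. ennreal (norm (complex_of_real (pseudo_hyp (\<phi> z) (\<psi> z)) * v z) powr q) * avg q f (\<psi> z) \<partial>\<mu>)
     + (\<integral>\<^sup>+z. ennreal (indicator {z \<in> Bn. pseudo_hyp (\<phi> z) (\<psi> z) < r} z * norm (u z - v z) powr q) * avg q f (\<phi> z) \<partial>\<mu>))"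
      by (simp add: norm_mult pseudo_hyp_def)
  qed
qed

theorem theorem4p1:
  fixes r p q :: real
    and \<omega> :: "real \<Rightarrow> real"
    and \<phi> \<psi> :: "complex ^ 'n::finite \<Rightarrow> complex ^ 'n"
    and u v :: "complex ^ 'n \<Rightarrow> complex"
    and \<mu> :: "(complex ^ 'n) measure"
  assumes r: "0 < r" "r < 1"
    and pq: "0 < p" "p \<le> q"
    and \<omega>: "D_class TYPE('n) \<omega>"
    and \<phi>: "holo_self_map \<phi>" and \<psi>: "holo_self_map \<psi>"
    and u: "u \<in> borel_measurable (restrict_space borel Bn)"
    and v: "v \<in> borel_measurable (restrict_space borel Bn)"
    and \<mu>: "sets \<mu> = sets (restrict_space borel (Bn :: (complex ^ 'n) set))"
  defines "\<eta> \<equiv> measure_plus (push \<mu> (\<lambda>z. norm (complex_of_real (pseudo_hyp (\<phi> z) (\<psi> z)) * u z) powr q) \<phi>)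
                             (push \<mu> (\<lambda>z. norm (complex_of_real (pseudo_hyp (\<phi> z) (\<psi> z)) * v z) powr q) \<psi>)"
    and "\<sigma>\<phi> \<equiv> push \<mu> (\<lambda>z. indicator {z \<in> Bn. pseudo_hyp (\<phi> z) (\<psi> z) < r} z * norm (u z - v z) powr q) \<phi>"
    and "\<sigma>\<psi> \<equiv> push \<mu> (\<lambda>z. indicator {z \<in> Bn. pseudo_hyp (\<phi> z) (\<psi> z) < r} z * norm (u z - v z) powr q) \<psi>"
  shows "(carleson p q \<omega> (measure_plus \<eta> \<sigma>\<phi>) \<or> carleson p q \<omega> (measure_plus \<eta> \<sigma>\<psi>)
            \<longrightarrow> bounded_Ap_Lq p q \<omega> \<mu> (wcd u \<phi> v \<psi>))
       \<and> (vanishing_carleson p q \<omega> (measure_plus \<eta> \<sigma>\<phi>) \<or> vanishing_carleson p q \<omega> (measure_plus \<eta> \<sigma>\<psi>)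
            \<longrightarrow> compact_Ap_Lq p q \<omega> \<mu> (wcd u \<phi> v \<psi>))"
proof -
  have q: "q > 0" using pq by simp
  have sp: "space \<mu> = Bn" by (rule space_restrict_Bn[OF \<mu>])
  have \<phi>m: "\<phi> \<in> \<mu> \<rightarrow>\<^sub>M restrict_space borel Bn" and \<psi>m: "\<psi> \<in> \<mu> \<rightarrow>\<^sub>M restrict_space borel Bn"
    using holo_self_map_measurable[OF \<phi> \<mu>] holo_self_map_measurable[OF \<psi> \<mu>] by auto
  have um [measurable]: "u \<in> borel_measurable \<mu>" and vm [measurable]: "v \<in> borel_measurable \<mu>"
    using u v measurable_cong_sets[OF \<mu> refl, of "borel :: complex measure"] by auto
  note \<rho>m [measurable] = pseudo_hyp_measurable[OF \<phi>m \<psi>m]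
  have B: "\<phi> z \<in> Bn" "\<psi> z \<in> Bn" if "z \<in> Bn" for z
    using \<phi> \<psi> that by (auto simp: holo_self_map_def)
  define g1 where "g1 = (\<lambda>z. norm (complex_of_real (pseudo_hyp (\<phi> z) (\<psi> z)) * u z) powr q)"
  define g2 where "g2 = (\<lambda>z. norm (complex_of_real (pseudo_hyp (\<phi> z) (\<psi> z)) * v z) powr q)"
  define g3 where "g3 = (\<lambda>z. indicator {z \<in> Bn. pseudo_hyp (\<phi> z) (\<psi> z) < r} z * norm (u z - v z) powr q)"
  have "{z \<in> space \<mu>. pseudo_hyp (\<phi> z) (\<psi> z) < r} \<in> sets \<mu>" by measurable
  then have [measurable]: "{z \<in> Bn. pseudo_hyp (\<phi> z) (\<psi> z) < r} \<in> sets \<mu>" by (simp add: sp)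
  have g: "g1 \<in> borel_measurable \<mu>" "g2 \<in> borel_measurable \<mu>" "g3 \<in> borel_measurable \<mu>"
    unfolding g1_def g2_def g3_def by measurable
  obtain K where K: "K > 0" and wcd_le: "\<And>(\<mu> :: (complex ^ 'n) measure) \<phi> \<psi> u v f.
    \<lbrakk>\<phi> \<in> \<mu> \<rightarrow>\<^sub>M restrict_space borel Bn; \<psi> \<in> \<mu> \<rightarrow>\<^sub>M restrict_space borel Bn; space \<mu> = Bn;
     u \<in> borel_measurable \<mu>; v \<in> borel_measurable \<mu>; holo_scalar f Bn\<rbrakk> \<Longrightarrow>
    Lq_integral q \<mu> (wcd u \<phi> v \<psi> f) \<le> ennreal K *
      ((\<integral>\<^sup>+z. ennreal (norm (complex_of_real (pseudo_hyp (\<phi> z) (\<psi> z)) * u z) powr q) * avg q f (\<phi> z) \<partial>\<mu>)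
     + (\<integral>\<^sup>+z. ennreal (norm (complex_of_real (pseudo_hyp (\<phi> z) (\<psi> z)) * v z) powr q) * avg q f (\<psi> z) \<partial>\<mu>)
     + (\<integral>\<^sup>+z. ennreal (indicator {z \<in> Bn. pseudo_hyp (\<phi> z) (\<psi> z) < r} z * norm (u z - v z) powr q) * avg q f (\<phi> z) \<partial>\<mu>))"
    by (rule wcd_integral_le[OF r(1) q, where 'n='n]) (erule that, assumption)
  have \<nu>: "sets (measure_plus \<eta> \<sigma>\<phi>) = sets (restrict_space borel Bn)" "sets (measure_plus \<eta> \<sigma>\<psi>) = sets (restrict_space borel Bn)"
    by (simp_all add: \<eta>_def \<sigma>\<phi>_def \<sigma>\<psi>_def)
  \<comment> \<open>Kept general in the map \<open>\<Phi>\<close>, which is \<open>\<phi>\<close>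
    for one choice of sigma and \<open>\<psi>\<close> for the other.\<close>
  have int_avg: "(\<integral>\<^sup>+b. avg q f b \<partial>measure_plus \<eta> (push \<mu> g3 \<Phi>))
      = (\<integral>\<^sup>+z. ennreal (g1 z) * avg q f (\<phi> z) \<partial>\<mu>) + (\<integral>\<^sup>+z. ennreal (g2 z) * avg q f (\<psi> z) \<partial>\<mu>) + (\<integral>\<^sup>+z. ennreal (g3 z) * avg q f (\<Phi> z) \<partial>\<mu>)"
    if f: "holo_scalar f Bn" and \<Phi>: "\<Phi> \<in> \<mu> \<rightarrow>\<^sub>M restrict_space borel Bn" for f \<Phi>
  proof -
    have m: "avg q f \<in> borel_measurable N" if "sets N = sets (restrict_space borel Bn)" for N
      using measurable_restrict_borel[OF avg_measurable[OF f] that] .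
    have \<eta>: "\<eta> = measure_plus (push \<mu> g1 \<phi>) (push \<mu> g2 \<psi>)" by (simp add: \<eta>_def g1_def g2_def)
    have "(\<integral>\<^sup>+b. avg q f b \<partial>measure_plus \<eta> (push \<mu> g3 \<Phi>)) = (\<integral>\<^sup>+b. avg q f b \<partial>\<eta>) + (\<integral>\<^sup>+b. avg q f b \<partial>push \<mu> g3 \<Phi>)"
      by (rule nn_integral_measure_plus) (simp_all add: \<eta> m)
    also have "(\<integral>\<^sup>+b. avg q f b \<partial>\<eta>) = (\<integral>\<^sup>+b. avg q f b \<partial>push \<mu> g1 \<phi>) + (\<integral>\<^sup>+b. avg q f b \<partial>push \<mu> g2 \<psi>)"
      unfolding \<eta> by (rule nn_integral_measure_plus) (simp_all add: m)
    finally show ?thesis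
      using nn_integral_push[OF g(1) \<phi>m avg_measurable[OF f]] nn_integral_push[OF g(2) \<psi>m avg_measurable[OF f]]
        nn_integral_push[OF g(3) \<Phi> avg_measurable[OF f]] by simp
  qed
  have holo: "holo_scalar f Bn" if "f \<in> Ap p \<omega>" for f :: "complex ^ 'n \<Rightarrow> complex"
    using that by (simp add: Ap_def)
  have bound\<phi>: "Lq_integral q \<mu> (wcd u \<phi> v \<psi> f) \<le> ennreal K * (\<integral>\<^sup>+b. avg q f b \<partial>measure_plus \<eta> \<sigma>\<phi>)" if "f \<in> Ap p \<omega>" for f
    using wcd_le[OF \<phi>m \<psi>m sp um vm holo[OF that]] int_avg[OF holo[OF that] \<phi>m]
    by (simp add: \<sigma>\<phi>_def g1_def g2_def g3_def)
  have bound\<psi>: "Lq_integral q \<mu> (wcd u \<phi> v \<psi> f) \<le> ennreal K * (\<integral>\<^sup>+b. avg q f b \<partial>measure_plus \<eta> \<sigma>\<psi>)" if "f \<in> Ap p \<omega>" for f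
  proof -
    have com: "pseudo_hyp (\<psi> z) (\<phi> z) = pseudo_hyp (\<phi> z) (\<psi> z)" if "z \<in> Bn" for z
      using B[OF that] by (intro pseudo_hyp_commute) (auto simp: mem_Bn_iff)
    \<comment> \<open>Exchanging the pair (u, phi) with (v, psi) only changes the sign of the
      difference. By symmetry of the pseudohyperbolic distance the two parts of eta trade places,
      and sigma is now pushed forward by \<open>\<psi>\<close>.\<close>
    have "Lq_integral q \<mu> (wcd u \<phi> v \<psi> f) = Lq_integral q \<mu> (wcd v \<psi> u \<phi> f)"
      unfolding Lq_integral_def wcd_def by (simp add: norm_minus_commute)
    also have "\<dots> \<le> ennreal K *
      ((\<integral>\<^sup>+z. ennreal (norm (complex_of_real (pseudo_hyp (\<psi> z) (\<phi> z)) * v z) powr q) * avg q f (\<psi> z) \<partial>\<mu>)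
     + (\<integral>\<^sup>+z. ennreal (norm (complex_of_real (pseudo_hyp (\<psi> z) (\<phi> z)) * u z) powr q) * avg q f (\<phi> z) \<partial>\<mu>)
     + (\<integral>\<^sup>+z. ennreal (indicator {z \<in> Bn. pseudo_hyp (\<psi> z) (\<phi> z) < r} z * norm (v z - u z) powr q) * avg q f (\<psi> z) \<partial>\<mu>))"
      by (rule wcd_le[OF \<psi>m \<phi>m sp vm um holo[OF that]])
    also have "(\<integral>\<^sup>+z. ennreal (norm (complex_of_real (pseudo_hyp (\<psi> z) (\<phi> z)) * v z) powr q) * avg q f (\<psi> z) \<partial>\<mu>) = (\<integral>\<^sup>+z. ennreal (g2 z) * avg q f (\<psi> z) \<partial>\<mu>)"
      by (intro nn_integral_cong) (simp add: g2_def sp com)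
    also have "(\<integral>\<^sup>+z. ennreal (norm (complex_of_real (pseudo_hyp (\<psi> z) (\<phi> z)) * u z) powr q) * avg q f (\<phi> z) \<partial>\<mu>) = (\<integral>\<^sup>+z. ennreal (g1 z) * avg q f (\<phi> z) \<partial>\<mu>)"
      by (intro nn_integral_cong) (simp add: g1_def sp com)
    also have "(\<integral>\<^sup>+z. ennreal (indicator {z \<in> Bn. pseudo_hyp (\<psi> z) (\<phi> z) < r} z * norm (v z - u z) powr q) * avg q f (\<psi> z) \<partial>\<mu>) = (\<integral>\<^sup>+z. ennreal (g3 z) * avg q f (\<psi> z) \<partial>\<mu>)"
      by (intro nn_integral_cong) (simp add: g3_def sp com indicator_def norm_minus_commute)
    finally show ?thesis
      using int_avg[OF holo[OF that] \<psi>m] by (simp add: \<sigma>\<psi>_def g3_def add_ac)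
  qed
  have meas: "wcd u \<phi> v \<psi> f \<in> borel_measurable \<mu>" if "f \<in> Ap p \<omega>" for f
  proof -
    have "f \<in> borel_measurable (restrict_space borel Bn)"
      using holo_scalar_continuous_on[OF holo[OF that]] by (rule borel_measurable_continuous_on_restrict)
    note [measurable] = measurable_compose[OF \<phi>m this] measurable_compose[OF \<psi>m this]
    show ?thesis unfolding wcd_def by measurable
  qed
  have diff: "wcd u \<phi> v \<psi> (\<lambda>z. f z - h z) z = wcd u \<phi> v \<psi> f z - wcd u \<phi> v \<psi> h z" for f h z
    by (simp add: wcd_def algebra_simps)
  have lim: "(\<lambda>k. wcd u \<phi> v \<psi> (fs k) z) \<longlonglongrightarrow> wcd u \<phi> v \<psi> F z"
    if "\<And>w. w \<in> Bn \<Longrightarrow> (\<lambda>k. fs k w) \<longlonglongrightarrow> F w" "z \<in> Bn" for fs F z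
    unfolding wcd_def using that B by (intro tendsto_intros) auto
  show ?thesis
    using bounded_if_avg_bound[OF \<omega> pq \<nu>(1) meas K bound\<phi>] bounded_if_avg_bound[OF \<omega> pq \<nu>(2) meas K bound\<psi>]
      compact_if_avg_bound[OF \<omega> pq \<nu>(1) sp meas K bound\<phi> diff lim] compact_if_avg_bound[OF \<omega> pq \<nu>(2) sp meas K bound\<psi> diff lim]
    by blast
qed

end
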